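(* Let $0<|q|<1$. With the notation of the context (with $\ell=3$), the following identities hold: $$R_{01}(0) =-1 -3q^3 \frac{(-q^3; q^{6})_{\infty}}{(q^{6}; q^{6})_{\infty}} \sum_{n \in \mathbb{Z}} \frac{(-1)^nq^{6n^2+9n}}{1-q^{6n+4}} + \frac{(q^{6}; q^{6})_{\infty}^4 (-q^3; q^3)_{\infty}^{4} (q; q^2)_{\infty}}{(q^{4}; q^{4})_{\infty} (q^2, q^{10}, q^{12}; q^{12})_{\infty}^2},$$ $$R_{01}(1)=\frac{(-q^3, q^6; q^6)_{\infty}}{(q^2, q^4; q^6)_{\infty}},$$ $$R_{01}(2)=\frac{(q^3; q^3)_{\infty} (-q^6; q^6)_{\infty}}{(q, q^5; q^6)_{\infty} (q^4, q^8; q^{12})_{\infty}}.$$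
   Context: Notation: $(a_1,\dots,a_j;q)_\infty=\prod_{k\ge0}(1-a_1q^k)\cdots(1-a_jq^k)$. A partition without repeated odd parts is a partition of $n$ in which each odd part occurs at most once. For such a partition $\lambda$, its $M_2$-rank is $\lceil l(\lambda)/2\rceil-\nu(\lambda)$, where $l(\lambda)$ is the largest part and $\nu(\lambda)$ the number of parts. For $n\ge1$ let $N_2(m,n)$ be the number of partitions of $n$ without repeated odd parts with $M_2$-rank $m$, and set $N_2(m,0)=0$ for all $m$ (the empty partition is not counted). For a positive integer $\ell$ and an integer $s$, let $N_2(s,\ell,n)=\sum_{m\equiv s \pmod \ell}N_2(m,n)$. Define $R_{st}(d)=\sum_{n\ge0}\big(N_2(s,\ell,\ell n+d)-N_2(t,\ell,\ell n+d)\big)q^n$. Sums over $n\in\mathbb{Z}$ with terms $1/(1-q^{k})$ for negative $k$ are understood as analytic functions in $0<|q|<1$. *)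

theory Defs
  imports "HOL-Analysis.Analysis" "HOL-Library.Multiset" "HOL-Number_Theory.Cong"
begin

text \<open>A partition is the multiset of its (positive) parts.\<close>

definition partitions_no_rep_odd :: "nat \<Rightarrow> nat multiset set" where
  "partitions_no_rep_odd n =
     {p. 0 \<notin># p \<and> sum_mset p = n \<and> (\<forall>k. odd k \<longrightarrow> count p k \<le> 1)}"

text \<open>Only meaningful for \<^term>\<open>p \<noteq> {#}\<close>, since it refers to the largest part.\<close>

definition M2_rank :: "nat multiset \<Rightarrow> int" where
  "M2_rank p = \<lceil>real (Max (set_mset p)) / 2\<rceil> - int (size p)"

text \<open>The empty partition is not counted.\<close>

definition N2 :: "int \<Rightarrow> nat \<Rightarrow> nat" where
  "N2 m n = (if n = 0 then 0 else card {p \<in> partitions_no_rep_odd n. M2_rank p = m})"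

text \<open>
  For fixed \<open>n\<close> only finitely many \<open>m\<close> contribute. The index set is infinite, so
  \<^const>\<open>infsum\<close> is used: \<^const>\<open>sum\<close> over an infinite set would be 0.
\<close>

definition N2_mod :: "int \<Rightarrow> nat \<Rightarrow> nat \<Rightarrow> nat" where
  "N2_mod s l n = (\<Sum>\<^sub>\<infinity>m\<in>{m. [m = s] (mod int l)}. N2 m n)"

definition rank_diff :: "nat \<Rightarrow> int \<Rightarrow> int \<Rightarrow> nat \<Rightarrow> complex \<Rightarrow> complex" where
  "rank_diff l s t d q =
     (\<Sum>n. of_int (int (N2_mod s l (l * n + d)) - int (N2_mod t l (l * n + d))) * q ^ n)"

text \<open>\<open>qpoch [a\<^sub>1, \<dots>, a\<^sub>j] q\<close> is $(a_1,\dots,a_j;q)_\infty$.\<close>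

definition qpoch :: "complex list \<Rightarrow> complex \<Rightarrow> complex" where
  "qpoch as q = (\<Prod>k. \<Prod>a\<leftarrow>as. 1 - a * q ^ k)"

end

theory Submission
  imports Defs "HOL-Complex_Analysis.Complex_Analysis"
begin

text \<open>
  At a primitive cube root of unity \<open>w\<close> the rank generating function of \<open>t\<close> equals
  \<open>1 + \<Sum>n. (N2_mod 0 3 n - N2_mod 1 3 n) t^n\<close>. The rank generating function, divided by
  \<open>1 - x\<close>, and the Appell sum \<open>(\<Sum>n. (- 1)^n t^(2n^2 + n) / (1 - x t^(2n))) / psi t\<close> obey the same
  first-order difference equation under \<open>x \<mapsto> t^2 x\<close> and have the same residue at \<open>x = 1\<close>; a solution of the
  homogeneous equation without poles extends to the origin and vanishes, so they coincide. By the same rigidity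
  argument, that Appell sum equals a combination of three Appell sums in \<open>t^9\<close> and \<open>x^3\<close> plus a quotient of
  theta functions. Letting \<open>x\<close> tend to \<open>w\<close> produces the derivative at 1 of a theta function, which the
  quintuple product identity evaluates. The result is an expression whose only dependence on \<open>t\<close>, apart from
  \<open>q = t^3\<close>, is through \<open>1 / psi t\<close>, and \<open>1 / psi t\<close> is a quadratic polynomial in \<open>t\<close> over functions
  of \<open>q\<close>. Comparing the three cube roots \<open>t\<close> of \<open>q\<close> separates the residue classes modulo 3.
\<close>

section \<open>Rigidity of solutions of difference equations\<close>

text \<open>Everything is compared through the law under \<open>x \<mapsto> p * x\<close>, so one
  annulus decides an identity. The rank series must be divided by \<open>1 - x\<close>: this
  quotient has the multiplier and the inhomogeneous term of the Appell sum over
  \<open>psi t\<close>. The obstacle is the value at \<open>w\<close>. In the decomposition, the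
  middle Appell sum and the theta quotient each have a pole there. The coefficient of the theta
  quotient is fixed by requiring these poles to cancel, so what remains at \<open>w\<close> is a 0/0
  limit, and hence a derivative of theta functions. The classes 1 and -1 modulo 3 of the theta
  series are exchanged by inversion, which reduces that derivative to the one of an antisymmetric
  sum, the series side of the quintuple product. One root \<open>w\<close> is enough because the
  rank series takes the same value at \<open>w\<close> and \<open>w ^ 2\<close>; the residue classes
  1 and 2 then have equal counts, and \<open>1 + w + w ^ 2 = 0\<close> leaves the difference of the
  classes 0 and 1. Finally, \<open>psi t\<close> is linear in \<open>t\<close> over functions of
  \<open>t ^ 3\<close>, and the product of \<open>psi\<close> over the three cube roots of
  \<open>q\<close> is a function of \<open>q\<close>; this is why \<open>1 / psi t\<close> is
  quadratic in \<open>t\<close>.\<close>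

lemma removable_lim:
  fixes f :: "complex \<Rightarrow> complex"
  assumes iso: "isolated_singularity_at f s" and lim: "((\<lambda>z. (z - s) * f z) \<longlongrightarrow> 0) (at s)"
  shows "remove_sings f analytic_on {s}"
proof -
  obtain A where A: "open A" "s \<in> A" "f holomorphic_on (A - {s})"
    using iso analytic_imp_holomorphic isolated_singularity_at_iff_analytic_nhd by auto
  obtain g where g: "g holomorphic_on A" "\<And>z. z \<in> A - {s} \<Longrightarrow> g z = f z"
    using holomorphic_on_extend_lim[of f A s] A lim by (auto simp: interior_open)
  have "g \<midarrow>s\<rightarrow> g s"
    using g(1) A by (metis holomorphic_on_imp_continuous_on continuous_on_eq_continuous_at isContD)
  moreover have "\<forall>\<^sub>F z in at s. f z = g z"
    using A(1,2) g(2) by (auto simp: eventually_at_topological intro!: exI[of _ A])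
  ultimately have "f \<midarrow>s\<rightarrow> g s"
    using tendsto_cong by blast
  then show ?thesis
    using iso remove_sings_analytic_at by blast
qed

lemma holomorphic_on_LIM:
  "f holomorphic_on S \<Longrightarrow> open S \<Longrightarrow> z \<in> S \<Longrightarrow> f \<midarrow>z\<rightarrow> f z"
  using holomorphic_on_imp_continuous_on continuous_on_eq_continuous_at isContD by blast

lemma LIM_unique_eventually:
  fixes f g :: "complex \<Rightarrow> complex"
  assumes "f \<midarrow>z\<rightarrow> a" "g \<midarrow>z\<rightarrow> b" "\<forall>\<^sub>F x in at z. f x = g x"
  shows "a = b"
proof -
  have "g \<midarrow>z\<rightarrow> a" using tendsto_cong[OF assms(3)] assms(1) by blast
  then show ?thesis using assms(2) LIM_unique by blast
qed

lemma norm_mult_less_of_le_1: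
  fixes p z :: complex
  assumes "norm p \<le> 1" "norm z < R"
  shows "norm (p * z) < R"
proof -
  have "norm (p * z) \<le> norm z" using assms by (simp add: norm_mult mult_left_le_one_le)
  then show ?thesis using assms by simp
qed

text \<open>The annulus \<open>norm p < norm z \<le> 1\<close> meets every orbit of
  \<open>z \<mapsto> p * z\<close> once. From it, \<open>down\<close> reaches the points near the
  origin and \<open>up\<close> the points of norm between 1 and \<open>R\<close>.\<close>

lemma qshift_induct:
  fixes p :: complex
  assumes p: "0 < norm p" "norm p < 1"
    and base: "\<And>z::complex. norm p < norm z \<Longrightarrow> norm z \<le> 1 \<Longrightarrow> P z"
    and up: "\<And>z. 1 < norm z \<Longrightarrow> norm z < R \<Longrightarrow> P (p * z) \<Longrightarrow> P z"
    and down: "\<And>z. 0 < norm z \<Longrightarrow> norm z \<le> 1 \<Longrightarrow> P z \<Longrightarrow> P (p * z)"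
    and z: "z \<noteq> 0" "norm z < R"
  shows "P z"
proof -
  have small: "\<forall>z. norm p ^ Suc n < norm z \<longrightarrow> norm z \<le> 1 \<longrightarrow> P z" for n
  proof (induction n)
    case 0 then show ?case using base by auto
  next
    case (Suc n)
    show ?case
    proof (intro allI impI)
      fix z :: complex assume z: "norm p ^ Suc (Suc n) < norm z" "norm z \<le> 1"
      show "P z"
      proof (cases "norm p < norm z")
        case True then show ?thesis using base z by auto
      next
        case False
        have "norm p ^ Suc n < norm (z / p)"
          using z p by (simp add: norm_divide field_simps)
        moreover have "norm (z / p) \<le> 1" using False p by (simp add: norm_divide field_simps)
        ultimately have "P (z / p)" using Suc by blast
        then have "P (p * (z / p))"
          using down[of "z / p"] \<open>norm (z/p) \<le> 1\<close> \<open>norm p ^ Suc n < norm (z / p)\<close> p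
          by (meson dual_order.strict_trans zero_less_power)
        then show ?thesis using p by auto
      qed
    qed
  qed
  have small': "P z" if z: "z \<noteq> 0" "norm z \<le> 1" for z
  proof -
    obtain n where "norm p ^ n < norm z"
      using real_arch_pow_inv[of "norm z" "norm p"] z p by auto
    moreover have "norm p ^ Suc n \<le> norm p ^ n"
      using p by (intro power_decreasing) auto
    ultimately have "norm p ^ Suc n < norm z" by linarith
    then show ?thesis using small z by blast
  qed
  have big: "\<forall>z. 0 < norm z \<longrightarrow> norm z < R \<longrightarrow> norm p ^ n * norm z \<le> 1 \<longrightarrow> P z" for n
  proof (induction n)
    case 0 then show ?case using small' by auto
  next
    case (Suc n)
    show ?case
    proof (intro allI impI)
      fix z :: complex assume z: "0 < norm z" "norm z < R" "norm p ^ Suc n * norm z \<le> 1"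
      show "P z"
      proof (cases "norm z \<le> 1")
        case True then show ?thesis using small' z by auto
      next
        case False
        have le: "norm (p * z) \<le> norm z"
          using p by (simp add: norm_mult mult_left_le_one_le)
        have "P (p * z)"
        proof (rule Suc[rule_format])
          show "0 < norm (p * z)" using z p by (simp add: norm_mult)
          show "norm (p * z) < R" using z le by linarith
          show "norm p ^ n * norm (p * z) \<le> 1" using z by (simp add: norm_mult algebra_simps)
        qed
        then show ?thesis using up[of z] z False by auto
      qed
    qed
  qed
  obtain n where "norm p ^ n < 1 / norm z"
    using real_arch_pow_inv[of "1 / norm z" "norm p"] z p by auto
  then have "norm p ^ n * norm z \<le> 1" using z by (simp add: field_simps)
  then show ?thesis using big z by auto
qed

text \<open>
  \<open>S\<close> is the set of possible singularities. The functional equation transports removability from the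
  annulus \<open>norm p < norm z \<le> 1\<close> to the whole punctured disc. The radius \<open>1 / norm p\<close> is imposed by
  the rank generating function, which converges only there.
\<close>

lemma qshift_extend:
  fixes p \<mu> :: complex and D :: "complex \<Rightarrow> complex"
  assumes p: "0 < norm p" "norm p < 1" and mu: "\<mu> \<noteq> 0"
    and an: "\<And>z. z \<noteq> 0 \<Longrightarrow> norm z < 1 / norm p \<Longrightarrow> z \<notin> S \<Longrightarrow> D analytic_on {z}"
    and disc: "\<And>z. z \<noteq> 0 \<Longrightarrow> norm z < 1 / norm p \<Longrightarrow> \<forall>\<^sub>F x in at z. x \<notin> S"
    and shift: "\<And>z. z \<noteq> 0 \<Longrightarrow> norm z < 1 / norm p \<Longrightarrow> p * z \<in> S \<longleftrightarrow> z \<in> S"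
    and law: "\<And>z. z \<noteq> 0 \<Longrightarrow> norm z < 1 / norm p \<Longrightarrow> z \<notin> S \<Longrightarrow> D (p * z) = \<mu> * z ^ k * D z"
    and res: "\<And>s. s \<in> S \<Longrightarrow> norm p < norm s \<Longrightarrow> norm s \<le> 1 \<Longrightarrow> ((\<lambda>z. (z - s) * D z) \<longlongrightarrow> 0) (at s)"
  shows "\<exists>g. (\<forall>z. z \<noteq> 0 \<longrightarrow> norm z < 1 / norm p \<longrightarrow>
           g analytic_on {z} \<and> (z \<notin> S \<longrightarrow> g z = D z) \<and> g (p * z) = \<mu> * z ^ k * g z)"
proof -
  define R where "R = 1 / norm p"
  have R: "R > 1" using p by (simp add: R_def)
  have p0: "p \<noteq> 0" using p by auto
  have pz: "norm (p * z) < R" if "norm z < R" for z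
  proof -
    have "norm (p * z) \<le> norm z" using p by (simp add: norm_mult mult_left_le_one_le)
    then show ?thesis using that by simp
  qed
  have evR: "\<forall>\<^sub>F x in at z. x \<noteq> 0 \<and> norm x < R" if "z \<noteq> 0" "norm z < R" for z :: complex
  proof -
    have "open (ball 0 R - {0::complex})" by auto
    then have "\<forall>\<^sub>F x in nhds z. x \<in> ball 0 R - {0}"
      by (rule eventually_nhds_in_open) (use that in auto)
    then have "\<forall>\<^sub>F x in at z. x \<in> ball 0 R - {0}"
      by (auto simp: eventually_at_filter elim: eventually_mono)
    then show ?thesis by eventually_elim auto
  qed
  have evL: "\<forall>\<^sub>F x in at z. x \<notin> S \<and> x \<noteq> 0 \<and> norm x < R \<and> D (p * x) = \<mu> * x ^ k * D x"
    if z: "z \<noteq> 0" "norm z < R" for z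
    using eventually_conj[OF evR[OF z] disc[OF z[unfolded R_def]]]
    by eventually_elim (auto simp: law R_def)
  \<comment> \<open>The substitutions \<open>x \<mapsto> p * x\<close> and
    \<open>x \<mapsto> x / p\<close> carry limits at \<open>z\<close> to limits at
    \<open>p * z\<close> and back.\<close>
  have flt: "filterlim (\<lambda>x. p * x) (at (p * z)) (at z)" for z
    using p0 by (intro filterlim_atI tendsto_intros) (auto simp: eventually_at_filter)
  have fltd: "filterlim (\<lambda>x. x / p) (at z) (at (p * z))" for z
  proof (intro filterlim_atI)
    show "((\<lambda>x. x / p) \<longlongrightarrow> z) (at (p * z))"
      using p0 by (auto intro!: tendsto_eq_intros)
    show "\<forall>\<^sub>F x in at (p * z). x / p \<noteq> z"
      using p0 by (auto simp: eventually_at_filter field_simps)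
  qed
  have iso: "isolated_singularity_at D z" if z: "z \<noteq> 0" "norm z < R" for z
  proof -
    have "\<forall>\<^sub>F x in at z. D analytic_on {x}"
      using evL[OF z] by eventually_elim (auto intro: an simp: R_def)
    then obtain r where r: "r > 0" "\<And>x. x \<in> ball z r - {z} \<Longrightarrow> D analytic_on {x}"
      by (auto simp: eventually_at dist_commute)
    then have "D analytic_on ball z r - {z}"
      using analytic_on_analytic_at by blast
    then show ?thesis unfolding isolated_singularity_at_def using r by blast
  qed
  have lim: "((\<lambda>x. (x - z) * D x) \<longlongrightarrow> 0) (at z)" if z: "z \<noteq> 0" "norm z < R" for z
  proof (rule qshift_induct[OF p _ _ _ z, where P = "\<lambda>z. ((\<lambda>x. (x - z) * D x) \<longlongrightarrow> 0) (at z)"])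
    fix z :: complex assume z: "norm p < norm z" "norm z \<le> 1"
    show "((\<lambda>x. (x - z) * D x) \<longlongrightarrow> 0) (at z)"
    proof (cases "z \<in> S")
      case True then show ?thesis using res z by auto
    next
      case False
      then have "D analytic_on {z}" using an[of z] z p R unfolding R_def by force
      then have "isCont D z" by (rule analytic_at_imp_isCont)
      then have "((\<lambda>x. (x - z) * D x) \<longlongrightarrow> (z - z) * D z) (at z)"
        by (intro tendsto_intros) (auto simp: isCont_def)
      then show ?thesis by simp
    qed
  next
    fix z :: complex assume z: "1 < norm z" "norm z < R" and IH: "((\<lambda>x. (x - p * z) * D x) \<longlongrightarrow> 0) (at (p * z))"
    have z0: "z \<noteq> 0" "norm z < R" using z by auto
    have "((\<lambda>x. (p * x - p * z) * D (p * x)) \<longlongrightarrow> 0) (at z)"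
      by (rule filterlim_compose[OF IH flt])
    then have "((\<lambda>x. (p * x - p * z) * D (p * x) / (p * \<mu> * x ^ k)) \<longlongrightarrow> 0 / (p * \<mu> * z ^ k)) (at z)"
      using p0 mu z by (intro tendsto_intros) auto
    moreover have "\<forall>\<^sub>F x in at z. (p * x - p * z) * D (p * x) / (p * \<mu> * x ^ k) = (x - z) * D x"
      using evL[OF z0]
    proof (eventually_elim)
      case (elim x)
      then have "(p * x - p * z) * D (p * x) = (p * \<mu> * x ^ k) * ((x - z) * D x)"
        by (simp add: algebra_simps)
      moreover have "p * \<mu> * x ^ k \<noteq> 0" using elim p0 mu by simp
      ultimately show ?case by (simp only: nonzero_mult_div_cancel_left not_False_eq_True)
    qed
    ultimately show "((\<lambda>x. (x - z) * D x) \<longlongrightarrow> 0) (at z)"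
      using tendsto_cong by force
  next
    fix z :: complex assume z: "0 < norm z" "norm z \<le> 1" and IH: "((\<lambda>x. (x - z) * D x) \<longlongrightarrow> 0) (at z)"
    have z0: "z \<noteq> 0" "norm z < R" using z R by auto
    have "((\<lambda>x. p * \<mu> * x ^ k * ((x - z) * D x)) \<longlongrightarrow> p * \<mu> * z ^ k * 0) (at z)"
      by (intro tendsto_intros IH)
    moreover have ev: "\<forall>\<^sub>F x in at z. (p * x - p * z) * D (p * x) = p * \<mu> * x ^ k * ((x - z) * D x)"
      using evL[OF z0] by eventually_elim (simp add: algebra_simps)
    ultimately have "((\<lambda>x. (p * x - p * z) * D (p * x)) \<longlongrightarrow> 0) (at z)"
      using tendsto_cong[OF ev, of 0] by simp
    then have "((\<lambda>x. (p * (x / p) - p * z) * D (p * (x / p))) \<longlongrightarrow> 0) (at (p * z))"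
      by (rule filterlim_compose[OF _ fltd])
    then show "((\<lambda>x. (x - p * z) * D x) \<longlongrightarrow> 0) (at (p * z))"
      using p0 by simp
  qed
  define g where "g = remove_sings D"
  have ga: "g analytic_on {z}" if "z \<noteq> 0" "norm z < R" for z
    unfolding g_def by (rule removable_lim[OF iso lim]) (use that in auto)
  have gD: "g z = D z" if "z \<noteq> 0" "norm z < R" "z \<notin> S" for z
    unfolding g_def using an that by (auto simp: R_def)
  \<comment> \<open>At points of \<open>S\<close> the law for \<open>g\<close> follows by
    continuity: nearby points lie outside \<open>S\<close>, as do their images by
    \<open>shift\<close>, and there \<open>g\<close> agrees with \<open>D\<close>.\<close>
  have gl: "g (p * z) = \<mu> * z ^ k * g z" if z: "z \<noteq> 0" "norm z < R" for z
  proof -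
    have pz': "p * z \<noteq> 0" "norm (p * z) < R" using z p0 pz by auto
    have "g \<midarrow>p * z\<rightarrow> g (p * z)"
      using ga[OF pz'] analytic_at_imp_isCont isContD by blast
    then have "(\<lambda>x. g (p * x)) \<midarrow>z\<rightarrow> g (p * z)"
      by (rule filterlim_compose[OF _ flt])
    moreover have "(\<lambda>x. \<mu> * x ^ k * g x) \<midarrow>z\<rightarrow> \<mu> * z ^ k * g z"
      using ga[OF z] analytic_at_imp_isCont isContD by (intro tendsto_intros) blast
    moreover have "\<forall>\<^sub>F x in at z. g (p * x) = \<mu> * x ^ k * g x"
      using evL[OF z]
    proof eventually_elim
      case (elim x)
      then have "p * x \<notin> S" using shift by (auto simp: R_def)
      then show ?case using elim gD[of x] gD[of "p * x"] p0 pz by auto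
    qed
    ultimately show ?thesis
      by (rule LIM_unique_eventually)
  qed
  show ?thesis
    by (rule exI[of _ g]) (use ga gD gl in \<open>auto simp: R_def\<close>)
qed

text \<open>On \<open>norm z \<le> r\<close> the multiplier has norm at most 1, so a bound on the
  compact annulus \<open>K\<close> propagates inwards to the whole punctured disc. Riemann's theorem
  then extends \<open>g\<close> over the origin, and the law holds at 0 by continuity.\<close>

lemma qshift_bounded:
  fixes p \<mu> :: complex and g :: "complex \<Rightarrow> complex"
  assumes p: "0 < norm p" "norm p < 1"
    and an: "\<And>z. z \<noteq> 0 \<Longrightarrow> norm z < 1 / norm p \<Longrightarrow> g analytic_on {z}"
    and law: "\<And>z. z \<noteq> 0 \<Longrightarrow> norm z < 1 / norm p \<Longrightarrow> g (p * z) = \<mu> * z ^ k * g z"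
    and r: "0 < r" "r \<le> 1" "\<And>z. norm z \<le> r \<Longrightarrow> norm (\<mu> * z ^ k) \<le> 1"
  shows "\<exists>h. h holomorphic_on ball 0 (1 / norm p) \<and>
    (\<forall>z. norm z < 1 / norm p \<longrightarrow> (z \<noteq> 0 \<longrightarrow> h z = g z) \<and> h (p * z) = \<mu> * z ^ k * h z)"
proof -
  define R where "R = 1 / norm p"
  have R: "R > 1" using p by (simp add: R_def)
  have p0: "p \<noteq> 0" using p by auto
  have g_an: "g analytic_on (ball 0 R - {0})"
    unfolding analytic_on_analytic_at[of g "ball 0 R - {0}"] using an by (auto simp: R_def)
  have g_hol: "g holomorphic_on (ball 0 R - {0})"
    using g_an analytic_imp_holomorphic by blast
  define K where "K = cball 0 r - ball (0::complex) (norm p * r)"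
  have "continuous_on K g"
    using p r R
    by (intro holomorphic_on_imp_continuous_on holomorphic_on_subset[OF g_hol])
       (auto simp: K_def mult_less_0_iff not_less mult_le_0_iff)
  moreover have "compact K" unfolding K_def by (intro compact_diff) auto
  ultimately have "bounded (g ` K)"
    by (intro compact_imp_bounded compact_continuous_image)
  then obtain M where M: "\<And>z. z \<in> K \<Longrightarrow> norm (g z) \<le> M"
    unfolding bounded_iff by blast
  have bd: "norm (g (r *\<^sub>R z)) \<le> M" if z: "z \<noteq> 0" "norm z \<le> 1" for z
  proof -
    \<comment> \<open>The induction is centred on radius 1, hence the rescaling by \<open>r\<close>.
      The premise \<open>norm z \<le> 1\<close> makes the outward step vacuous.\<close>
    have "norm z \<le> 1 \<longrightarrow> norm (g (r *\<^sub>R z)) \<le> M"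
    proof (rule qshift_induct[OF p _ _ _ that(1), where R = R])
      fix z :: complex assume "norm p < norm z" "norm z \<le> 1"
      then show "norm z \<le> 1 \<longrightarrow> norm (g (r *\<^sub>R z)) \<le> M"
        using r by (intro impI M) (auto simp: K_def mult.commute mult_left_le)
    next
      fix z :: complex assume z: "0 < norm z" "norm z \<le> 1" and IH: "norm z \<le> 1 \<longrightarrow> norm (g (r *\<^sub>R z)) \<le> M"
      have n: "norm (r *\<^sub>R z) \<le> r" using z r by (simp add: mult_left_le)
      have "norm (g (p * (r *\<^sub>R z))) = norm (\<mu> * (r *\<^sub>R z) ^ k) * norm (g (r *\<^sub>R z))"
      proof -
        have "norm (r *\<^sub>R z) < 1 / norm p" using n r R unfolding R_def by linarith
        moreover have "r *\<^sub>R z \<noteq> 0" using z r by simp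
        ultimately have "g (p * (r *\<^sub>R z)) = \<mu> * (r *\<^sub>R z) ^ k * g (r *\<^sub>R z)"
          using law by blast
        then show ?thesis by (simp only: norm_mult)
      qed
      also have "\<dots> \<le> 1 * M"
        using r(3)[OF n] IH z by (intro mult_mono) auto
      finally show "norm (p * z) \<le> 1 \<longrightarrow> norm (g (r *\<^sub>R (p * z))) \<le> M"
        by (simp add: mult_scaleR_right)
    qed (use z R in auto)
    then show ?thesis using z by simp
  qed
  have bd': "norm (g z) \<le> M" if "z \<noteq> 0" "norm z \<le> r" for z
    using bd[of "z /\<^sub>R r"] that r by (simp add: field_simps)
  have "\<forall>\<^sub>F z in at 0. norm (g z) \<le> M"
    using bd' r by (auto simp: eventually_at intro!: exI[of _ r])
  then have "\<exists>B. \<forall>\<^sub>F z in at 0. norm (g z) \<le> B" by blast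
  moreover have "0 \<in> interior (ball (0::complex) R)" using R by simp
  ultimately have "\<exists>h. h holomorphic_on ball 0 R \<and> (\<forall>z\<in>ball 0 R - {0}. h z = g z)"
    using holomorphic_on_extend_bounded[OF g_hol] by metis
  then obtain h where h: "h holomorphic_on ball 0 R" "\<And>z. z \<in> ball 0 R - {0} \<Longrightarrow> h z = g z"
    by blast
  have hl: "h (p * z) = \<mu> * z ^ k * h z" if "z \<noteq> 0" "norm z < R" for z
  proof -
    have "norm (p * z) < R"
      using that p by (intro norm_mult_less_of_le_1) auto
    then show ?thesis using h(2)[of z] h(2)[of "p * z"] law[of z] that p0 by (auto simp: R_def)
  qed
  have h0: "h \<midarrow>0\<rightarrow> h 0"
    by (rule holomorphic_on_LIM[OF h(1)]) (use R in auto)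
  have "filterlim (\<lambda>x. p * x) (at 0) (at 0)"
    using p0 by (intro filterlim_atI tendsto_eq_intros) (auto simp: eventually_at_filter)
  then have 1: "(\<lambda>x. h (p * x)) \<midarrow>0\<rightarrow> h 0"
    by (rule filterlim_compose[OF h0])
  have 2: "(\<lambda>x. \<mu> * x ^ k * h x) \<midarrow>0\<rightarrow> \<mu> * 0 ^ k * h 0"
    by (intro tendsto_intros h0)
  have "\<forall>\<^sub>F x in at 0. h (p * x) = \<mu> * x ^ k * h x"
    using hl R by (auto simp: eventually_at intro!: exI[of _ R])
  then have "h (p * 0) = \<mu> * 0 ^ k * h 0"
    using LIM_unique_eventually[OF 1 2] by simp
  then have hl': "h (p * z) = \<mu> * z ^ k * h z" if "norm z < R" for z
    using hl that by (cases "z = 0") auto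
  show ?thesis
    by (rule exI[of _ h]) (use h hl' in \<open>auto simp: R_def\<close>)
qed

text \<open>The case of multiplier 1. The extended function is constant along
  \<open>p ^ n * z\<close>, which tends to 0, so its value everywhere is the one at the origin. It
  is applied to quotients of theta functions.\<close>

lemma qshift_periodic_const:
  fixes p :: complex and D :: "complex \<Rightarrow> complex"
  assumes p: "0 < norm p" "norm p < 1"
    and an: "\<And>z. z \<noteq> 0 \<Longrightarrow> norm z < 1 / norm p \<Longrightarrow> z \<notin> S \<Longrightarrow> D analytic_on {z}"
    and disc: "\<And>z. z \<noteq> 0 \<Longrightarrow> norm z < 1 / norm p \<Longrightarrow> \<forall>\<^sub>F x in at z. x \<notin> S"
    and shift: "\<And>z. z \<noteq> 0 \<Longrightarrow> norm z < 1 / norm p \<Longrightarrow> p * z \<in> S \<longleftrightarrow> z \<in> S"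
    and law: "\<And>z. z \<noteq> 0 \<Longrightarrow> norm z < 1 / norm p \<Longrightarrow> z \<notin> S \<Longrightarrow> D (p * z) = D z"
    and res: "\<And>s. s \<in> S \<Longrightarrow> norm p < norm s \<Longrightarrow> norm s \<le> 1 \<Longrightarrow> ((\<lambda>z. (z - s) * D z) \<longlongrightarrow> 0) (at s)"
  shows "\<exists>C. \<forall>z. z \<noteq> 0 \<longrightarrow> norm z < 1 / norm p \<longrightarrow> z \<notin> S \<longrightarrow> D z = C"
proof -
  have law0: "\<And>z. z \<noteq> 0 \<Longrightarrow> norm z < 1 / norm p \<Longrightarrow> z \<notin> S \<Longrightarrow> D (p * z) = 1 * z ^ 0 * D z"
    using law by simp
  have "\<exists>g. (\<forall>z. z \<noteq> 0 \<longrightarrow> norm z < 1 / norm p \<longrightarrow>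
           g analytic_on {z} \<and> (z \<notin> S \<longrightarrow> g z = D z) \<and> g (p * z) = 1 * z ^ 0 * g z)"
    by (rule qshift_extend) (fact p one_neq_zero an disc shift law0 res)+
  then obtain g where g: "\<And>z. z \<noteq> 0 \<Longrightarrow> norm z < 1 / norm p \<Longrightarrow> g analytic_on {z}"
    "\<And>z. z \<noteq> 0 \<Longrightarrow> norm z < 1 / norm p \<Longrightarrow> z \<notin> S \<Longrightarrow> g z = D z"
    "\<And>z. z \<noteq> 0 \<Longrightarrow> norm z < 1 / norm p \<Longrightarrow> g (p * z) = 1 * z ^ 0 * g z"
    by blast
  have "\<exists>h. h holomorphic_on ball 0 (1 / norm p) \<and>
    (\<forall>z. norm z < 1 / norm p \<longrightarrow> (z \<noteq> 0 \<longrightarrow> h z = g z) \<and> h (p * z) = 1 * z ^ 0 * h z)"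
    by (rule qshift_bounded[where r = 1]) (fact p g zero_less_one order_refl | simp)+
  then obtain h where h: "h holomorphic_on ball 0 (1 / norm p)"
    "\<And>z. z \<noteq> 0 \<Longrightarrow> norm z < 1 / norm p \<Longrightarrow> h z = g z"
    "\<And>z. norm z < 1 / norm p \<Longrightarrow> h (p * z) = 1 * z ^ 0 * h z"
    by blast
  have pow: "h (p ^ n * z) = h z" if "norm z < 1 / norm p" for n z
  proof (induction n)
    case (Suc n)
    have "norm (p ^ n * z) \<le> norm z"
      using p by (simp add: norm_mult norm_power mult_left_le_one_le power_le_one)
    then show ?case using Suc h(3)[of "p ^ n * z"] that by (simp add: mult.assoc)
  qed auto
  have "h z = h 0" if "norm z < 1 / norm p" for z
  proof -
    have "(\<lambda>n. p ^ n * z) \<longlonglongrightarrow> 0 * z"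
      using p by (intro tendsto_intros LIMSEQ_power_zero)
    moreover have "isCont h 0"
      unfolding isCont_def by (rule holomorphic_on_LIM[OF h(1)]) (use p in auto)
    ultimately have "(\<lambda>n. h (p ^ n * z)) \<longlonglongrightarrow> h 0"
      using isCont_tendsto_compose by force
    then show ?thesis using pow[OF that] by (simp add: LIMSEQ_const_iff)
  qed
  then show ?thesis using g(2) h(2) by (intro exI[of _ "h 0"]) simp
qed

text \<open>
  The orders of vanishing at the origin of the two sides of the functional equation differ by \<open>k\<close>.
\<close>

lemma qshift_zero:
  fixes p \<mu> :: complex and D :: "complex \<Rightarrow> complex"
  assumes p: "0 < norm p" "norm p < 1" and mu: "\<mu> \<noteq> 0" and k: "k > 0"
    and an: "\<And>z. z \<noteq> 0 \<Longrightarrow> norm z < 1 / norm p \<Longrightarrow> z \<notin> S \<Longrightarrow> D analytic_on {z}"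
    and disc: "\<And>z. z \<noteq> 0 \<Longrightarrow> norm z < 1 / norm p \<Longrightarrow> \<forall>\<^sub>F x in at z. x \<notin> S"
    and shift: "\<And>z. z \<noteq> 0 \<Longrightarrow> norm z < 1 / norm p \<Longrightarrow> p * z \<in> S \<longleftrightarrow> z \<in> S"
    and law: "\<And>z. z \<noteq> 0 \<Longrightarrow> norm z < 1 / norm p \<Longrightarrow> z \<notin> S \<Longrightarrow> D (p * z) = \<mu> * z ^ k * D z"
    and res: "\<And>s. s \<in> S \<Longrightarrow> norm p < norm s \<Longrightarrow> norm s \<le> 1 \<Longrightarrow> ((\<lambda>z. (z - s) * D z) \<longlongrightarrow> 0) (at s)"
    and z: "z \<noteq> 0" "norm z < 1 / norm p" "z \<notin> S"
  shows "D z = 0"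
proof -
  have p0: "p \<noteq> 0" using p by auto
  have "\<exists>g. (\<forall>z. z \<noteq> 0 \<longrightarrow> norm z < 1 / norm p \<longrightarrow>
           g analytic_on {z} \<and> (z \<notin> S \<longrightarrow> g z = D z) \<and> g (p * z) = \<mu> * z ^ k * g z)"
    by (rule qshift_extend) (fact p mu an disc shift law res)+
  then obtain g where g: "\<And>z. z \<noteq> 0 \<Longrightarrow> norm z < 1 / norm p \<Longrightarrow> g analytic_on {z}"
    "\<And>z. z \<noteq> 0 \<Longrightarrow> norm z < 1 / norm p \<Longrightarrow> z \<notin> S \<Longrightarrow> g z = D z"
    "\<And>z. z \<noteq> 0 \<Longrightarrow> norm z < 1 / norm p \<Longrightarrow> g (p * z) = \<mu> * z ^ k * g z"
    by blast
  \<comment> \<open>As \<open>k > 0\<close>, \<open>norm z ^ k \<le> norm z\<close> for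
    \<open>norm z \<le> 1\<close>; the second bound then makes the multiplier at most 1 in
    norm.\<close>
  define r where "r = min 1 (1 / norm \<mu>)"
  have r: "0 < r" "r \<le> 1" using mu by (auto simp: r_def)
  have r3: "norm (\<mu> * z ^ k) \<le> 1" if "norm z \<le> r" for z
  proof -
    have "norm z ^ k \<le> norm z" using power_decreasing[of 1 k "norm z"] that r k by simp
    then have "norm z ^ k \<le> 1 / norm \<mu>" using that by (simp add: r_def)
    then show ?thesis using mu by (simp add: norm_mult norm_power field_simps)
  qed
  have "\<exists>h. h holomorphic_on ball 0 (1 / norm p) \<and>
    (\<forall>z. norm z < 1 / norm p \<longrightarrow> (z \<noteq> 0 \<longrightarrow> h z = g z) \<and> h (p * z) = \<mu> * z ^ k * h z)"
    by (rule qshift_bounded[where r = r]) (fact p g r r3)+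
  then obtain h where h: "h holomorphic_on ball 0 (1 / norm p)"
    "\<And>z. z \<noteq> 0 \<Longrightarrow> norm z < 1 / norm p \<Longrightarrow> h z = g z"
    "\<And>z. norm z < 1 / norm p \<Longrightarrow> h (p * z) = \<mu> * z ^ k * h z"
    by blast
  have h0: "h 0 = 0" using h(3)[of 0] p by (simp add: zero_power[OF k])
  have R: "1 / norm p > 0" using p by simp
  have "h constant_on ball 0 (1 / norm p)"
  proof (rule ccontr)
    assume nc: "\<not> ?thesis"
    have c0: "0 \<in> ball (0::complex) (1 / norm p)" using R by simp
    obtain u e n where u: "0 < (n::nat)" "0 < e" "ball (0::complex) e \<subseteq> ball 0 (1 / norm p)"
            "u holomorphic_on ball 0 e"
            "\<And>w. w \<in> ball 0 e \<Longrightarrow> h w = (w - 0)^n * u w"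
            "\<And>w. w \<in> ball 0 e \<Longrightarrow> u w \<noteq> 0"
      by (rule holomorphic_factor_zero_nonconstant[OF h(1) open_ball convex_connected[OF convex_ball] c0 h0 nc])
         ((rule that; assumption) | blast | metis)
    \<comment> \<open>Cancelling \<open>w ^ n\<close> and letting \<open>w\<close> tend to 0 leaves
      \<open>p ^ n * u 0 = 0\<close>, because \<open>k > 0\<close>; but \<open>u 0\<close> is
      nonzero.\<close>
    have eq: "p ^ n * u (p * w) = \<mu> * w ^ k * u w" if w: "w \<noteq> 0" "norm w < e" for w
    proof -
      have "norm (p * w) < e"
        using that p by (intro norm_mult_less_of_le_1) auto
      moreover have "norm w < 1 / norm p" using subsetD[OF u(3), of w] w by simp
      ultimately have "(p * w) ^ n * u (p * w) = \<mu> * w ^ k * (w ^ n * u w)"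
        using h(3)[of w] u(5)[of w] u(5)[of "p * w"] w by simp
      then have "w ^ n * (p ^ n * u (p * w)) = w ^ n * (\<mu> * w ^ k * u w)"
        by (simp add: power_mult_distrib algebra_simps)
      then show ?thesis using w by simp
    qed
    have u0: "u \<midarrow>0\<rightarrow> u 0"
      by (rule holomorphic_on_LIM[OF u(4)]) (use u(2) in auto)
    have "filterlim (\<lambda>x. p * x) (at 0) (at 0)"
      using p0 by (intro filterlim_atI tendsto_eq_intros) (auto simp: eventually_at_filter)
    then have 1: "(\<lambda>x. p ^ n * u (p * x)) \<midarrow>0\<rightarrow> p ^ n * u 0"
      by (intro tendsto_intros filterlim_compose[OF u0])
    have 2: "(\<lambda>x. \<mu> * x ^ k * u x) \<midarrow>0\<rightarrow> \<mu> * 0 ^ k * u 0"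
      by (intro tendsto_intros u0)
    have "\<forall>\<^sub>F x in at 0. p ^ n * u (p * x) = \<mu> * x ^ k * u x"
      using eq u(2) by (auto simp: eventually_at intro!: exI[of _ e])
    then have "p ^ n * u 0 = \<mu> * 0 ^ k * u 0"
      by (rule LIM_unique_eventually[OF 1 2])
    then show False using p0 u(2) u(6)[of 0] by (simp add: zero_power[OF k])
  qed
  then have "h z = 0" using h0 R z unfolding constant_on_def by auto
  then show ?thesis using g(2)[OF z] h(2)[OF z(1,2)] by simp
qed

section \<open>Infinite products\<close>

definition qp :: "complex \<Rightarrow> complex \<Rightarrow> complex" where
  "qp a q = (\<Prod>k. 1 - a * q ^ k)"

lemma summable_qp:
  fixes a q :: complex
  assumes "norm q < 1"
  shows "summable (\<lambda>k. norm (a * q ^ k))"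
  using assms by (auto simp: norm_mult norm_power intro!: summable_mult summable_geometric)

lemma convergent_qp:
  fixes a q :: complex
  assumes "norm q < 1"
  shows "convergent_prod (\<lambda>k. 1 - a * q ^ k)"
proof -
  have "summable (\<lambda>k. norm ((1 - a * q ^ k) - 1))"
    using summable_qp[OF assms, of a] by simp
  then show ?thesis
    by (intro abs_convergent_prod_imp_convergent_prod summable_imp_abs_convergent_prod)
qed

lemma qp_LIMSEQ:
  assumes "norm q < 1"
  shows "(\<lambda>n. \<Prod>k<n. 1 - a * q ^ k) \<longlonglongrightarrow> qp a q"
proof -
  have "(\<lambda>n. \<Prod>k<Suc n. 1 - a * q ^ k) \<longlonglongrightarrow> qp a q"
    using convergent_prod_LIMSEQ[OF convergent_qp[OF assms, of a]]
    by (simp add: qp_def lessThan_Suc_atMost)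
  then show ?thesis by (rule LIMSEQ_imp_Suc)
qed

lemma qp_rec:
  assumes "norm q < 1"
  shows "qp a q = (1 - a) * qp (a * q) q"
proof -
  have "(\<lambda>n. (1 - a) * (\<Prod>k<n. 1 - a * q * q ^ k)) \<longlonglongrightarrow> (1 - a) * qp (a * q) q"
    by (intro tendsto_intros qp_LIMSEQ assms)
  moreover have "(1 - a) * (\<Prod>k<n. 1 - a * q * q ^ k) = (\<Prod>k<Suc n. 1 - a * q ^ k)" for n
    by (subst prod.lessThan_Suc_shift) (simp add: mult_ac)
  ultimately have "(\<lambda>n. \<Prod>k<Suc n. 1 - a * q ^ k) \<longlonglongrightarrow> (1 - a) * qp (a * q) q"
    by simp
  then show ?thesis
    by (rule LIMSEQ_unique[OF LIMSEQ_Suc[OF qp_LIMSEQ[OF assms]]])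
qed

lemma qp_split_initial:
  assumes "norm q < 1"
  shows "qp a q = (\<Prod>k<n. 1 - a * q ^ k) * qp (a * q ^ n) q"
proof (induction n)
  case (Suc n)
  then show ?case using qp_rec[OF assms, of "a * q ^ n"] by (simp add: mult_ac)
qed simp

lemma qp_eq_0_iff:
  assumes "norm q < 1"
  shows "qp a q = 0 \<longleftrightarrow> (\<exists>k. a * q ^ k = 1)"
proof -
  have "(\<lambda>k. 1 - a * q ^ k) has_prod qp a q"
    unfolding qp_def by (intro convergent_prod_has_prod convergent_qp assms)
  then have "qp a q = 0 \<longleftrightarrow> (\<exists>k. 1 - a * q ^ k = 0)"
    using has_prod_eq_0_iff[of "\<lambda>k. 1 - a * q ^ k" "qp a q"] by auto
  moreover have "1 - x = 0 \<longleftrightarrow> x = 1" for x :: complex by auto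
  ultimately show ?thesis by simp
qed

lemma qp_nonzero:
  assumes "norm q < 1" "norm a < 1"
  shows "qp a q \<noteq> 0"
proof
  assume "qp a q = 0"
  then obtain k where "a * q ^ k = 1" using qp_eq_0_iff[OF assms(1)] by blast
  then have "norm a * norm q ^ k = 1" by (metis norm_mult norm_one norm_power)
  moreover have "norm a * norm q ^ k \<le> norm a"
    using assms by (simp add: mult_left_le power_le_one)
  ultimately show False using assms by linarith
qed

lemma qp_mult_minus:
  assumes "norm q < 1"
  shows "qp a q * qp (- a) q = qp (a ^ 2) (q ^ 2)" (is "?L = _")
proof -
  have q2: "norm (q ^ 2) < 1" using assms by (simp add: norm_power power_less_one_iff)
  have "(\<lambda>n. (\<Prod>k<n. 1 - a * q ^ k) * (\<Prod>k<n. 1 - (- a) * q ^ k)) \<longlonglongrightarrow> qp a q * qp (- a) q"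
    by (intro tendsto_intros qp_LIMSEQ assms)
  moreover have "(\<Prod>k<n. 1 - a * q ^ k) * (\<Prod>k<n. 1 - (- a) * q ^ k) = (\<Prod>k<n. 1 - a ^ 2 * (q ^ 2) ^ k)" for n
    unfolding prod.distrib [symmetric]
    by (intro prod.cong refl) (simp add: algebra_simps power2_eq_square power_mult_distrib)
  ultimately have "(\<lambda>n. \<Prod>k<n. 1 - a ^ 2 * (q ^ 2) ^ k) \<longlonglongrightarrow> ?L" by (simp only:)
  then show ?thesis by (rule LIMSEQ_unique[OF _ qp_LIMSEQ[OF q2]])
qed

text \<open>Factorwise this is
  \<open>(1 - x) * (1 - w * x) * (1 - w ^ 2 * x) = 1 - x ^ 3\<close>.\<close>

lemma qp_mult_cube_roots:
  assumes "norm q < 1" and w: "1 + w + w ^ 2 = (0::complex)"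
  shows "qp a q * qp (w * a) q * qp (w ^ 2 * a) q = qp (a ^ 3) (q ^ 3)" (is "?L = _")
proof -
  have q3: "norm (q ^ 3) < 1" using assms(1) by (simp add: norm_power power_less_one_iff)
  have w3: "w ^ 3 = 1"
  proof -
    have "w ^ 3 - 1 = (w - 1) * (1 + w + w ^ 2)"
      by (simp add: algebra_simps power2_eq_square power3_eq_cube)
    then show ?thesis using w by simp
  qed
  have id: "(1 - x) * (1 - w * x) * (1 - w ^ 2 * x) = 1 - x ^ 3" for x
  proof -
    have "(1 - x) * (1 - w * x) * (1 - w ^ 2 * x)
        = 1 - (1 + w + w ^ 2) * x + w * (1 + w + w ^ 2) * x ^ 2 - w ^ 3 * x ^ 3"
      by (simp add: algebra_simps power2_eq_square power3_eq_cube)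
    then show ?thesis by (simp add: w w3)
  qed
  have "(\<lambda>n. (\<Prod>k<n. 1 - a * q ^ k) * (\<Prod>k<n. 1 - w * a * q ^ k) * (\<Prod>k<n. 1 - w ^ 2 * a * q ^ k)) \<longlonglongrightarrow>
      qp a q * qp (w * a) q * qp (w ^ 2 * a) q"
    by (intro tendsto_intros qp_LIMSEQ assms(1))
  moreover have "(\<Prod>k<n. 1 - a * q ^ k) * (\<Prod>k<n. 1 - w * a * q ^ k) * (\<Prod>k<n. 1 - w ^ 2 * a * q ^ k)
      = (\<Prod>k<n. 1 - a ^ 3 * (q ^ 3) ^ k)" for n
    unfolding prod.distrib [symmetric]
  proof (rule prod.cong[OF refl])
    fix k
    have "(a * q ^ k) ^ 3 = a ^ 3 * (q ^ 3) ^ k"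
      by (simp add: power_mult_distrib mult.commute flip: power_mult)
    then show "(1 - a * q ^ k) * (1 - w * a * q ^ k) * (1 - w ^ 2 * a * q ^ k) = 1 - a ^ 3 * (q ^ 3) ^ k"
      using id[of "a * q ^ k"] by (simp only: mult.assoc)
  qed
  ultimately have "(\<lambda>n. \<Prod>k<n. 1 - a ^ 3 * (q ^ 3) ^ k) \<longlonglongrightarrow> ?L" by (simp only:)
  then show ?thesis by (rule LIMSEQ_unique[OF _ qp_LIMSEQ[OF q3]])
qed

text \<open>The exponents of \<open>q\<close> are sorted by their residue modulo \<open>m\<close>;
  along multiples of \<open>m\<close> the partial products agree exactly.\<close>

lemma qp_split:
  assumes "norm q < 1" "m > 0"
  shows "qp a q = (\<Prod>j<m. qp (a * q ^ j) (q ^ m))"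
proof -
  have qm: "norm (q ^ m) < 1" using assms by (simp add: norm_power power_less_one_iff)
  have "(\<lambda>n. \<Prod>j<m. \<Prod>k<n. 1 - a * q ^ j * (q ^ m) ^ k) \<longlonglongrightarrow> (\<Prod>j<m. qp (a * q ^ j) (q ^ m))"
    by (intro tendsto_intros qp_LIMSEQ qm)
  moreover have "(\<Prod>j<m. \<Prod>k<n. 1 - a * q ^ j * (q ^ m) ^ k) = (\<Prod>k<n*m. 1 - a * q ^ k)" for n
  proof -
    have "(\<Prod>k<n*m. 1 - a * q ^ k) = (\<Prod>k<n. \<Prod>i\<in>{k*m..<k*m+m}. 1 - a * q ^ i)"
      by (rule prod.nat_group [symmetric])
    also have "\<dots> = (\<Prod>k<n. \<Prod>j<m. 1 - a * q ^ (j + k * m))"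
    proof (rule prod.cong[OF refl])
      fix k
      show "(\<Prod>i\<in>{k*m..<k*m+m}. 1 - a * q ^ i) = (\<Prod>j<m. 1 - a * q ^ (j + k * m))"
        by (rule prod.reindex_bij_witness[of _ "\<lambda>j. j + k * m" "\<lambda>i. i - k * m"]) auto
    qed
    also have "\<dots> = (\<Prod>j<m. \<Prod>k<n. 1 - a * q ^ (j + k * m))"
      by (rule prod.swap)
    finally show ?thesis
      by (simp add: power_add power_mult[symmetric] mult_ac)
  qed
  ultimately have "(\<lambda>n. \<Prod>k<n*m. 1 - a * q ^ k) \<longlonglongrightarrow> (\<Prod>j<m. qp (a * q ^ j) (q ^ m))"
    by simp
  moreover have "(\<lambda>n. \<Prod>k<n*m. 1 - a * q ^ k) \<longlonglongrightarrow> qp a q"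
    by (rule filterlim_compose[OF qp_LIMSEQ[OF assms(1)]])
       (use assms(2) in \<open>auto intro!: mult_nat_right_at_top simp: mult.commute\<close>)
  ultimately show ?thesis by (rule LIMSEQ_unique[rotated])
qed

text \<open>The norms of the deviations from 1 form a geometric series. Keeping the
  \<open>- 1\<close> makes the bound tend to 0 with \<open>a\<close>, which fixes the constant of
  the triple product at \<open>q = 0\<close>.\<close>

lemma norm_qp_partial_minus_1_le:
  fixes a q :: complex
  assumes "norm q < 1"
  shows "norm ((\<Prod>k<n. 1 - a * q ^ k) - 1) \<le> exp (norm a / (1 - norm q)) - 1"
proof -
  have "norm ((\<Prod>k<n. 1 + (- a * q ^ k)) - 1) \<le> (\<Prod>k<n. 1 + norm (- a * q ^ k)) - 1"
    by (rule norm_prod_minus1_le_prod_minus1)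
  also have "(\<Prod>k<n. 1 + norm (- a * q ^ k)) \<le> exp (\<Sum>k<n. norm (- a * q ^ k))"
    by (rule prod_le_exp_sum) auto
  also have "(\<Sum>k<n. norm (- a * q ^ k)) \<le> (\<Sum>k. norm a * norm q ^ k)"
    using assms by (subst norm_mult, subst norm_power, simp only: norm_minus_cancel, intro sum_le_suminf summable_mult summable_geometric) auto
  also have "\<dots> = norm a / (1 - norm q)"
    using assms by (simp add: suminf_mult suminf_geometric summable_geometric)
  finally show ?thesis by simp
qed

lemma norm_qp_minus_1_le:
  assumes "norm q < 1"
  shows "norm (qp a q - 1) \<le> exp (norm a / (1 - norm q)) - 1"
proof (rule Lim_bounded)
  show "(\<lambda>n. norm ((\<Prod>k<n. 1 - a * q ^ k) - 1)) \<longlonglongrightarrow> norm (qp a q - 1)"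
    by (intro tendsto_intros qp_LIMSEQ assms)
qed (use norm_qp_partial_minus_1_le[OF assms] in auto)

lemma norm_qp_le:
  fixes a q :: complex
  assumes "norm q < 1"
  shows "norm (\<Prod>k<n. 1 - a * q ^ k) \<le> exp (norm a / (1 - norm q))" "norm (qp a q) \<le> exp (norm a / (1 - norm q))"
proof -
  have *: "norm x \<le> norm (x - 1) + 1" for x :: complex
    using norm_triangle_ineq[of "x - 1" 1] by simp
  show "norm (\<Prod>k<n. 1 - a * q ^ k) \<le> exp (norm a / (1 - norm q))"
    using *[of "\<Prod>k<n. 1 - a * q ^ k"] norm_qp_partial_minus_1_le[OF assms, of a n] by linarith
  show "norm (qp a q) \<le> exp (norm a / (1 - norm q))"
    using *[of "qp a q"] norm_qp_minus_1_le[OF assms, of a] by linarith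
qed

lemma qp_holomorphic:
  assumes "norm q < 1"
  shows "(\<lambda>a. qp a q) holomorphic_on UNIV"
proof -
  have "(\<lambda>a. qp a q) holomorphic_on ball 0 R" for R :: real
  proof -
    have "uniformly_convergent_on (cball 0 R) (\<lambda>N a. \<Prod>n<N. 1 + (- a * q ^ n))"
    proof (rule uniformly_convergent_on_prod)
      show "uniformly_convergent_on (cball 0 R) (\<lambda>N x. \<Sum>n<N. norm (- x * q ^ n))"
      proof (rule Weierstrass_m_test'[where M = "\<lambda>n. R * norm q ^ n"])
        show "summable (\<lambda>n. R * norm q ^ n)" using assms by (intro summable_mult summable_geometric) auto
      qed (auto simp: norm_mult norm_power intro!: mult_right_mono)
    qed (auto intro!: continuous_intros)
    then have "uniform_limit (cball 0 R) (\<lambda>N a. \<Prod>n<N. 1 + (- a * q ^ n))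
        (\<lambda>a. lim (\<lambda>N. \<Prod>n<N. 1 + (- a * q ^ n))) sequentially"
      by (simp only: uniformly_convergent_uniform_limit_iff)
    moreover have "lim (\<lambda>N. \<Prod>n<N. 1 + (- a * q ^ n)) = qp a q" for a
      using qp_LIMSEQ[OF assms, of a] by (intro limI) simp
    ultimately have ul: "uniform_limit (cball 0 R) (\<lambda>N a. \<Prod>n<N. 1 + (- a * q ^ n)) (\<lambda>a. qp a q) sequentially"
      by simp
    show ?thesis
      by (rule holomorphic_uniform_limit[OF _ ul])
         (auto intro!: always_eventually continuous_intros holomorphic_intros)
  qed
  then have "(\<lambda>a. qp a q) holomorphic_on (\<Union>n. ball 0 (real n))"
    by (intro holomorphic_on_UN_open) auto
  moreover have "(\<Union>n. ball (0::complex) (real n)) = UNIV"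
    by (auto simp: reals_Archimedean2)
  ultimately show ?thesis by simp
qed

lemma qp_analytic [analytic_intros]:
  assumes "norm q < 1" "f analytic_on A"
  shows "(\<lambda>z. qp (f z) q) analytic_on A"
proof -
  have "(\<lambda>a. qp a q) analytic_on UNIV"
    using qp_holomorphic[OF assms(1)] by (simp add: analytic_on_open)
  then have "(\<lambda>a. qp a q) analytic_on (f ` A)" by (rule analytic_on_subset) simp
  from analytic_on_compose[OF assms(2) this] show ?thesis by (simp only: o_def)
qed

lemma tendsto_qp [tendsto_intros]:
  assumes "(f \<longlongrightarrow> a) F" "norm q < 1"
  shows "((\<lambda>x. qp (f x) q) \<longlongrightarrow> qp a q) F"
proof -
  have "isCont (\<lambda>a. qp a q) a"
    unfolding isCont_def by (rule holomorphic_on_LIM[OF qp_holomorphic[OF assms(2)]]) auto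
  then show ?thesis by (rule isCont_tendsto_compose[OF _ assms(1)])
qed

section \<open>Theta series and the Jacobi triple product\<close>

text \<open>The term is \<open>(u ^ n * B) ^ n\<close>, and its base is eventually below
  1/2.\<close>

lemma summable_theta_nat:
  fixes u B :: real
  assumes u: "0 \<le> u" "u < 1" and B: "B \<ge> 0"
  shows "summable (\<lambda>n::nat. u ^ (n ^ 2) * B ^ n)"
proof -
  have "(\<lambda>n. u ^ n * B) \<longlonglongrightarrow> 0 * B"
    using u by (intro tendsto_intros LIMSEQ_power_zero) auto
  then have "\<forall>\<^sub>F n in sequentially. u ^ n * B < 1 / 2"
    by (rule order_tendstoD) simp
  then obtain N where N: "\<And>n. n \<ge> N \<Longrightarrow> u ^ n * B < 1 / 2"
    by (auto simp: eventually_sequentially)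
  show ?thesis
  proof (rule summable_comparison_test')
    show "summable (\<lambda>n. (1 / 2 :: real) ^ n)" by (rule summable_geometric) simp
    fix n assume "n \<ge> N"
    have "u ^ (n ^ 2) * B ^ n = (u ^ n * B) ^ n"
      by (simp add: power_mult_distrib power2_eq_square power_mult)
    also have "\<dots> \<le> (1 / 2) ^ n"
      using N[OF \<open>n \<ge> N\<close>] u B by (intro power_mono) auto
    finally show "norm (u ^ (n ^ 2) * B ^ n) \<le> (1 / 2) ^ n"
      using u B by simp
  qed
qed

lemma summable_on_int_abs:
  fixes F :: "nat \<Rightarrow> real"
  assumes "summable F" "\<And>n. F n \<ge> 0"
  shows "(\<lambda>n::int. F (nat \<bar>n\<bar>)) summable_on UNIV"
proof -
  have F: "F summable_on UNIV"
    using assms by (simp add: summable_on_UNIV_nonneg_real_iff)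
  have 1: "(\<lambda>n::int. F (nat \<bar>n\<bar>)) summable_on range int"
    by (subst summable_on_reindex) (use F in \<open>auto simp: o_def inj_on_def\<close>)
  have 2: "(\<lambda>n::int. F (nat \<bar>n\<bar>)) summable_on range (\<lambda>n. - int n)"
    by (subst summable_on_reindex) (use F in \<open>auto simp: o_def inj_on_def\<close>)
  have "(\<lambda>n::int. F (nat \<bar>n\<bar>)) summable_on (range int \<union> range (\<lambda>n. - int n))"
    using 1 2 by (rule summable_on_union)
  moreover have "range int \<union> range (\<lambda>n. - int n) = UNIV"
    by (auto simp: image_iff) (metis int_cases2)
  ultimately show ?thesis by simp
qed

text \<open>A majorant of the two-sided theta term of base norm \<open>u\<close>, valid whenever
  \<open>B\<close> dominates both \<open>norm x\<close> and \<open>1 / norm x\<close>. It serves the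
  Appell sums as well.\<close>

definition theta_bound :: "real \<Rightarrow> real \<Rightarrow> int \<Rightarrow> real" where
  "theta_bound u B n = u ^ (nat \<bar>n\<bar> ^ 2) * B ^ nat \<bar>n\<bar>"

lemma summable_theta_bound:
  assumes "0 \<le> u" "u < 1" "B \<ge> 0"
  shows "theta_bound u B summable_on UNIV"
  unfolding theta_bound_def using assms by (intro summable_on_int_abs summable_theta_nat) auto

lemma norm_theta_term_le:
  fixes q x :: complex
  assumes "x \<noteq> 0" "norm x \<le> B" "1 / norm x \<le> B"
  shows "norm (q powi (n ^ 2) * x powi n) \<le> theta_bound (norm q) B n"
proof -
  have B: "B > 0" using assms by (smt (verit) zero_less_norm_iff)
  have "nat (n ^ 2) = nat \<bar>n\<bar> ^ 2" by (simp add: nat_power_eq[symmetric])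
  then have 1: "norm (q powi (n ^ 2)) = norm q ^ (nat \<bar>n\<bar> ^ 2)"
    by (simp add: power_int_def norm_power)
  have 2: "norm (x powi n) \<le> B ^ nat \<bar>n\<bar>"
  proof (cases "n \<ge> 0")
    case True then show ?thesis using assms by (auto simp: power_int_def norm_power intro!: power_mono)
  next
    case False
    have "norm (x powi n) = (1 / norm x) ^ nat \<bar>n\<bar>"
      using False by (simp add: power_int_def norm_power norm_inverse divide_inverse)
    also have "\<dots> \<le> B ^ nat \<bar>n\<bar>" using assms by (intro power_mono) auto
    finally show ?thesis .
  qed
  show ?thesis unfolding theta_bound_def norm_mult 1 by (intro mult_left_mono 2) auto
qed

lemma summable_theta:
  fixes q x :: complex
  assumes "norm q < 1" "x \<noteq> 0"
  shows "(\<lambda>n. norm (q powi (n ^ 2) * x powi n)) summable_on UNIV"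
    "(\<lambda>n. q powi (n ^ 2) * x powi n) summable_on UNIV"
proof -
  define B where "B = max (norm x) (1 / norm x)"
  show *: "(\<lambda>n. norm (q powi (n ^ 2) * x powi n)) summable_on UNIV"
    by (rule summable_on_comparison_test[OF summable_theta_bound[of "norm q" B]])
       (use assms in \<open>auto simp: B_def intro!: norm_theta_term_le simp: le_max_iff_disj\<close>)
  show "(\<lambda>n. q powi (n ^ 2) * x powi n) summable_on UNIV"
    using * by (rule abs_summable_summable)
qed

lemma analytic_infsum:
  fixes f :: "'i \<Rightarrow> complex \<Rightarrow> complex"
  assumes r: "r > 0" and hol: "\<And>i. i \<in> I \<Longrightarrow> f i holomorphic_on cball z r"
    and bd: "\<And>i x. i \<in> I \<Longrightarrow> x \<in> cball z r \<Longrightarrow> norm (f i x) \<le> M i" and M: "M summable_on I"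
  shows "(\<lambda>x. \<Sum>\<^sub>\<infinity>i\<in>I. f i x) analytic_on {z}"
proof -
  have ul: "uniform_limit (cball z r) (\<lambda>X x. \<Sum>i\<in>X. f i x) (\<lambda>x. \<Sum>\<^sub>\<infinity>i\<in>I. f i x) (finite_subsets_at_top I)"
    by (rule Weierstrass_m_test_general[OF bd M])
  have ev: "\<forall>\<^sub>F X in finite_subsets_at_top I.
      continuous_on (cball z r) (\<lambda>x. \<Sum>i\<in>X. f i x) \<and> (\<lambda>x. \<Sum>i\<in>X. f i x) holomorphic_on ball z r"
  proof (rule eventually_finite_subsets_at_top_weakI)
    fix X assume X: "finite X" "X \<subseteq> I"
    have "(\<lambda>x. \<Sum>i\<in>X. f i x) holomorphic_on cball z r"
      using X hol by (intro holomorphic_on_sum) auto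
    then show "continuous_on (cball z r) (\<lambda>x. \<Sum>i\<in>X. f i x) \<and> (\<lambda>x. \<Sum>i\<in>X. f i x) holomorphic_on ball z r"
      using holomorphic_on_imp_continuous_on holomorphic_on_subset ball_subset_cball by blast
  qed
  have "(\<lambda>x. \<Sum>\<^sub>\<infinity>i\<in>I. f i x) holomorphic_on ball z r"
    by (rule holomorphic_uniform_limit[OF ev ul]) auto
  then show ?thesis using r analytic_at[of _ z] by (metis centre_in_ball open_ball)
qed

text \<open>Jacobi's theta function in multiplicative notation. With exponent $n^2$ its natural
  shift is by \<open>q ^ 2\<close>, so the products on the other side have base
  \<open>q ^ 2\<close>.\<close>

definition jac :: "complex \<Rightarrow> complex \<Rightarrow> complex" where
  "jac q x = (\<Sum>\<^sub>\<infinity>n\<in>(UNIV :: int set). q powi (n ^ 2) * x powi n)"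

lemma cball_bounds:
  fixes z x :: complex
  assumes "z \<noteq> 0" "x \<in> cball z (norm z / 2)"
  shows "x \<noteq> 0" "norm x \<le> 2 * norm z" "norm z / 2 \<le> norm x"
proof -
  have d: "norm (z - x) \<le> norm z / 2" using assms by (simp add: dist_norm)
  show le: "norm z / 2 \<le> norm x" using d norm_triangle_ineq2[of z x] by linarith
  show "x \<noteq> 0" using le assms by auto
  show "norm x \<le> 2 * norm z" using d norm_triangle_ineq2[of x z] norm_minus_commute[of x z] norm_ge_zero[of z] by linarith
qed

lemma jac_analytic:
  assumes "norm q < 1" "z \<noteq> 0"
  shows "jac q analytic_on {z}"
proof -
  define B where "B = max (2 * norm z) (2 / norm z)"
  have "(\<lambda>x. \<Sum>\<^sub>\<infinity>n\<in>(UNIV :: int set). q powi (n ^ 2) * x powi n) analytic_on {z}"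
  proof (rule analytic_infsum[where r = "norm z / 2" and M = "theta_bound (norm q) B"])
    fix n :: int and x assume x: "x \<in> cball z (norm z / 2)"
    note c = cball_bounds[OF assms(2) x]
    show "norm (q powi (n ^ 2) * x powi n) \<le> theta_bound (norm q) B n"
    proof (rule norm_theta_term_le)
      have "1 / norm x \<le> 1 / (norm z / 2)" using c assms by (intro divide_left_mono) auto
      then show "1 / norm x \<le> B" by (simp add: B_def le_max_iff_disj)
    qed (use c in \<open>auto simp: B_def le_max_iff_disj\<close>)
  next
    fix n :: int
    show "(\<lambda>x. q powi (n ^ 2) * x powi n) holomorphic_on cball z (norm z / 2)"
      using cball_bounds(1)[OF assms(2)] by (intro holomorphic_intros) auto
  qed (use assms in \<open>auto simp: B_def le_max_iff_disj intro!: summable_theta_bound\<close>)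
  then show ?thesis unfolding jac_def[abs_def] .
qed

lemma jac_analytic_comp [analytic_intros]:
  assumes "norm q < 1" "f analytic_on A" "\<And>z. z \<in> A \<Longrightarrow> f z \<noteq> 0"
  shows "(\<lambda>z. jac q (f z)) analytic_on A"
proof -
  have "jac q analytic_on (f ` A)"
    unfolding analytic_on_analytic_at[of _ "f ` A"] using assms jac_analytic by blast
  from analytic_on_compose[OF assms(2) this] show ?thesis by (simp only: o_def)
qed

lemma tendsto_jac [tendsto_intros]:
  assumes "(f \<longlongrightarrow> a) F" "norm q < 1" "a \<noteq> 0"
  shows "((\<lambda>x. jac q (f x)) \<longlongrightarrow> jac q a) F"
  using isCont_tendsto_compose[OF analytic_at_imp_isCont[OF jac_analytic[OF assms(2,3)]] assms(1)] .

text \<open>The index shift \<open>n \<mapsto> n + 1\<close> absorbs the factor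
  \<open>q powi (2 * n)\<close> by completing the square.\<close>

lemma jac_shift:
  assumes "q \<noteq> 0" "x \<noteq> 0"
  shows "jac q (q ^ 2 * x) = jac q x / (q * x)"
proof -
  have "jac q (q ^ 2 * x) = (\<Sum>\<^sub>\<infinity>n. (q powi (n ^ 2) * x powi n) / (q * x))"
    unfolding jac_def
  proof (rule infsum_reindex_bij_witness[of _ "\<lambda>n. n - 1" "\<lambda>n. n + 1"])
    fix n :: int
    have "q powi ((n + 1) ^ 2) = q powi (n ^ 2) * q powi (2 * n) * q"
      using assms by (simp add: power2_eq_square algebra_simps power_int_add)
    moreover have "(q ^ 2 * x) powi n = q powi (2 * n) * x powi n"
      by (simp add: power_int_mult_distrib power_int_mult)
    ultimately show "q powi (n + 1)\<^sup>2 * x powi (n + 1) / (q * x) = q powi n\<^sup>2 * (q\<^sup>2 * x) powi n"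
      using assms by (simp add: power_int_add field_simps)
  qed auto
  then show ?thesis by (simp only: jac_def divide_inverse infsum_cmult_left')
qed

lemma jac_inverse: "jac q (1 / x) = jac q x"
  unfolding jac_def
  by (rule infsum_reindex_bij_witness[of _ uminus uminus])
     (auto simp: power_int_minus power_int_divide_distrib field_simps)

text \<open>The shift from \<open>- 1 / q\<close> to \<open>- q\<close> changes the sign, while
  these two points are inverse to each other and inversion preserves \<open>jac\<close>.\<close>

lemma jac_zero:
  assumes "q \<noteq> 0"
  shows "jac q (- q) = 0" "jac q (- 1 / q) = 0"
proof -
  have "jac q (q ^ 2 * (- 1 / q)) = jac q (- 1 / q) / (q * (- 1 / q))"
    using assms by (intro jac_shift) auto
  moreover have "q ^ 2 * (- 1 / q) = - q" using assms by (simp add: power2_eq_square)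
  moreover have "jac q (- 1 / q) = jac q (- q)" using jac_inverse[of q "- q"] by simp
  ultimately show "jac q (- q) = 0" "jac q (- 1 / q) = 0" using assms by auto
qed

lemma power_less_one_norm:
  fixes q :: complex
  assumes "norm q < 1" "n > 0"
  shows "norm (q ^ n) < 1"
  using assms by (simp add: norm_power power_less_one_iff)

text \<open>Zeros are isolated because the punctured plane is connected and \<open>f\<close> does
  not vanish identically, as \<open>w\<close> witnesses.\<close>

lemma eventually_analytic_nonzero:
  fixes f :: "complex \<Rightarrow> complex"
  assumes an: "\<And>z. z \<noteq> 0 \<Longrightarrow> f analytic_on {z}" and w: "w \<noteq> 0" "f w \<noteq> 0" and z: "z \<noteq> 0"
  shows "\<forall>\<^sub>F x in at z. f x \<noteq> 0"
proof (cases "f z = 0")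
  case True
  have "f analytic_on (- {0})" unfolding analytic_on_analytic_at[of f "- {0}"] using an by auto
  then have hol: "f holomorphic_on (- {0})" by (rule analytic_imp_holomorphic)
  have "connected (- {0::complex})" by (rule connected_punctured_universe) simp
  from isolated_zeros[OF hol _ this _ True, of w]
  obtain r where "0 < r" "ball z r \<subseteq> - {0}" "\<And>x. x \<in> ball z r - {z} \<Longrightarrow> f x \<noteq> 0"
    using w z by auto
  then show ?thesis by (auto simp: eventually_at dist_commute intro!: exI[of _ r])
next
  case False
  then have "\<forall>\<^sub>F x in nhds z. f x \<noteq> 0"
    using analytic_at_imp_isCont[OF an[OF z]] by (intro tendsto_imp_eventually_ne) (auto simp: isCont_def tendsto_at_iff_tendsto_nhds)
  then show ?thesis by (simp add: eventually_at_filter eventually_mono)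
qed

lemma qp_split2:
  assumes "norm q < 1"
  shows "qp a q = qp a (q ^ 2) * qp (a * q) (q ^ 2)"
proof -
  have "{..<2::nat} = {0, 1}" by auto
  then show ?thesis using qp_split[OF assms, of 2 a] by simp
qed

lemma qp_split3:
  assumes "norm q < 1"
  shows "qp a q = qp a (q ^ 3) * qp (a * q) (q ^ 3) * qp (a * q ^ 2) (q ^ 3)"
proof -
  have "{..<3::nat} = {0, 1, 2}" by auto
  then show ?thesis using qp_split[OF assms, of 3 a] by (simp add: mult.assoc)
qed

section \<open>The product side of the triple product, up to a factor depending only on
  \<open>q\<close>\<close>

definition jac_prod :: "complex \<Rightarrow> complex \<Rightarrow> complex" where
  "jac_prod q x = qp (- (q * x)) (q ^ 2) * qp (- (q / x)) (q ^ 2)"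

lemma jac_prod_inverse: "jac_prod q (1 / x) = jac_prod q x"
  by (simp add: jac_prod_def)

context
  fixes q :: complex
  assumes q: "q \<noteq> 0" "norm q < 1"
begin

lemma norm_square_less_1: "norm (q ^ 2) < 1" "0 < norm (q ^ 2)"
  using power_less_one_norm[OF q(2), of 2] q by auto

text \<open>The shift removes the factor \<open>1 + q * x\<close> from one product and adds
  \<open>1 + 1 / (q * x)\<close> to the other. If \<open>1 + q * x = 0\<close>, no division is
  possible, but both sides are 0.\<close>

lemma jac_prod_shift:
  assumes "x \<noteq> 0"
  shows "jac_prod q (q ^ 2 * x) = jac_prod q x / (q * x)"
proof (cases "1 + q * x = 0")
  case False
  have 1: "qp (- (q * x)) (q ^ 2) = (1 + q * x) * qp (- (q * (q ^ 2 * x))) (q ^ 2)"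
    using qp_rec[OF norm_square_less_1(1), of "- (q * x)"] by (simp add: mult_ac)
  have "- (q / (q ^ 2 * x)) * q ^ 2 = - (q / x)" using q assms by (simp add: field_simps)
  then have 2: "qp (- (q / (q ^ 2 * x))) (q ^ 2) = (1 + q / (q ^ 2 * x)) * qp (- (q / x)) (q ^ 2)"
    using qp_rec[OF norm_square_less_1(1), of "- (q / (q ^ 2 * x))"] by simp
  have 3: "1 + q / (q ^ 2 * x) = (1 + q * x) / (q * x)"
    using q assms by (simp add: field_simps power2_eq_square)
  show ?thesis unfolding jac_prod_def 1 2 3 using False q assms by (simp add: field_simps)
next
  case True
  then have qx: "q * x = - 1" by (simp add: add_eq_0_iff)
  have "qp (- (q * x)) (q ^ 2) = 0" using qp_rec[OF norm_square_less_1(1), of "- (q * x)"] qx by simp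
  moreover have "q / (q ^ 2 * x) = - 1"
    using q assms qx by (simp add: field_simps power2_eq_square)
  then have "qp (- (q / (q ^ 2 * x))) (q ^ 2) = 0" using qp_rec[OF norm_square_less_1(1), of "- (q / (q ^ 2 * x))"] by simp
  ultimately show ?thesis by (simp add: jac_prod_def)
qed

lemma jac_prod_analytic: "z \<noteq> 0 \<Longrightarrow> jac_prod q analytic_on {z}"
  unfolding jac_prod_def[abs_def] by (intro analytic_intros norm_square_less_1) auto

lemma jac_prod_nz:
  assumes "norm (q ^ 2) < norm x" "norm x \<le> 1" "jac_prod q x = 0"
  shows "x = - q"
proof -
  have "norm (q * x) \<le> norm q" using assms by (simp add: norm_mult mult_left_le)
  then have "qp (- (q * x)) (q ^ 2) \<noteq> 0" using q by (intro qp_nonzero norm_square_less_1) auto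
  then have "qp (- (q / x)) (q ^ 2) = 0" using assms by (simp add: jac_prod_def)
  then obtain k where k: "- (q / x) * (q ^ 2) ^ k = 1" using qp_eq_0_iff[OF norm_square_less_1(1)] by blast
  have x: "x \<noteq> 0" using assms q by auto
  have xe: "x = - (q * (q ^ 2) ^ k)" using k x by (simp add: field_simps)
  show ?thesis
  proof (cases k)
    case 0 then show ?thesis using xe by simp
  next
    case (Suc j)
    have "norm x = norm (q ^ 2) * (norm q * norm (q ^ 2) ^ j)"
      unfolding xe Suc by (simp add: norm_mult norm_power)
    also have "\<dots> \<le> norm (q ^ 2) * (1 * 1)"
      using q norm_square_less_1 by (intro mult_mono power_le_one) auto
    finally show ?thesis using assms by simp
  qed
qed

lemma jac_prod_1: "jac_prod q 1 \<noteq> 0"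
  using qp_nonzero[OF norm_square_less_1(1), of "- q"] q by (simp add: jac_prod_def)

text \<open>Both sides have the same multiplier, and the only zero of the product in the fundamental
  annulus, \<open>- q\<close>, is also a zero of the series. The quotient is therefore
  constant.\<close>

lemma jac_jac_prod_ratio: "\<exists>C. \<forall>x. x \<noteq> 0 \<longrightarrow> jac q x = C * jac_prod q x"
proof -
  let ?D = "\<lambda>x. jac q x / jac_prod q x" and ?S = "{x. jac_prod q x = 0}"
  have ev: "\<forall>\<^sub>F x in at z. x \<notin> ?S" if "z \<noteq> 0" for z
    using eventually_analytic_nonzero[OF jac_prod_analytic _ jac_prod_1 that] by simp
  have lim: "((\<lambda>z. (z - (- q)) * ?D z) \<longlongrightarrow> 0) (at (- q))"
  proof -
    \<comment> \<open>\<open>?h\<close> is \<open>(x + q) * ?D x\<close> with the vanishing factor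
      \<open>1 + q / x\<close> divided out; its numerator is 0 at \<open>- q\<close> by
      \<open>jac_zero\<close>.\<close>
    let ?h = "\<lambda>x. x * jac q x / (qp (- (q * x)) (q ^ 2) * qp (- (q ^ 3 / x)) (q ^ 2))"
    have q3: "norm (q ^ 2) < 1" by (rule norm_square_less_1)
    have nz: "qp (q ^ 2) (q ^ 2) \<noteq> 0" by (rule qp_nonzero[OF q3 q3])
    have "?h \<midarrow>- q\<rightarrow> (- q) * jac q (- q) / (qp (- (q * - q)) (q ^ 2) * qp (- (q ^ 3 / - q)) (q ^ 2))"
      using q q3 nz by (intro tendsto_intros) (auto simp: power2_eq_square power3_eq_cube)
    then have "?h \<midarrow>- q\<rightarrow> 0" using jac_zero[OF q(1)] by simp
    moreover have "\<forall>\<^sub>F x in at (- q). ?h x = (x - (- q)) * ?D x"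
    proof -
      have "\<forall>\<^sub>F x in at (- q). x \<noteq> 0 \<and> x \<noteq> - q"
        using q by (intro eventually_conj eventually_neq_at_within)
      then show ?thesis
      proof eventually_elim
        case (elim x)
        have e: "- (q / x) * q ^ 2 = - (q ^ 3 / x)" by (simp add: power2_eq_square power3_eq_cube)
        have "jac_prod q x = (1 + q / x) * (qp (- (q * x)) (q ^ 2) * qp (- (q ^ 3 / x)) (q ^ 2))"
          unfolding jac_prod_def qp_rec[OF q3, of "- (q / x)"] e by simp
        moreover have "x + q \<noteq> 0" using elim by (simp add: add_eq_0_iff2)
        moreover have "1 + q / x = (x + q) / x" using elim by (simp add: field_simps)
        ultimately show ?case using elim by simp
      qed
    qed
    ultimately show ?thesis by (rule Lim_transform_eventually)
  qed
  have "\<exists>C. \<forall>z. z \<noteq> 0 \<longrightarrow> norm z < 1 / norm (q ^ 2) \<longrightarrow> z \<notin> ?S \<longrightarrow> ?D z = C"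
  proof (rule qshift_periodic_const[of "q ^ 2" ?S ?D])
    show "0 < norm (q ^ 2)" "norm (q ^ 2) < 1" by (fact norm_square_less_1)+
    show "?D analytic_on {z}" if "z \<noteq> 0" "z \<notin> ?S" for z
      using that q jac_prod_analytic jac_analytic by (intro analytic_intros) auto
    show "\<forall>\<^sub>F x in at z. x \<notin> ?S" if "z \<noteq> 0" for z by (rule ev[OF that])
    show "q ^ 2 * z \<in> ?S \<longleftrightarrow> z \<in> ?S" if "z \<noteq> 0" for z
      using jac_prod_shift[OF that] that q by simp
    show "?D (q ^ 2 * z) = ?D z" if "z \<noteq> 0" for z
      using jac_prod_shift[OF that] jac_shift[OF q(1) that] that q by simp
    show "((\<lambda>z. (z - s) * ?D z) \<longlongrightarrow> 0) (at s)" if "s \<in> ?S" "norm (q ^ 2) < norm s" "norm s \<le> 1" for s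
      using jac_prod_nz[of s] that lim by simp
  qed
  then obtain C where C: "\<And>z. z \<noteq> 0 \<Longrightarrow> norm z < 1 / norm (q ^ 2) \<Longrightarrow> z \<notin> ?S \<Longrightarrow> ?D z = C"
    by blast
  have 1: "jac q x = C * jac_prod q x" if x: "x \<noteq> 0" "norm x < 1 / norm (q ^ 2)" for x
  proof (cases "x \<in> ?S")
    case False then show ?thesis using C[OF x False] by (simp add: field_simps)
  next
    case True
    have l1: "jac q \<midarrow>x\<rightarrow> jac q x"
      using analytic_at_imp_isCont[OF jac_analytic[OF q(2) x(1)]] isContD by blast
    have l2: "(\<lambda>x. C * jac_prod q x) \<midarrow>x\<rightarrow> C * jac_prod q x"
      using analytic_at_imp_isCont[OF jac_prod_analytic[OF x(1)]] isContD by (intro tendsto_intros) blast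
    have "\<forall>\<^sub>F y in at x. y \<in> ball 0 (1 / norm (q ^ 2)) - {0}"
    proof -
      have "open (ball 0 (1 / norm (q ^ 2)) - {0::complex})" by auto
      then have "\<forall>\<^sub>F y in nhds x. y \<in> ball 0 (1 / norm (q ^ 2)) - {0}"
        by (rule eventually_nhds_in_open) (use x in auto)
      then show ?thesis by (auto simp: eventually_at_filter elim: eventually_mono)
    qed
    then have "\<forall>\<^sub>F y in at x. jac q y = C * jac_prod q y"
      using ev[OF x(1)]
    proof eventually_elim
      case (elim y)
      then show ?case using C[of y] by (auto simp: field_simps)
    qed
    then show ?thesis by (rule LIM_unique_eventually[OF l1 l2])
  qed
  show ?thesis
  proof (intro exI[of _ C] allI impI)
    fix x :: complex assume x: "x \<noteq> 0"
    show "jac q x = C * jac_prod q x"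
    proof (cases "norm x < 1 / norm (q ^ 2)")
      case True then show ?thesis using 1 x by blast
    next
      \<comment> \<open>The rigidity argument covers only a disc. Inversion preserves both sides and
        sends the remaining points into that disc.\<close>
      case False
      then have "norm (1 / x) \<le> norm (q ^ 2)"
        using q x by (simp add: norm_divide field_simps)
      also have "\<dots> < 1" by (rule norm_square_less_1)
      also have "1 < 1 / norm (q ^ 2)" using norm_square_less_1 by (simp only: less_divide_eq_1_pos)
      finally have "jac q (1 / x) = C * jac_prod q (1 / x)" using 1[of "1 / x"] x by simp
      then show ?thesis by (simp only: jac_inverse jac_prod_inverse)
    qed
  qed
qed

end

text \<open>
  This relation between \<open>q\<close> and \<open>q^4\<close> determines the constant in the triple product, by iteration.
\<close>

lemma jac_i:
  assumes q: "norm q < 1"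
  shows "jac q \<i> = jac (q ^ 4) (- 1)"
proof -
  let ?t = "\<lambda>(x::complex) n::int. q powi (n ^ 2) * x powi n"
  have ii: "1 / \<i> = - \<i>" by (simp add: field_simps)
  have "2 * jac q \<i> = jac q \<i> + jac q (- \<i>)"
    using jac_inverse[of q \<i>] by (simp add: ii)
  also have "\<dots> = (\<Sum>\<^sub>\<infinity>n. ?t \<i> n + ?t (- \<i>) n)"
    unfolding jac_def by (intro infsum_add [symmetric] summable_theta q) auto
  \<comment> \<open>The terms with odd index cancel between \<open>\<i>\<close> and
    \<open>- \<i>\<close>; the even ones give base \<open>q ^ 4\<close> and argument -1.\<close>
  also have "\<dots> = (\<Sum>\<^sub>\<infinity>n\<in>{n. even n}. ?t \<i> n + ?t (- \<i>) n)"
  proof (rule infsum_cong_neutral)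
    fix n :: int assume "n \<in> UNIV - {n. even n}"
    then have "(- \<i>) powi n = - (\<i> powi n)" by (simp add: power_int_minus_left)
    then show "?t \<i> n + ?t (- \<i>) n = 0" by simp
  qed auto
  also have "\<dots> = (\<Sum>\<^sub>\<infinity>n. 2 * ((q ^ 4) powi (n ^ 2) * (- 1) powi n))"
  proof (rule infsum_reindex_bij_witness[of _ "\<lambda>n. 2 * n" "\<lambda>n. n div 2"])
    fix n :: int assume "n \<in> {n. even n}"
    then obtain m where n: "n = 2 * m" by auto
    have "\<i> powi (2 * m) = (- 1) powi m" "(- \<i>) powi (2 * m) = (- 1) powi m"
      by (simp_all add: power_int_mult)
    moreover have "q powi ((2 * m) ^ 2) = (q ^ 4) powi (m ^ 2)"
      using power_int_mult[of q 4 "m ^ 2"] by (simp add: power_mult_distrib)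
    ultimately show "2 * ((q ^ 4) powi ((n div 2) ^ 2) * (- 1) powi (n div 2)) = ?t \<i> n + ?t (- \<i>) n"
      using n by simp
  qed auto
  also have "\<dots> = 2 * jac (q ^ 4) (- 1)" by (simp add: jac_def infsum_cmult_right')
  finally show ?thesis by simp
qed

lemma jac_tendsto_1: "((\<lambda>q. jac q 1) \<longlongrightarrow> 1) (at 0)"
proof -
  have "(\<lambda>q. \<Sum>\<^sub>\<infinity>n\<in>(UNIV :: int set). q powi (n ^ 2) * 1 powi n) analytic_on {0}"
  proof (rule analytic_infsum[where r = "1/2" and M = "theta_bound (1/2) 1"])
    fix n :: int and q :: complex assume "q \<in> cball 0 (1/2)"
    then have q: "norm q \<le> 1/2" by simp
    have "norm (q powi (n ^ 2) * 1 powi n) \<le> theta_bound (norm q) 1 n"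
      by (rule norm_theta_term_le) auto
    also have "\<dots> \<le> theta_bound (1/2) 1 n" using q by (auto simp: theta_bound_def intro!: power_mono)
    finally show "norm (q powi (n ^ 2) * 1 powi n) \<le> theta_bound (1/2) 1 n" .
  next
    fix n :: int
    have "(\<lambda>q::complex. q powi (n ^ 2) * 1 powi n) = (\<lambda>q. q ^ nat (n ^ 2))"
      by (simp add: power_int_def)
    then show "(\<lambda>q::complex. q powi (n ^ 2) * 1 powi n) holomorphic_on cball 0 (1/2)"
      by (simp only:) (intro holomorphic_intros)
  qed (auto intro!: summable_theta_bound)
  then have "isCont (\<lambda>q. jac q 1) 0" unfolding jac_def by (rule analytic_at_imp_isCont)
  \<comment> \<open>Powers of 0 vanish except for exponent 0, so only the index 0
    contributes.\<close>
  moreover have "jac 0 1 = 1"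
  proof -
    have "jac 0 1 = (\<Sum>\<^sub>\<infinity>n\<in>{0::int}. 1 :: complex)"
      unfolding jac_def by (rule infsum_cong_neutral) (auto simp: power_int_0_left)
    then show ?thesis by simp
  qed
  ultimately show ?thesis by (simp add: isCont_def)
qed

lemma jac_prod_tendsto_1: "((\<lambda>q. jac_prod q 1) \<longlongrightarrow> 1) (at 0)" "((\<lambda>q. qp (q ^ 2) (q ^ 2)) \<longlongrightarrow> 1) (at 0)"
proof -
  have *: "((\<lambda>q. qp (f q) (q ^ 2)) \<longlongrightarrow> 1) (at 0)" if f: "(f \<longlongrightarrow> 0) (at 0)" for f
  proof -
    have "((\<lambda>q. exp (norm (f q) / (1 - norm (q ^ 2))) - 1) \<longlongrightarrow> exp (norm (0::complex) / (1 - norm ((0::complex) ^ 2))) - 1) (at 0)"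
      by (intro tendsto_intros f) auto
    then have "((\<lambda>q. exp (norm (f q) / (1 - norm (q ^ 2))) - 1) \<longlongrightarrow> 0) (at 0)" by simp
    moreover have "\<forall>\<^sub>F q in at 0. norm (qp (f q) (q ^ 2) - 1) \<le> exp (norm (f q) / (1 - norm (q ^ 2))) - 1"
      using eventually_at_in_open'[of "ball (0::complex) 1" 0]
    proof (rule eventually_mono)
      fix x :: complex assume "x \<in> ball 0 1"
      then show "norm (qp (f x) (x ^ 2) - 1) \<le> exp (norm (f x) / (1 - norm (x ^ 2))) - 1"
        by (intro norm_qp_minus_1_le power_less_one_norm) auto
    qed auto
    ultimately have "((\<lambda>q. qp (f q) (q ^ 2) - 1) \<longlongrightarrow> 0) (at 0)"
      by (rule Lim_null_comparison[rotated])
    then show ?thesis by (simp add: LIM_zero_iff)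
  qed
  show "((\<lambda>q. qp (q ^ 2) (q ^ 2)) \<longlongrightarrow> 1) (at 0)"
    by (rule *) (auto intro!: tendsto_eq_intros)
  have "((\<lambda>q. qp (- q) (q ^ 2)) \<longlongrightarrow> 1) (at 0)"
    by (rule *) (auto intro!: tendsto_eq_intros)
  from tendsto_mult[OF this this] show "((\<lambda>q. jac_prod q 1) \<longlongrightarrow> 1) (at 0)" by (simp add: jac_prod_def)
qed

text \<open>The ratio \<open>C q\<close> of the two sides is independent of \<open>x\<close>.
  Equality of \<open>C q\<close> and \<open>C (q ^ 4)\<close> allows \<open>q\<close> to be replaced
  by \<open>q ^ (4 ^ n)\<close>, and \<open>C\<close> tends to 1 at the origin.\<close>

theorem jacobi_triple_product:
  assumes q: "q \<noteq> 0" "norm q < 1" and x: "x \<noteq> 0"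
  shows "jac q x = qp (q ^ 2) (q ^ 2) * qp (- (q * x)) (q ^ 2) * qp (- (q / x)) (q ^ 2)"
proof -
  define C where "C = (\<lambda>q. jac q 1 / (jac_prod q 1 * qp (q ^ 2) (q ^ 2)))"
  have nz: "qp (q ^ 2) (q ^ 2) \<noteq> 0" if "norm q < 1" for q
    using that by (intro qp_nonzero power_less_one_norm) auto
  have jtp: "jac q x = C q * (jac_prod q x * qp (q ^ 2) (q ^ 2))" if q: "q \<noteq> 0" "norm q < 1" and x: "x \<noteq> 0" for q x
  proof -
    obtain K where K: "\<And>x. x \<noteq> 0 \<Longrightarrow> jac q x = K * jac_prod q x"
      using jac_jac_prod_ratio[OF q] by blast
    have "C q * qp (q ^ 2) (q ^ 2) = K"
      using K[of 1] jac_prod_1[OF q] nz[OF q(2)] by (simp add: C_def)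
    then show ?thesis using K[OF x] by (simp add: mult_ac)
  qed
  \<comment> \<open>By \<open>jac_i\<close> the series at \<open>\<i>\<close> with base
    \<open>q\<close> and at -1 with base \<open>q ^ 4\<close> agree. The splittings below show that
    the products agree too, and they are nonzero.\<close>
  have C4: "C q = C (q ^ 4)" if q: "q \<noteq> 0" "norm q < 1" for q
  proof -
    have n: "norm (q ^ 2) < 1" "norm (q ^ 4) < 1" "norm (q ^ 8) < 1"
      using power_less_one_norm[OF q(2)] by auto
    have e: "(q ^ 4) ^ 2 = q ^ 8" "(q ^ 2) ^ 2 = q ^ 4" by (simp_all flip: power_mult)
    have "jac_prod q \<i> = qp (- (q * \<i>)) (q ^ 2) * qp (- (- (q * \<i>))) (q ^ 2)"
      by (simp add: jac_prod_def divide_inverse)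
    also have "\<dots> = qp ((- (q * \<i>)) ^ 2) ((q ^ 2) ^ 2)" by (rule qp_mult_minus[OF n(1)])
    finally have 1: "jac_prod q \<i> = qp (- (q ^ 2)) (q ^ 4)" by (simp add: power_mult_distrib e)
    have 2: "qp (q ^ 2) (q ^ 2) = qp (q ^ 2) (q ^ 4) * qp (q ^ 4) (q ^ 4)"
      using qp_split2[OF n(1), of "q ^ 2"] by (simp add: e flip: power_add)
    have 3: "qp (q ^ 4) (q ^ 4) = qp (q ^ 4) (q ^ 8) * qp (q ^ 8) (q ^ 8)"
      using qp_split2[OF n(2), of "q ^ 4"] by (simp add: e flip: power_add)
    have 4: "qp (q ^ 2) (q ^ 4) * qp (- (q ^ 2)) (q ^ 4) = qp (q ^ 4) (q ^ 8)"
      using qp_mult_minus[OF n(2), of "q ^ 2"] by (simp add: e)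
    have "jac_prod q \<i> * qp (q ^ 2) (q ^ 2) = (qp (q ^ 2) (q ^ 4) * qp (- (q ^ 2)) (q ^ 4)) * qp (q ^ 4) (q ^ 8) * qp (q ^ 8) (q ^ 8)"
      by (simp add: 1 2 3)
    also have "\<dots> = jac_prod (q ^ 4) (- 1) * qp ((q ^ 4) ^ 2) ((q ^ 4) ^ 2)"
      by (simp add: 4 jac_prod_def e)
    finally have *: "jac_prod q \<i> * qp (q ^ 2) (q ^ 2) = jac_prod (q ^ 4) (- 1) * qp ((q ^ 4) ^ 2) ((q ^ 4) ^ 2)" .
    have "jac_prod (q ^ 4) (- 1) * qp ((q ^ 4) ^ 2) ((q ^ 4) ^ 2) \<noteq> 0"
      using qp_nonzero[OF n(3) n(2)] qp_nonzero[OF n(3) n(3)] by (simp add: jac_prod_def e)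
    moreover have "C q * (jac_prod q \<i> * qp (q ^ 2) (q ^ 2)) = C (q ^ 4) * (jac_prod (q ^ 4) (- 1) * qp ((q ^ 4) ^ 2) ((q ^ 4) ^ 2))"
      using jtp[OF q, of \<i>] jtp[of "q ^ 4" "- 1"] jac_i[OF q(2)] q n by simp
    ultimately show ?thesis using * by simp
  qed
  have Cn: "C q = C (q ^ (4 ^ n))" for n
  proof (induction n)
    case (Suc n)
    have "C (q ^ (4 ^ n)) = C ((q ^ (4 ^ n)) ^ 4)"
      using q by (intro C4 power_less_one_norm) auto
    also have "(q ^ (4 ^ n)) ^ 4 = q ^ (4 ^ Suc n)" by (simp add: mult.commute flip: power_mult)
    finally show ?case using Suc by simp
  qed auto
  have "(C \<longlongrightarrow> 1 / (1 * 1)) (at 0)"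
    unfolding C_def by (intro tendsto_intros jac_tendsto_1 jac_prod_tendsto_1) auto
  moreover have "filterlim (\<lambda>n. q ^ (4 ^ n)) (at 0) sequentially"
  proof (rule filterlim_atI)
    have "filterlim (\<lambda>n::nat. (4::nat) ^ n) at_top sequentially"
      by (rule filterlim_subseq) (auto intro!: strict_monoI_Suc)
    then show "(\<lambda>n. q ^ (4 ^ n)) \<longlonglongrightarrow> 0"
      by (rule filterlim_compose[OF LIMSEQ_power_zero[OF q(2)]])
  qed (use q in auto)
  ultimately have "(\<lambda>n. C (q ^ (4 ^ n))) \<longlonglongrightarrow> 1 / (1 * 1)"
    by (rule filterlim_compose)
  then have "(\<lambda>n. C q) \<longlonglongrightarrow> 1" by (simp flip: Cn)
  then have "C q = 1" by (simp add: LIMSEQ_const_iff)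
  then show ?thesis using jtp[OF q x] by (simp add: jac_prod_def mult_ac)
qed

definition psi :: "complex \<Rightarrow> complex" where "psi q = jac (q ^ 2) (- q)"

lemma psi_eq:
  assumes q: "q \<noteq> 0" "norm q < 1"
  shows "psi q = qp (q ^ 2) (q ^ 2) / qp (- q) (q ^ 2)"
    and "psi q = qp (q ^ 4) (q ^ 4) * qp q (q ^ 2)"
proof -
  have n: "norm (q ^ 2) < 1" "norm (q ^ 4) < 1"
    using power_less_one_norm[OF q(2)] by auto
  have e: "(q ^ 2) ^ 2 = q ^ 4" "q ^ 2 * q = q ^ 3" by (simp_all flip: power_mult power_add power_Suc2)
  have e': "q ^ 2 / q = q" using q by (simp add: power2_eq_square)
  have 1: "psi q = qp (q ^ 4) (q ^ 4) * qp (q ^ 3) (q ^ 4) * qp q (q ^ 4)"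
    unfolding psi_def using q n by (subst jacobi_triple_product) (auto simp: e e')
  have 2: "qp q (q ^ 2) = qp q (q ^ 4) * qp (q ^ 3) (q ^ 4)"
    using qp_split2[OF n(1), of q] by (simp add: e mult.commute[of q])
  show 3: "psi q = qp (q ^ 4) (q ^ 4) * qp q (q ^ 2)" unfolding 1 2 by simp
  have 4: "qp q (q ^ 2) * qp (- q) (q ^ 2) = qp (q ^ 2) (q ^ 4)"
    using qp_mult_minus[OF n(1), of q] by (simp add: e)
  have 5: "qp (q ^ 2) (q ^ 2) = qp (q ^ 2) (q ^ 4) * qp (q ^ 4) (q ^ 4)"
    using qp_split2[OF n(1), of "q ^ 2"] by (simp add: e flip: power_add)
  have nz: "qp (- q) (q ^ 2) \<noteq> 0" using n q by (intro qp_nonzero) auto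
  show "psi q = qp (q ^ 2) (q ^ 2) / qp (- q) (q ^ 2)"
    unfolding 3 5 4[symmetric] using nz by (simp add: field_simps)
qed

lemma psi_nonzero:
  assumes "q \<noteq> 0" "norm q < 1"
  shows "psi q \<noteq> 0"
  using assms qp_nonzero[OF power_less_one_norm[OF assms(2)], of 2] power_less_one_norm[OF assms(2), of 2]
  by (auto simp: psi_eq)

section \<open>Appell sums\<close>

text \<open>The index set is a parameter so that the term \<open>n = 0\<close>, which carries the
  pole at \<open>x = 1\<close>, can be split off.\<close>

definition appell_on :: "complex \<Rightarrow> complex \<Rightarrow> int set \<Rightarrow> complex" where
  "appell_on q x I = (\<Sum>\<^sub>\<infinity>n\<in>I. (q ^ 2) powi (n ^ 2) * (- q) powi n / (1 - x * (q ^ 2) powi n))"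

abbreviation appell :: "complex \<Rightarrow> complex \<Rightarrow> complex" where
  "appell q x \<equiv> appell_on q x UNIV"

text \<open>For large positive \<open>n\<close> the product \<open>x * p powi n\<close> has norm at
  most 1/2, for large negative \<open>n\<close> at least 2. Only finitely many indices remain, and
  for these continuity at \<open>z\<close> suffices.\<close>

lemma powi_denominator_bound:
  fixes p z :: complex
  assumes p: "p \<noteq> 0" "norm p < 1" and z: "z \<noteq> 0" and nz: "\<And>n. n \<in> I \<Longrightarrow> z * p powi n \<noteq> 1"
  obtains r c where "0 < r" "r \<le> norm z / 2" "0 < c"
    "\<And>x n. x \<in> cball z r \<Longrightarrow> n \<in> I \<Longrightarrow> c \<le> norm (1 - x * p powi n)"
proof -
  obtain N where N: "norm p ^ N < 1 / (4 * norm z)"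
    using real_arch_pow_inv[of "1 / (4 * norm z)" "norm p"] z p by auto
  obtain M where M: "norm p ^ M < norm z / 4"
    using real_arch_pow_inv[of "norm z / 4" "norm p"] z p by auto
  define F where "F = I \<inter> {- int M..int N}"
  have F: "finite F" by (simp add: F_def)
  have "\<forall>n\<in>F. \<forall>\<^sub>F x in nhds z. norm (1 - z * p powi n) / 2 < norm (1 - x * p powi n)"
  proof
    fix n assume "n \<in> F"
    then have "0 < norm (1 - z * p powi n)" using nz[of n] by (auto simp: F_def)
    moreover have "((\<lambda>x. norm (1 - x * p powi n)) \<longlongrightarrow> norm (1 - z * p powi n)) (nhds z)"
      by (intro tendsto_intros filterlim_ident)
    ultimately show "\<forall>\<^sub>F x in nhds z. norm (1 - z * p powi n) / 2 < norm (1 - x * p powi n)"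
      by (intro order_tendstoD(1)) auto
  qed
  then have "\<forall>\<^sub>F x in nhds z. \<forall>n\<in>F. norm (1 - z * p powi n) / 2 < norm (1 - x * p powi n)"
    by (intro eventually_ball_finite F)
  then obtain e where e: "e > 0" "\<And>x n. dist x z < e \<Longrightarrow> n \<in> F \<Longrightarrow> norm (1 - z * p powi n) / 2 < norm (1 - x * p powi n)"
    unfolding eventually_nhds_metric by blast
  define r where "r = min (e / 2) (norm z / 2)"
  define c where "c = Min (insert (1 / 2) ((\<lambda>n. norm (1 - z * p powi n) / 2) ` F))"
  have c0: "0 < c"
    unfolding c_def using F nz by (subst Min_gr_iff) (auto simp: F_def)
  have cF: "c \<le> norm (1 - z * p powi n) / 2" if "n \<in> F" for n
    unfolding c_def using F that by (intro Min_le) auto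
  have c2: "c \<le> 1 / 2" unfolding c_def using F by (intro Min_le) auto
  show ?thesis
  proof (rule that[of r c])
    show "0 < r" "r \<le> norm z / 2" using e z by (auto simp: r_def)
    show "0 < c" by (rule c0)
    fix x n assume x: "x \<in> cball z r" and n: "n \<in> I"
    have x2: "x \<in> cball z (norm z / 2)" using x by (auto simp: r_def)
    note cb = cball_bounds[OF z x2]
    show "c \<le> norm (1 - x * p powi n)"
    proof (cases "n \<in> F")
      case True
      have "dist x z < e" using x e(1) by (auto simp: r_def dist_commute)
      then show ?thesis using e(2)[OF _ True, of x] cF[OF True] by linarith
    next
      case False
      then have "n > int N \<or> n < - int M" using n by (auto simp: F_def)
      then show ?thesis
      proof
        assume n: "n > int N"
        have "norm (p powi n) = norm p ^ nat n" using n by (simp add: power_int_def norm_power)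
        also have "\<dots> \<le> norm p ^ N" using n p by (intro power_decreasing) auto
        finally have "norm (p powi n) \<le> 1 / (4 * norm z)" using N by linarith
        then have "norm x * norm (p powi n) \<le> (2 * norm z) * (1 / (4 * norm z))"
          using cb by (intro mult_mono) auto
        also have "\<dots> = 1 / 2" using z by simp
        finally have "norm (x * p powi n) \<le> 1 / 2" by (simp only: norm_mult)
        then show ?thesis using c2 norm_triangle_ineq2[of 1 "x * p powi n"] by simp
      next
        assume n: "n < - int M"
        have pe: "norm (p powi n) = 1 / norm p ^ nat (- n)"
          using n by (simp add: power_int_def norm_power norm_inverse divide_inverse power_inverse)
        have "norm p ^ nat (- n) \<le> norm p ^ M" using n p by (intro power_decreasing) auto
        then have "norm p ^ nat (- n) \<le> norm z / 4" using M by linarith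
        then have "1 / (norm z / 4) \<le> norm (p powi n)"
          unfolding pe using p z by (intro divide_left_mono) auto
        then have "(norm z / 2) * (1 / (norm z / 4)) \<le> norm x * norm (p powi n)"
          using cb z by (intro mult_mono) auto
        moreover have "(norm z / 2) * (1 / (norm z / 4)) = 2" using z by simp
        ultimately have "2 \<le> norm (x * p powi n)" by (simp only: norm_mult)
        then show ?thesis using c2 norm_triangle_ineq2[of "x * p powi n" 1]
          by (simp add: norm_minus_commute)
      qed
    qed
  qed
qed

context
  fixes q :: complex
  assumes q: "q \<noteq> 0" "norm q < 1"
begin

lemma appell_on_analytic_summable:
  assumes z: "z \<noteq> 0" and nz: "\<And>n. n \<in> I \<Longrightarrow> z * (q ^ 2) powi n \<noteq> 1"
  shows appell_on_analytic: "(\<lambda>x. appell_on q x I) analytic_on {z}"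
    and appell_on_summable: "(\<lambda>n. (q ^ 2) powi (n ^ 2) * (- q) powi n / (1 - z * (q ^ 2) powi n)) summable_on I"
proof -
  note q2 = norm_square_less_1[OF q]
  have p: "q ^ 2 \<noteq> 0" using q by simp
  obtain r c where rc: "0 < r" "r \<le> norm z / 2" "0 < c"
    "\<And>x n. x \<in> cball z r \<Longrightarrow> n \<in> I \<Longrightarrow> c \<le> norm (1 - x * (q ^ 2) powi n)"
    using powi_denominator_bound[OF p q2(1) z nz, where I = I] by metis
  define B where "B = max (norm q) (1 / norm q)"
  define M where "M = (\<lambda>n. theta_bound (norm (q ^ 2)) B n / c)"
  have M: "M summable_on I"
  proof -
    have "theta_bound (norm (q ^ 2)) B summable_on UNIV"
      using q2 by (intro summable_theta_bound) (auto simp: B_def le_max_iff_disj)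
    then have "M summable_on UNIV"
      unfolding M_def divide_inverse by (rule summable_on_cmult_left)
    then show ?thesis by (rule summable_on_subset_banach) simp
  qed
  have bd: "norm ((q ^ 2) powi (n ^ 2) * (- q) powi n / (1 - x * (q ^ 2) powi n)) \<le> M n"
    if "n \<in> I" "x \<in> cball z r" for n x
  proof -
    have "norm ((q ^ 2) powi (n ^ 2) * (- q) powi n) \<le> theta_bound (norm (q ^ 2)) B n"
      using q by (intro norm_theta_term_le) (auto simp: B_def)
    then show ?thesis
      unfolding norm_divide M_def using rc(3) rc(4)[OF that(2,1)]
      by (intro frac_le) (auto simp: theta_bound_def B_def le_max_iff_disj)
  qed
  show "(\<lambda>x. appell_on q x I) analytic_on {z}"
    unfolding appell_on_def
  proof (rule analytic_infsum[OF rc(1) _ bd M])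
    fix n assume n: "n \<in> I"
    have "1 - x * (q ^ 2) powi n \<noteq> 0" if "x \<in> cball z r" for x
      using rc(4)[OF that n] rc(3) by auto
    then show "(\<lambda>x. (q ^ 2) powi (n ^ 2) * (- q) powi n / (1 - x * (q ^ 2) powi n)) holomorphic_on cball z r"
      by (intro holomorphic_intros) auto
  qed
  have "(\<lambda>n. norm ((q ^ 2) powi (n ^ 2) * (- q) powi n / (1 - z * (q ^ 2) powi n))) summable_on I"
    by (rule summable_on_comparison_test[OF M]) (use bd rc(1) in auto)
  then show "(\<lambda>n. (q ^ 2) powi (n ^ 2) * (- q) powi n / (1 - z * (q ^ 2) powi n)) summable_on I"
    by (rule abs_summable_summable)
qed

text \<open>With \<open>u = p powi n\<close>, the reindexed term is
  \<open>- q * a n / u ^ 2 / (1 - z * u)\<close>, and \<open>1 / (u ^ 2 * (1 - z * u)) = z ^ 2 / (1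
  - z * u) + z / u + 1 / u ^ 2\<close>. The last two summands sum to theta values, both multiples of
  \<open>psi q\<close>.\<close>

lemma appell_shift:
  assumes z: "z \<noteq> 0" and nz: "\<And>n. z * (q ^ 2) powi n \<noteq> 1"
  shows "appell q (q ^ 2 * z) = - q * z ^ 2 * appell q z + psi q * (1 - q * z)"
proof -
  define p where "p = q ^ 2"
  have p: "p \<noteq> 0" "norm p < 1" using q norm_square_less_1[OF q] by (auto simp: p_def)
  define a where "a = (\<lambda>n::int. p powi (n ^ 2) * (- q) powi n)"
  have j1: "((\<lambda>n. a n * p powi (- n)) has_sum psi q) UNIV"
  proof -
    have "(\<lambda>n. a n * p powi (- n)) = (\<lambda>n. p powi (n ^ 2) * (- 1 / q) powi n)"
    proof
      fix n :: int
      have "(- q) powi n * p powi (- n) = ((- q) / p) powi n"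
        by (simp only: power_int_mult_distrib power_int_minus divide_inverse power_int_inverse)
      also have "- q / p = - 1 / q" using q by (simp add: p_def power2_eq_square)
      finally show "a n * p powi (- n) = p powi (n ^ 2) * (- 1 / q) powi n"
        by (simp add: a_def mult.assoc)
    qed
    moreover have "jac p (- 1 / q) = psi q" using jac_inverse[of p "- q"] by (simp add: psi_def p_def)
    ultimately show ?thesis
      using summable_theta(2)[OF p(2), of "- 1 / q"] q has_sum_infsum by (fastforce simp: jac_def)
  qed
  \<comment> \<open>The argument \<open>- 1 / q ^ 3\<close> is one theta shift away from
    \<open>- q\<close>, whence the extra factor \<open>- 1 / q\<close>.\<close>
  have j2: "((\<lambda>n. a n * p powi (- 2 * n)) has_sum (- psi q / q)) UNIV"
  proof -
    have "(\<lambda>n. a n * p powi (- 2 * n)) = (\<lambda>n. p powi (n ^ 2) * (- 1 / q ^ 3) powi n)"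
    proof
      fix n :: int
      have "(- q) powi n * p powi (- 2 * n) = ((- q) / p ^ 2) powi n"
      proof -
        have "p powi (- 2 * n) = inverse ((p ^ 2) powi n)"
          using power_int_mult[of p 2 n] by (simp add: power_int_minus)
        then show ?thesis by (simp only: power_int_mult_distrib divide_inverse power_int_inverse)
      qed
      also have "- q / p ^ 2 = - 1 / q ^ 3" using q by (simp add: p_def field_simps flip: power_mult power_Suc power_Suc2)
      finally show "a n * p powi (- 2 * n) = p powi (n ^ 2) * (- 1 / q ^ 3) powi n"
        by (simp add: a_def mult.assoc)
    qed
    moreover have "jac p (- 1 / q ^ 3) = - psi q / q"
    proof -
      have "p ^ 2 * (- 1 / q ^ 3) = - q"
        using q by (simp add: p_def field_simps flip: power_mult power_Suc power_Suc2)
      moreover have "p * (- 1 / q ^ 3) = - 1 / q" using q by (simp add: p_def power2_eq_square power3_eq_cube)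
      ultimately have "jac p (- q) = jac p (- 1 / q ^ 3) / (- 1 / q)"
        using jac_shift[OF p(1), of "- 1 / q ^ 3"] q by simp
      then show ?thesis using q by (simp add: psi_def p_def)
    qed
    ultimately show ?thesis
      using summable_theta(2)[OF p(2), of "- 1 / q ^ 3"] q has_sum_infsum by (fastforce simp: jac_def)
  qed
  have j0: "((\<lambda>n. a n / (1 - z * p powi n)) has_sum appell q z) UNIV"
    using appell_on_summable[OF z nz, of UNIV] by (simp add: appell_on_def a_def p_def)
  have "((\<lambda>n. - q * z ^ 2 * (a n / (1 - z * p powi n)) + ((- q * z) * (a n * p powi (- n)) + (- q) * (a n * p powi (- 2 * n))))
     has_sum (- q * z ^ 2 * appell q z + ((- q * z) * psi q + (- q) * (- psi q / q)))) UNIV"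
    by (intro has_sum_add has_sum_cmult_right j0 j1 j2)
  also have "(\<lambda>n. - q * z ^ 2 * (a n / (1 - z * p powi n)) + ((- q * z) * (a n * p powi (- n)) + (- q) * (a n * p powi (- 2 * n))))
     = (\<lambda>n. a (n - 1) / (1 - (p * z) * p powi (n - 1)))"
  proof
    fix n :: int
    define u where "u = p powi n"
    have u: "u \<noteq> 0" "p powi (- n) = 1 / u" "p powi (- 2 * n) = 1 / u ^ 2"
      using p power_int_mult[of p "-n" 2] by (auto simp: u_def power_int_minus divide_inverse power_inverse mult.commute)
    have zu: "1 - z * u \<noteq> 0" using nz[of n] by (auto simp: u_def p_def)
    have "(n - 1) ^ 2 = n ^ 2 + (- 2 * n) + 1" by (simp add: power2_eq_square algebra_simps)
    moreover have "p powi (n ^ 2 + (- 2 * n) + 1) = p powi (n ^ 2) * p powi (- 2 * n) * p powi 1"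
      using p(1) by (simp only: power_int_add simp_thms disj_ac)
    ultimately have "p powi ((n - 1) ^ 2) = p powi (n ^ 2) * p powi (- 2 * n) * p"
      by (simp only: power_int_1_right)
    moreover have "(- q) powi (n - 1) = (- q) powi n / (- q)" using q by (simp add: power_int_diff)
    ultimately have "a (n - 1) = a n * (1 / u ^ 2) * (p / (- q))"
      by (simp add: a_def u(3)[simplified])
    also have "p / (- q) = - q" using q by (simp add: p_def power2_eq_square)
    finally have an: "a (n - 1) = - q * a n / u ^ 2" by simp
    have "(p * z) * p powi (n - 1) = z * u" using p by (simp add: power_int_diff u_def)
    moreover have "- q * z ^ 2 * (a n / (1 - z * u)) + ((- q * z) * (a n * (1 / u)) + (- q) * (a n * (1 / u ^ 2)))
      = (- q * a n / u ^ 2) / (1 - z * u)"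
      using u(1) zu by (simp add: divide_simps) (simp add: algebra_simps power2_eq_square)
    ultimately show "- q * z ^ 2 * (a n / (1 - z * p powi n)) + ((- q * z) * (a n * p powi (- n)) + (- q) * (a n * p powi (- 2 * n)))
      = a (n - 1) / (1 - (p * z) * p powi (n - 1))"
      using an by (simp only: u(2,3) u_def[symmetric])
  qed
  finally have "((\<lambda>n. a n / (1 - (p * z) * p powi n)) has_sum (- q * z ^ 2 * appell q z + ((- q * z) * psi q + (- q) * (- psi q / q)))) UNIV"
    by (rule iffD1[OF has_sum_reindex_bij_betw[where g = "\<lambda>n. n - 1" and f = "\<lambda>n. a n / (1 - (p * z) * p powi n)"], rotated])
       (rule bij_betwI[of _ _ _ "\<lambda>n. n + 1"]; simp)
  then have "appell q (q ^ 2 * z) = - q * z ^ 2 * appell q z + ((- q * z) * psi q + (- q) * (- psi q / q))"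
    by (simp add: infsumI appell_on_def a_def p_def)
  then show ?thesis using q by (simp add: algebra_simps)
qed

lemma appell_on_inverse:
  assumes z: "z \<noteq> 0" and I: "uminus ` I = I"
  shows "appell_on q (1 / z) I = - z * appell_on q z I"
proof -
  have "appell_on q (1 / z) I = (\<Sum>\<^sub>\<infinity>n\<in>I. - z * ((q ^ 2) powi (n ^ 2) * (- q) powi n / (1 - z * (q ^ 2) powi n)))"
    unfolding appell_on_def
  proof (rule infsum_reindex_bij_witness[of _ uminus uminus])
    fix n :: int
    define u where "u = (q ^ 2) powi n"
    have u: "u \<noteq> 0" "(q ^ 2) powi (- n) = 1 / u" using q by (auto simp: u_def power_int_minus divide_inverse)
    have v: "(- q) powi (- n) = (- q) powi n / u"
    proof -
      have "(- q) powi (- n) * u = ((1 / (- q)) * q ^ 2) powi n"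
        by (simp only: u_def power_int_mult_distrib power_int_minus divide_inverse power_int_inverse mult_1_left)
      also have "(1 / (- q)) * q ^ 2 = - q" using q by (simp add: power2_eq_square)
      finally show ?thesis using u by (simp add: field_simps)
    qed
    have e: "K * (- z * (1 / u) / (1 - z * (1 / u))) = K / (1 - 1 / z * u)" for K
    \<comment> \<open>For \<open>z = u\<close> both denominators vanish and both sides are 0 by the
      convention for division by zero.\<close>
    proof (cases "z = u")
      case True then show ?thesis using z by simp
    next
      case False then show ?thesis using z u by (simp add: divide_simps) (simp add: algebra_simps)
    qed
    have "- z * (P * (Y / u) / (1 - z * (1 / u))) = (P * Y) * (- z * (1 / u) / (1 - z * (1 / u)))" for P Y
      by (simp add: divide_inverse mult_ac)
    then have "- z * (P * (Y / u) / (1 - z * (1 / u))) = P * Y / (1 - 1 / z * u)" for P Y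
      by (simp only: e)
    then show "- z * ((q ^ 2) powi ((- n) ^ 2) * (- q) powi (- n) / (1 - z * (q ^ 2) powi (- n))) =
         (q ^ 2) powi (n ^ 2) * (- q) powi n / (1 - 1 / z * (q ^ 2) powi n)"
      unfolding v u(2) u_def[symmetric] by simp
  qed (use I in auto)
  then show ?thesis by (simp only: appell_on_def infsum_cmult_right')
qed

lemma appell_split:
  assumes z: "z \<noteq> 0" and nz: "\<And>n. n \<noteq> 0 \<Longrightarrow> z * (q ^ 2) powi n \<noteq> 1"
  shows "appell q z = 1 / (1 - z) + appell_on q z (- {0})"
proof -
  have "appell q z = (\<Sum>\<^sub>\<infinity>n\<in>insert 0 (- {0}). (q ^ 2) powi (n ^ 2) * (- q) powi n / (1 - z * (q ^ 2) powi n))"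
    unfolding appell_on_def by (rule infsum_cong_neutral) auto
  also have "\<dots> = 1 / (1 - z) + appell_on q z (- {0})"
    unfolding appell_on_def using appell_on_summable[OF z, of "- {0}"] nz by (subst infsum_insert) auto
  finally show ?thesis .
qed

lemma q2_powi_ne_1: "n \<noteq> 0 \<Longrightarrow> (q ^ 2) powi n \<noteq> 1"
proof
  assume n: "n \<noteq> 0" and e: "(q ^ 2) powi n = 1"
  have "norm (q ^ 2) ^ nat \<bar>n\<bar> = 1"
  proof (cases "n \<ge> 0")
    case True then show ?thesis using e by (metis abs_of_nonneg norm_one norm_power power_int_def)
  next
    case False
    then have "inverse ((q ^ 2) ^ nat (- n)) = 1" using e by (simp add: power_int_def power_inverse)
    then have "(q ^ 2) ^ nat (- n) = 1" by (metis inverse_inverse_eq inverse_1)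
    then show ?thesis using False by (metis abs_of_neg norm_one norm_power not_le)
  qed
  moreover have "norm (q ^ 2) ^ nat \<bar>n\<bar> < 1"
    using n norm_square_less_1[OF q] by (intro power_less_one_iff[THEN iffD2]) auto
  ultimately show False by simp
qed

text \<open>At the fixed point 1 of inversion, \<open>appell_on_inverse\<close> says that the value
  equals its own negative.\<close>

lemma appell_on_1: "appell_on q 1 (- {0}) = 0"
proof -
  have "uminus ` (- {0}) = - {0 :: int}"
  proof (intro equalityI subsetI)
    fix x :: int assume "x \<in> - {0}"
    then show "x \<in> uminus ` (- {0})" by (intro image_eqI[of _ _ "- x"]) auto
  qed auto
  from appell_on_inverse[OF _ this, of 1] show ?thesis by simp
qed

lemma appell_on_punctured_analytic: "(\<lambda>x. appell_on q x (- {0})) analytic_on {1}"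
  by (rule appell_on_analytic) (use q2_powi_ne_1 in auto)

end

section \<open>The rank generating function as an Appell sum\<close>

definition qp_fin :: "complex \<Rightarrow> complex \<Rightarrow> nat \<Rightarrow> complex" where
  "qp_fin a p n = (\<Prod>k<n. 1 - a * p ^ k)"

lemma qp_fin_0 [simp]: "qp_fin a p 0 = 1"
  by (simp add: qp_fin_def)

lemma qp_fin_Suc: "qp_fin a p (Suc n) = qp_fin a p n * (1 - a * p ^ n)"
  by (simp add: qp_fin_def)

lemma qp_fin_Suc_shift: "qp_fin a p (Suc n) = (1 - a) * qp_fin (a * p) p n"
  unfolding qp_fin_def by (subst prod.lessThan_Suc_shift) (simp add: mult_ac)

lemma qp_split_fin: "norm p < 1 \<Longrightarrow> qp a p = qp_fin a p n * qp (a * p ^ n) p"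
  unfolding qp_fin_def by (rule qp_split_initial)

text \<open>The quotient $(-t/x;t^2)_k/(t^2/x;t^2)_{k+1}$. Up to elementary factors it counts the
  partitions with largest part \<open>2 * k + 1\<close> or \<open>2 * k + 2\<close>, as
  \<open>rank_gf\<close> shows.\<close>

definition rank_term :: "complex \<Rightarrow> complex \<Rightarrow> nat \<Rightarrow> complex" where
  "rank_term t x k = qp_fin (- t / x) (t ^ 2) k / qp_fin (t ^ 2 / x) (t ^ 2) (Suc k)"

definition rank_series :: "complex \<Rightarrow> complex \<Rightarrow> complex" where
  "rank_series t x = 1 + (1 + t) * t * (\<Sum>k. (t ^ 2 * x) ^ k * rank_term t x k)"

context
  fixes t p :: complex
  assumes t: "t \<noteq> 0" "norm t < 1" and p_def: "p = t ^ 2"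
begin

private lemma base: "norm p < 1" "0 < norm p" "p \<noteq> 0" "t ^ 2 = p"
  using norm_square_less_1[OF t] t by (auto simp: p_def)

text \<open>One infinite product serves as common denominator for all \<open>k\<close>. The
  remaining factors are bounded uniformly in \<open>k\<close>, so poles in \<open>x\<close> can come
  only from \<open>qp (p / x) p\<close>.\<close>

lemma rank_term_eq:
  assumes "qp (p / x) p \<noteq> 0"
  shows "rank_term t x k = qp_fin (- t / x) p k * qp (p ^ (k + 2) / x) p / qp (p / x) p"
proof -
  have "qp (p / x) p = qp_fin (p / x) p (Suc k) * qp (p ^ (k + 2) / x) p"
    using qp_split_fin[OF base(1), of "p / x" "Suc k"] by (simp add: mult_ac)
  then show ?thesis using assms by (simp add: rank_term_def base(4))
qed

lemma rank_term_bounds: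
  assumes "x \<noteq> 0"
  shows "norm (qp_fin (- t / x) p k * qp (p ^ (k + 2) / x) p) \<le> exp (2 / (norm x * (1 - norm p)))"
proof -
  have "norm (qp_fin (- t / x) p k) \<le> exp (norm (- t / x) / (1 - norm p))"
    unfolding qp_fin_def by (rule norm_qp_le(1)[OF base(1)])
  also have "\<dots> \<le> exp (1 / (norm x * (1 - norm p)))"
  proof -
    have "norm t / (norm x * (1 - norm p)) \<le> 1 / (norm x * (1 - norm p))"
      using t base by (intro divide_right_mono) auto
    then show ?thesis by (simp add: norm_divide)
  qed
  finally have 1: "norm (qp_fin (- t / x) p k) \<le> exp (1 / (norm x * (1 - norm p)))" .
  have "norm (qp (p ^ (k + 2) / x) p) \<le> exp (norm (p ^ (k + 2) / x) / (1 - norm p))"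
    by (rule norm_qp_le(2)[OF base(1)])
  also have "\<dots> \<le> exp (1 / (norm x * (1 - norm p)))"
  proof -
    have "norm p ^ (k + 2) / (norm x * (1 - norm p)) \<le> 1 / (norm x * (1 - norm p))"
      using power_le_one[of "norm p" "k + 2"] base by (intro divide_right_mono) auto
    then show ?thesis by (simp add: norm_divide norm_power norm_mult)
  qed
  finally have 2: "norm (qp (p ^ (k + 2) / x) p) \<le> exp (1 / (norm x * (1 - norm p)))" .
  have "norm (qp_fin (- t / x) p k * qp (p ^ (k + 2) / x) p) \<le> exp (1 / (norm x * (1 - norm p))) * exp (1 / (norm x * (1 - norm p)))"
    unfolding norm_mult by (intro mult_mono 1 2) auto
  also have "\<dots> = exp (2 / (norm x * (1 - norm p)))"
    by (simp add: exp_add[symmetric] add_divide_distrib[symmetric])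
  finally show ?thesis .
qed

lemma rank_term_summable:
  assumes x: "qp (p / x) p \<noteq> 0" "x \<noteq> 0" and z: "norm z < 1"
  shows "summable (\<lambda>k. z ^ k * rank_term t x k)"
proof (rule summable_comparison_test')
  define K where "K = exp (2 / (norm x * (1 - norm p))) / norm (qp (p / x) p)"
  show "summable (\<lambda>k. K * norm z ^ k)" using z by (intro summable_mult summable_geometric) auto
  fix k :: nat
  have "norm (rank_term t x k) \<le> K"
    unfolding rank_term_eq[OF x(1)] norm_divide K_def using rank_term_bounds[OF x(2)] by (intro divide_right_mono) auto
  then show "norm (z ^ k * rank_term t x k) \<le> K * norm z ^ k"
    using mult_left_mono[of "norm (rank_term t x k)" K "norm z ^ k"] by (simp add: norm_mult norm_power mult.commute)
qed

lemma qp_fin_nonzero: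
  assumes "qp (p / x) p \<noteq> 0"
  shows "qp_fin (p / x) p k \<noteq> 0"
  using qp_split_fin[OF base(1), of "p / x" k] assms by auto

text \<open>The sum of \<open>g\<close> is computed twice. In \<open>g k\<close> the last
  denominator factor of \<open>rank_term\<close> is cancelled; in \<open>g (Suc k)\<close> the last
  numerator factor is expanded. Both give combinations of the series at \<open>z\<close> and at
  \<open>p * z\<close>.\<close>

lemma rank_term_rec:
  assumes x: "qp (p / x) p \<noteq> 0" "x \<noteq> 0" and z: "norm z < 1"
  shows "(1 - z) * (\<Sum>k. z ^ k * rank_term t x k) = 1 + (p + t * z) / x * (\<Sum>k. (p * z) ^ k * rank_term t x k)"
proof -
  have pz: "norm (p * z) < 1" using z base by (intro norm_mult_less_of_le_1) auto
  note s = rank_term_summable[OF x z] rank_term_summable[OF x pz]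
  define S where "S = (\<Sum>k. z ^ k * rank_term t x k)"
  define S' where "S' = (\<Sum>k. (p * z) ^ k * rank_term t x k)"
  define g where "g = (\<lambda>k. z ^ k * rank_term t x k - p / x * ((p * z) ^ k * rank_term t x k))"
  have g: "g sums (S - p / x * S')"
    unfolding g_def S_def S'_def using s by (intro sums_diff sums_mult summable_sums)
  have gk: "g k = z ^ k * qp_fin (- t / x) p k / qp_fin (p / x) p k" for k
  proof -
    have nz: "1 - p / x * p ^ k \<noteq> 0" "qp_fin (p / x) p k \<noteq> 0"
      using qp_fin_nonzero[OF x(1), of "Suc k"] by (auto simp: qp_fin_Suc)
    have "g k = z ^ k * rank_term t x k * (1 - p / x * p ^ k)"
      by (simp add: g_def power_mult_distrib algebra_simps)
    moreover have "z ^ k * (A / (B * c)) * c = z ^ k * A / B" if "c \<noteq> 0" for A B c :: complex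
      using that by simp
    ultimately show ?thesis using nz(1) by (simp only: rank_term_def base(4) qp_fin_Suc not_False_eq_True)
  qed
  have gS: "g (Suc k) = z * (z ^ k * rank_term t x k) + t * z / x * ((p * z) ^ k * rank_term t x k)" for k
    unfolding gk rank_term_def base(4) qp_fin_Suc[of "- t / x"] by (simp add: power_mult_distrib algebra_simps add_divide_distrib)
  have "(\<lambda>k. g (Suc k)) sums (z * S + t * z / x * S')"
    unfolding gS S_def S'_def using s by (intro sums_add sums_mult summable_sums)
  then have "g sums (z * S + t * z / x * S' + g 0)" by (rule sums_Suc)
  moreover have "g 0 = 1" unfolding gk by simp
  ultimately have "S - p / x * S' = z * S + t * z / x * S' + 1"
    using sums_unique2[OF g] by simp
  then have "(1 - z) * S = 1 + (p + t * z) / x * S'"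
    by (simp add: algebra_simps add_divide_distrib)
  then show ?thesis by (simp only: S_def S'_def)
qed

text \<open>Replacing \<open>x\<close> by \<open>p * x\<close> shifts the index of
  \<open>rank_term\<close> by one, up to the constant \<open>c\<close>. The series is then one in
  \<open>rank_term t x\<close> with argument \<open>p * (p * x)\<close>, and
  \<open>rank_term_rec\<close> at \<open>z = p * x\<close> leads back to the argument
  \<open>p * x\<close>.\<close>

lemma rank_series_shift:
  assumes x: "qp (p / x) p \<noteq> 0" "x \<noteq> 0" "x \<noteq> 1" and xp: "norm (p * x) < 1"
  shows "rank_series t (p * x) / (1 - p * x) = - t * x ^ 2 * (rank_series t x / (1 - x)) + (1 - t * x)"
proof -
  define G where "G = (\<Sum>k. (p * x) ^ k * rank_term t x k)"
  define G2 where "G2 = (\<Sum>k. (p * (p * x)) ^ k * rank_term t x k)"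
  define c where "c = (1 + t / (p * x)) / (1 - 1 / x)"
  have pp: "norm (p * (p * x)) < 1" using base by (intro norm_mult_less_of_le_1[OF _ xp]) auto
  have px: "p * x \<noteq> 0" using base x by auto
  have x1: "1 - 1 / x \<noteq> 0" using x by (simp add: field_simps)
  have GS: "rank_term t (p * x) (Suc k) = c * rank_term t x k" for k
  proof -
    have "qp_fin (- t / (p * x)) p (Suc k) = (1 + t / (p * x)) * qp_fin (- t / x) p k"
      using qp_fin_Suc_shift[of "- t / (p * x)" p k] base by simp
    moreover have "qp_fin (p / (p * x)) p (Suc (Suc k)) = (1 - 1 / x) * qp_fin (p / x) p (Suc k)"
      using qp_fin_Suc_shift[of "p / (p * x)" p "Suc k"] base by simp
    ultimately show ?thesis by (simp add: rank_term_def base(4) c_def)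
  qed
  have G0: "rank_term t (p * x) 0 = 1 / (1 - 1 / x)"
    using base by (simp add: rank_term_def base(4) qp_fin_Suc)
  have "(\<lambda>k. c * (p * (p * x)) * ((p * (p * x)) ^ k * rank_term t x k)) sums (c * (p * (p * x)) * G2)"
    unfolding G2_def by (intro sums_mult summable_sums rank_term_summable x pp)
  then have "(\<lambda>k. (p * (p * x)) ^ Suc k * (c * rank_term t x k)) sums (c * (p * (p * x)) * G2)"
    by (simp add: mult_ac)
  then have "(\<lambda>k. (p * (p * x)) ^ Suc k * rank_term t (p * x) (Suc k)) sums (c * (p * (p * x)) * G2)"
    by (simp only: GS)
  then have "(\<lambda>k. (p * (p * x)) ^ k * rank_term t (p * x) k) sums (c * (p * (p * x)) * G2 + (p * (p * x)) ^ 0 * rank_term t (p * x) 0)"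
    by (rule sums_Suc)
  then have "(\<Sum>k. (p * (p * x)) ^ k * rank_term t (p * x) k) = c * (p * (p * x)) * G2 + 1 / (1 - 1 / x)"
    using sums_unique G0 by fastforce
  then have F1: "rank_series t (p * x) = 1 + (1 + t) * t * (c * (p * (p * x)) * G2 + 1 / (1 - 1 / x))"
    by (simp add: rank_series_def base(4))
  have F2: "rank_series t x = 1 + (1 + t) * t * G" by (simp add: rank_series_def base(4) G_def)
  have "(1 - p * x) * G = 1 + (p + t * (p * x)) / x * G2"
    unfolding G_def G2_def by (rule rank_term_rec[OF x(1,2) xp])
  then have R: "p * (1 + t * x) * G2 = x * ((1 - p * x) * G - 1)"
    using x by (simp add: field_simps)
  have "c * (p * (p * x)) * G2 = x / (x - 1) * (t * (p * (1 + t * x) * G2))"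
  proof -
    have "c = x / (x - 1) * (1 + t / (p * x))" using x by (simp add: c_def divide_simps)
    moreover have "(1 + t / (p * x)) * (p * (p * x)) = t * (p * (1 + t * x))"
      using px base(3) by (simp add: field_simps p_def power2_eq_square)
    ultimately show ?thesis by (metis (no_types, opaque_lifting) mult.assoc)
  qed
  also have "\<dots> = x / (x - 1) * (t * (x * ((1 - p * x) * G - 1)))" by (simp only: R)
  finally have F1': "rank_series t (p * x) = 1 + (1 + t) * t * (x / (x - 1) * (t * (x * ((1 - p * x) * G - 1))) + x / (x - 1))"
    unfolding F1 using x by (simp add: divide_simps)
  have px1: "1 - p * x \<noteq> 0" using xp by auto
  have x1': "x - 1 \<noteq> 0" "1 - x \<noteq> 0" using x by auto
  have "rank_series t (p * x) * (x - 1) = (x - 1) + (1 + t) * t * (x * (t * (x * ((1 - p * x) * G - 1))) + x)"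
  proof -
    have "(1 + C * (x / y * A + x / y)) * y = y + C * (x * A + x)" if "y \<noteq> 0" for A C y :: complex
      using that by (simp add: field_simps)
    then show ?thesis unfolding F1' using x1'(1) by blast
  qed
  also have "\<dots> = (1 - p * x) * (t * x ^ 2 * (1 + (1 + t) * t * G) + (1 - t * x) * (x - 1))"
    by (simp add: p_def algebra_simps power2_eq_square)
  finally have "rank_series t (p * x) = (1 - p * x) * (t * x ^ 2 * rank_series t x + (1 - t * x) * (x - 1)) / (x - 1)"
    unfolding F2 using x1' by (simp add: field_simps)
  then have "rank_series t (p * x) / (1 - p * x) = (t * x ^ 2 * rank_series t x + (1 - t * x) * (x - 1)) / (x - 1)"
    using px1 by simp
  also have "\<dots> = t * x ^ 2 * rank_series t x / (x - 1) + (1 - t * x)" using x1' by (simp add: add_divide_distrib)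
  also have "t * x ^ 2 * rank_series t x / (x - 1) = - t * x ^ 2 * (rank_series t x / (1 - x))"
    using x1' by (simp add: field_simps)
  finally show ?thesis .
qed

lemma rank_series_analytic:
  assumes x: "qp (p / x0) p \<noteq> 0" "x0 \<noteq> 0" and xp: "norm (p * x0) < 1"
  shows "rank_series t analytic_on {x0}"
proof -
  \<comment> \<open>\<open>N\<close> is the series with the common denominator multiplied out. The
    radius \<open>r\<close> keeps the disc away from 0 and \<open>norm (p * x)\<close> below some
    \<open>\<rho> < 1\<close>, which yields a geometric majorant.\<close>
  define N where "N = (\<lambda>x. \<Sum>\<^sub>\<infinity>k\<in>(UNIV::nat set). (p * x) ^ k * (qp_fin (- t / x) p k * qp (p ^ (k + 2) / x) p))"
  define r where "r = min (norm x0 / 2) ((1 / norm p - norm x0) / 2)"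
  define \<rho> where "\<rho> = norm p * (norm x0 + r)"
  define E where "E = exp (4 / (norm x0 * (1 - norm p)))"
  have xb: "norm x0 < 1 / norm p" using xp base by (simp add: norm_mult field_simps)
  have r: "r > 0" "r \<le> norm x0 / 2" using xb x by (auto simp: r_def)
  have "norm x0 + r < 1 / norm p" using xb by (simp add: r_def min_def field_simps)
  then have \<rho>: "0 \<le> \<rho>" "\<rho> < 1" using r base by (auto simp: \<rho>_def field_simps)
  have in_ball: "x \<noteq> 0" "norm x0 / 2 \<le> norm x" "norm (p * x) \<le> \<rho>" if "x \<in> cball x0 r" for x
  proof -
    have x2: "x \<in> cball x0 (norm x0 / 2)" using that r by auto
    show "x \<noteq> 0" "norm x0 / 2 \<le> norm x" using cball_bounds[OF x(2) x2] by auto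
    have "norm x \<le> norm x0 + r"
      using that norm_triangle_ineq2[of x x0] by (simp add: dist_norm norm_minus_commute)
    then show "norm (p * x) \<le> \<rho>" using base by (simp add: \<rho>_def norm_mult)
  qed
  have bd: "norm ((p * x) ^ k * (qp_fin (- t / x) p k * qp (p ^ (k + 2) / x) p)) \<le> \<rho> ^ k * E" if "x \<in> cball x0 r" for x k
  proof -
    note b = in_ball[OF that]
    have "norm (qp_fin (- t / x) p k * qp (p ^ (k + 2) / x) p) \<le> exp (2 / (norm x * (1 - norm p)))"
      by (rule rank_term_bounds[OF b(1)])
    also have "2 / (norm x * (1 - norm p)) \<le> 2 / (norm x0 / 2 * (1 - norm p))"
      using b base x by (intro divide_left_mono mult_right_mono mult_pos_pos) auto
    also have "\<dots> = 4 / (norm x0 * (1 - norm p))" by simp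
    finally have "norm (qp_fin (- t / x) p k * qp (p ^ (k + 2) / x) p) \<le> E" by (simp add: E_def)
    moreover have "norm ((p * x) ^ k) \<le> \<rho> ^ k" using b by (simp add: norm_power power_mono)
    ultimately show ?thesis unfolding norm_mult[of "(p * x) ^ k"] using \<rho> by (intro mult_mono) auto
  qed
  have M: "(\<lambda>k. \<rho> ^ k * E) summable_on UNIV"
    using \<rho> by (auto simp: summable_on_UNIV_nonneg_real_iff E_def intro!: summable_mult2 summable_geometric)
  have "N analytic_on {x0}"
    unfolding N_def
  proof (rule analytic_infsum[OF r(1) _ bd M])
    fix k :: nat
    have "(\<lambda>x. (p * x) ^ k * (qp_fin (- t / x) p k * qp (p ^ (k + 2) / x) p)) analytic_on cball x0 r"
      unfolding qp_fin_def using in_ball(1) base(1) by (intro analytic_intros) auto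
    then show "(\<lambda>x. (p * x) ^ k * (qp_fin (- t / x) p k * qp (p ^ (k + 2) / x) p)) holomorphic_on cball x0 r"
      by (rule analytic_imp_holomorphic)
  qed
  then have an: "(\<lambda>x. 1 + (1 + t) * t * (N x / qp (p / x) p)) analytic_on {x0}"
    using x base by (intro analytic_intros) auto
  have "\<forall>\<^sub>F x in nhds x0. qp (p / x) p \<noteq> 0 \<and> x \<in> cball x0 r"
  proof (rule eventually_conj)
    have "((\<lambda>x. qp (p / x) p) \<longlongrightarrow> qp (p / x0) p) (nhds x0)"
      using x base by (intro tendsto_intros filterlim_ident) auto
    then show "\<forall>\<^sub>F x in nhds x0. qp (p / x) p \<noteq> 0" using x(1) by (rule tendsto_imp_eventually_ne)
    have "\<forall>\<^sub>F x in nhds x0. x \<in> ball x0 r" using r by (intro eventually_nhds_in_open) auto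
    then show "\<forall>\<^sub>F x in nhds x0. x \<in> cball x0 r" by eventually_elim auto
  qed
  then have ev: "\<forall>\<^sub>F x in nhds x0. 1 + (1 + t) * t * (N x / qp (p / x) p) = rank_series t x"
  proof eventually_elim
    case (elim x)
    have "(\<lambda>k. norm ((p * x) ^ k * (qp_fin (- t / x) p k * qp (p ^ (k + 2) / x) p))) summable_on UNIV"
      by (rule summable_on_comparison_test[OF M]) (use bd elim in auto)
    then have "(\<lambda>k. (p * x) ^ k * (qp_fin (- t / x) p k * qp (p ^ (k + 2) / x) p)) summable_on UNIV"
      by (rule abs_summable_summable)
    then have "(\<lambda>k. (p * x) ^ k * (qp_fin (- t / x) p k * qp (p ^ (k + 2) / x) p)) sums N x"
      unfolding N_def by (intro has_sum_imp_sums has_sum_infsum)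
    then have "(\<lambda>k. (p * x) ^ k * (qp_fin (- t / x) p k * qp (p ^ (k + 2) / x) p) / qp (p / x) p) sums (N x / qp (p / x) p)"
      by (rule sums_divide)
    then have "(\<lambda>k. (p * x) ^ k * rank_term t x k) sums (N x / qp (p / x) p)"
      using elim by (simp add: rank_term_eq)
    then show ?case by (simp add: rank_series_def base(4) sums_unique[symmetric])
  qed
  show ?thesis by (rule iffD1[OF analytic_at_cong[OF ev refl] an])
qed

text \<open>At \<open>x = 1\<close> the series telescopes: its terms are the differences of
  \<open>P\<close>, since \<open>(1 + t * p ^ k) - (1 - p * p ^ k) = (1 + t) * t * p ^ k\<close>.
  The limit of \<open>P\<close> is \<open>1 / psi t\<close>; this value fixes the residue used
  below.\<close>

lemma rank_series_1: "rank_series t 1 = 1 / psi t"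
proof -
  define P where "P = (\<lambda>k. qp_fin (- t) p k / qp_fin p p k)"
  have nz: "qp p p \<noteq> 0" using base by (intro qp_nonzero) auto
  have pz: "qp_fin p p k \<noteq> 0" for k using qp_fin_nonzero[of 1 k] nz by simp
  have "P \<longlonglongrightarrow> qp (- t) p / qp p p"
    unfolding P_def qp_fin_def using nz by (intro tendsto_intros qp_LIMSEQ base)
  then have "(\<lambda>k. P (Suc k) - P k) sums (qp (- t) p / qp p p - P 0)"
    by (rule telescope_sums)
  also have "P 0 = 1" by (simp add: P_def)
  also have "(\<lambda>k. P (Suc k) - P k) = (\<lambda>k. (1 + t) * t * ((p * 1) ^ k * rank_term t 1 k))"
  proof
    fix k
    have "1 - p * p ^ k \<noteq> 0" using pz[of "Suc k"] by (simp add: qp_fin_Suc)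
    moreover have "(1 + t * p ^ k) - (1 - p * p ^ k) = (1 + t) * t * p ^ k"
      by (simp add: p_def algebra_simps power2_eq_square)
    ultimately show "P (Suc k) - P k = (1 + t) * t * ((p * 1) ^ k * rank_term t 1 k)"
    proof -
      assume u: "1 - p * p ^ k \<noteq> 0" and v: "(1 + t * p ^ k) - (1 - p * p ^ k) = (1 + t) * t * p ^ k"
      have aux: "A * v / (Q * u) - A / Q = A * (v - u) / (Q * u)" if "u \<noteq> 0" "Q \<noteq> 0" for A Q u v :: complex
        using that by (simp add: field_simps)
      have "P (Suc k) - P k = qp_fin (- t) p k * ((1 + t) * t * p ^ k) / (qp_fin p p k * (1 - p * p ^ k))"
        unfolding P_def qp_fin_Suc using aux[OF u pz[of k], of "qp_fin (- t) p k" "1 + t * p ^ k"]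
        by (simp only: v mult_minus_left diff_minus_eq_add)
      then show ?thesis by (simp add: rank_term_def base(4) qp_fin_Suc)
    qed
  qed
  finally have s: "(\<lambda>k. (1 + t) * t * ((p * 1) ^ k * rank_term t 1 k)) sums (qp (- t) p / qp p p - 1)" .
  have "summable (\<lambda>k. (p * 1) ^ k * rank_term t 1 k)"
    by (rule rank_term_summable) (use nz base in auto)
  then have "(\<lambda>k. (1 + t) * t * ((p * 1) ^ k * rank_term t 1 k)) sums ((1 + t) * t * (\<Sum>k. (p * 1) ^ k * rank_term t 1 k))"
    by (intro sums_mult summable_sums)
  from sums_unique2[OF this s] have "rank_series t 1 = qp (- t) p / qp p p"
    by (simp only: rank_series_def base(4)) simp
  then show ?thesis using psi_eq(1)[OF t] by (simp add: base(4))
qed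

section \<open>Poles along the orbit of 1, and equality with the Appell sum\<close>

definition "poles = {x. \<exists>n::int. x * p powi n = 1}"

private lemma poles_discrete:
  assumes "z \<noteq> 0"
  shows "\<forall>\<^sub>F x in at z. x \<notin> poles"
proof -
  obtain r c where rc: "0 < r" "r \<le> norm z / 2" "0 < c"
    "\<And>x n. x \<in> cball z r \<Longrightarrow> n \<in> {n. z * p powi n \<noteq> 1} \<Longrightarrow> c \<le> norm (1 - x * p powi n)"
    using powi_denominator_bound[OF base(3,1) assms, of "{n. z * p powi n \<noteq> 1}"] by auto
  have "\<forall>\<^sub>F x in at z. x \<in> ball z r \<and> x \<noteq> z"
    using rc(1) by (auto simp: eventually_at dist_commute intro!: exI[of _ r])
  then show ?thesis
  proof eventually_elim
    case (elim x)
    show ?case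
    proof
      assume "x \<in> poles"
      then obtain n where n: "x * p powi n = 1" by (auto simp: poles_def)
      show False
      proof (cases "z * p powi n = 1")
        case True
        then have "z = x" using n base by (metis mult_cancel_right zero_neq_one mult_zero_right)
        then show ?thesis using elim by simp
      next
        case False
        then show ?thesis using rc(4)[of x n] n elim rc(3) by auto
      qed
    qed
  qed
qed

private lemma poles_shift: "p * z \<in> poles \<longleftrightarrow> z \<in> poles"
proof
  assume "p * z \<in> poles"
  then obtain n where "p * z * p powi n = 1" by (auto simp: poles_def)
  then have "z * p powi (n + 1) = 1" using base by (simp add: power_int_add mult_ac)
  then show "z \<in> poles" by (auto simp: poles_def)
next
  assume "z \<in> poles"
  then obtain n where "z * p powi n = 1" by (auto simp: poles_def)
  then have "p * z * p powi (n - 1) = 1" using base by (simp add: power_int_diff)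
  then show "p * z \<in> poles" by (auto simp: poles_def)
qed

private lemma poles_annulus:
  assumes "s \<in> poles" "norm p < norm s" "norm s \<le> 1"
  shows "s = 1"
proof -
  obtain n where n: "s * p powi n = 1" using assms by (auto simp: poles_def)
  have "n = 0"
  proof (rule ccontr)
    assume "n \<noteq> 0"
    then consider "n \<ge> 1" | "n \<le> -1" by linarith
    then show False
    proof cases
      case 1
      have "norm (s * p powi n) = norm s * norm p ^ nat n" using 1 by (simp add: norm_mult power_int_def norm_power)
      also have "\<dots> \<le> 1 * norm p ^ 1" using 1 base assms by (intro mult_mono power_decreasing) auto
      finally show False using n base by simp
    next
      case 2
      have "s = p ^ nat (- n)" using n 2 base by (simp add: power_int_def field_simps power_inverse)
      then have "norm s = norm p ^ nat (- n)" by (simp add: norm_power)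
      also have "\<dots> \<le> norm p ^ 1" using 2 base by (intro power_decreasing) auto
      finally show False using assms by simp
    qed
  qed
  then show ?thesis using n by simp
qed

lemma qp_zero_poles:
  assumes "qp (p / x) p = 0" "x \<noteq> 0"
  shows "x \<in> poles"
proof -
  obtain k where "p / x * p ^ k = 1" using assms qp_eq_0_iff[OF base(1)] by blast
  then have "x = p ^ Suc k" using assms by (simp add: field_simps)
  then have "x * p powi (- int (Suc k)) = 1" using base by (simp only: power_int_minus power_int_of_nat) (simp add: field_simps)
  then show ?thesis unfolding poles_def by blast
qed

theorem rank_series_eq_appell:
  assumes x: "x \<noteq> 0" "norm x < 1 / norm p" "x \<notin> poles"
  shows "rank_series t x = (1 - x) * appell t x / psi t"
proof -
  let ?D = "\<lambda>x. rank_series t x / (1 - x) - appell t x / psi t"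
  have ps: "psi t \<noteq> 0" by (rule psi_nonzero[OF t])
  have pp: "z * (t ^ 2) powi n \<noteq> 1" if "z \<notin> poles" for z n using that by (auto simp: poles_def base(4))
  have one: "1 \<in> poles" by (auto simp: poles_def intro: exI[of _ 0])
  have pxn: "norm (p * z) < 1" if "norm z < 1 / norm p" for z
    using that base by (simp add: norm_mult field_simps)
  have "?D x = 0"
  proof (rule qshift_zero[where p = p and D = ?D and S = poles and k = 2 and \<mu> = "- t" and z = x])
    show "?D analytic_on {z}" if "z \<noteq> 0" "norm z < 1 / norm p" "z \<notin> poles" for z
    proof -
      have "rank_series t analytic_on {z}"
        using that qp_zero_poles[of z] pxn by (intro rank_series_analytic) auto
      moreover have "z \<noteq> 1" using that one by auto
      ultimately show ?thesis using that pp[OF that(3)] ps t by (intro analytic_intros appell_on_analytic) auto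
    qed
    \<comment> \<open>The inhomogeneous terms \<open>1 - t * z\<close> of the two laws
      cancel.\<close>
    show "?D (p * z) = - t * z ^ 2 * ?D z" if z: "z \<noteq> 0" "norm z < 1 / norm p" "z \<notin> poles" for z
    proof -
      have "rank_series t (p * z) / (1 - p * z) = - t * z ^ 2 * (rank_series t z / (1 - z)) + (1 - t * z)"
        using z qp_zero_poles[of z] one pxn by (intro rank_series_shift) auto
      moreover have "appell t (p * z) / psi t = - t * z ^ 2 * (appell t z / psi t) + (1 - t * z)"
        using appell_shift[OF t z(1) pp[OF z(3)]] ps by (simp add: base(4) add_divide_distrib diff_divide_distrib)
      ultimately show ?thesis by (simp only: right_diff_distrib) simp
    qed
    show "((\<lambda>z. (z - s) * ?D z) \<longlongrightarrow> 0) (at s)" if "s \<in> poles" "norm p < norm s" "norm s \<le> 1" for s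
    proof -
      have s: "s = 1" using poles_annulus that by blast
      have nz: "qp p p \<noteq> 0" using base by (intro qp_nonzero) auto
      have FLc: "rank_series t \<midarrow>1\<rightarrow> rank_series t 1"
        using isContD[OF analytic_at_imp_isCont[OF rank_series_analytic[of 1]]] nz base by simp
      have ac: "(\<lambda>x. appell_on t x (- {0})) \<midarrow>1\<rightarrow> appell_on t 1 (- {0})"
        by (rule isContD[OF analytic_at_imp_isCont[OF appell_on_punctured_analytic[OF t]]])
      \<comment> \<open>The residues at 1 cancel: the term \<open>n = 0\<close> of the Appell sum
        contributes \<open>1 / psi t\<close>, which is \<open>rank_series t 1\<close>.\<close>
      have "(\<lambda>x. - rank_series t x + (1 + (1 - x) * appell_on t x (- {0})) / psi t) \<midarrow>1\<rightarrow>
            - rank_series t 1 + (1 + (1 - 1) * appell_on t 1 (- {0})) / psi t"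
        using ps by (intro tendsto_intros FLc ac)
      then have "(\<lambda>x. - rank_series t x + (1 + (1 - x) * appell_on t x (- {0})) / psi t) \<midarrow>1\<rightarrow> 0"
        by (simp add: rank_series_1)
      moreover have "\<forall>\<^sub>F x in at 1. - rank_series t x + (1 + (1 - x) * appell_on t x (- {0})) / psi t = (x - 1) * ?D x"
        using eventually_conj[OF poles_discrete[of 1] eventually_neq_at_within[of "0::complex" 1 UNIV]]
      proof (rule eventually_mono)
        show "1 \<noteq> (0::complex)" by simp
        fix x assume x: "x \<notin> poles \<and> x \<noteq> 0"
        then have x1: "x \<noteq> 1" using one by auto
        have "appell t x = 1 / (1 - x) + appell_on t x (- {0})"
          using x pp by (intro appell_split[OF t]) auto
        then have "(1 - x) * appell t x = 1 + (1 - x) * appell_on t x (- {0})" using x1 by (simp add: algebra_simps)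
        then have "(1 + (1 - x) * appell_on t x (- {0})) / psi t = (1 - x) * (appell t x / psi t)" by simp
        moreover have "(x - 1) * (rank_series t x / (1 - x)) = - rank_series t x" using x1 by (simp add: field_simps)
        moreover have "(x - 1) * (a - b) = (x - 1) * a + (1 - x) * b" for a b :: complex
          by (simp add: algebra_simps)
        ultimately show "- rank_series t x + (1 + (1 - x) * appell_on t x (- {0})) / psi t = (x - 1) * ?D x"
          by (simp only:)
      qed
      ultimately show ?thesis unfolding s by (rule Lim_transform_eventually)
    qed
  qed (use base t x poles_discrete poles_shift in auto)
  moreover have "x \<noteq> 1" using x one by auto
  ultimately show ?thesis by (simp add: field_simps)
qed

end

section \<open>Trisection of theta series and the quintuple product\<close>

lemma cube_root_props:
  assumes w: "1 + w + w ^ 2 = (0::complex)"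
  shows "w ^ 3 = 1" "w \<noteq> 0" "w \<noteq> 1" "1 / w = w ^ 2" "1 / w ^ 2 = w" "norm w = 1"
proof -
  have "w ^ 3 - 1 = (w - 1) * (1 + w + w ^ 2)"
    by (simp add: algebra_simps power2_eq_square power3_eq_cube)
  then show 3: "w ^ 3 = 1" using w by simp
  then show w0: "w \<noteq> 0" by auto
  show "w \<noteq> 1" using w by auto
  show "1 / w = w ^ 2" "1 / w ^ 2 = w" using 3 w0 by (simp_all add: field_simps power2_eq_square power3_eq_cube)
  have "norm w ^ 3 = 1" unfolding norm_power[symmetric] 3 by simp
  then show "norm w = 1" using power_eq_imp_eq_base[of "norm w" 3 1] by simp
qed

lemma deriv_zero_of_symmetric:
  fixes F :: "complex \<Rightarrow> complex"
  assumes F: "(F has_field_derivative d) (at 1)"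
  shows "((\<lambda>y. F (1 / y)) has_field_derivative - d) (at 1)"
    and "(\<And>y. F (1 / y) = F y) \<Longrightarrow> d = 0"
proof -
  have "((\<lambda>y::complex. 1 / y) has_field_derivative - 1) (at 1)"
    by (auto intro!: derivative_eq_intros)
  then show *: "((\<lambda>y. F (1 / y)) has_field_derivative - d) (at 1)"
    using DERIV_chain2[of F d "\<lambda>y. 1 / y" 1 "- 1" UNIV] F by simp
  assume "\<And>y. F (1 / y) = F y"
  then have "(F has_field_derivative - d) (at 1)" using * by simp
  then have "d = - d" using F DERIV_unique by blast
  then show "d = 0" by (simp add: eq_neg_iff_add_eq_0)
qed

text \<open>The terms of \<open>jac t y\<close> whose index is 1 modulo 3, as
  \<open>(3 * m + 1) ^ 2 = 9 * m ^ 2 + 6 * m + 1\<close>. Negating indices,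
  \<open>theta1 t (1 / y)\<close> collects the class -1.\<close>

definition theta1 :: "complex \<Rightarrow> complex \<Rightarrow> complex" where
  "theta1 t y = t * y * jac (t ^ 9) (t ^ 6 * y ^ 3)"

lemma jac_trisect:
  assumes t: "t \<noteq> 0" "norm t < 1" and y: "y \<noteq> 0"
  shows "jac t y = jac (t ^ 9) (y ^ 3) + theta1 t y + theta1 t (1 / y)"
proof -
  define a where "a = (\<lambda>n::int. t powi (n ^ 2) * y powi n)"
  have t9: "norm (t ^ 9) < 1" using t by (intro power_less_one_norm) auto
  have sa: "a summable_on UNIV" unfolding a_def by (rule summable_theta(2)[OF t(2) y])
  define A where "A = (\<lambda>r::int. range (\<lambda>m::int. 3 * m + r))"
  have hs: "(a has_sum infsum a (A r)) (A r)" for r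
    using summable_on_subset_banach[OF sa] by (intro has_sum_infsum) auto
  have inj: "inj_on (\<lambda>m::int. 3 * m + r) UNIV" for r by (auto simp: inj_on_def)
  have reidx: "infsum a (A r) = (\<Sum>\<^sub>\<infinity>m. a (3 * m + r))" for r
    unfolding A_def using infsum_reindex[OF inj, of a r] by (simp add: o_def)
  have un: "A 0 \<union> A 1 \<union> A (-1) = UNIV"
  proof -
    have "n \<in> A 0 \<union> A 1 \<union> A (-1)" for n :: int
    proof -
      consider "n mod 3 = 0" | "n mod 3 = 1" | "n mod 3 = 2" by linarith
      then show ?thesis
      proof cases
        case 1 then have "n = 3 * (n div 3) + 0" by presburger
        then show ?thesis unfolding A_def by blast
      next
        case 2 then have "n = 3 * (n div 3) + 1" by presburger
        then show ?thesis unfolding A_def by blast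
      next
        case 3 then have "n = 3 * (n div 3 + 1) + (-1)" by presburger
        then show ?thesis unfolding A_def by blast
      qed
    qed
    then show ?thesis by blast
  qed
  have dis: "A 0 \<inter> A 1 = {}" "(A 0 \<union> A 1) \<inter> A (-1) = {}"
    unfolding A_def by (auto, presburger+)
  have eq: "t * (1 / y) * ((t ^ 9) powi m\<^sup>2 * (t ^ 6 * (1 / y) ^ 3) powi m) = a (- (3 * m) - 1)" for m
  proof -
    have "(- (3 * m) - 1) ^ 2 = 9 * m ^ 2 + 6 * m + 1" by (simp add: power2_eq_square algebra_simps)
    moreover have "t powi (9 * m ^ 2 + 6 * m + 1) = (t ^ 9) powi (m ^ 2) * (t ^ 6) powi m * t"
      using t(1) power_int_mult[of t 9 "m ^ 2"] power_int_mult[of t 6 m] by (simp add: power_int_add)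
    moreover have "y powi (- (3 * m) - 1) = inverse ((y ^ 3) powi m * y)"
    proof -
      have "- (3 * m) - 1 = - (3 * m + 1)" by simp
      moreover have "y powi (3 * m + 1) = (y ^ 3) powi m * y" using y power_int_mult[of y 3 m] by (simp add: power_int_add)
      ultimately show ?thesis by (simp only: power_int_minus)
    qed
    ultimately have *: "a (- (3 * m) - 1) = ((t ^ 9) powi (m ^ 2) * (t ^ 6) powi m * t) * inverse ((y ^ 3) powi m * y)"
      by (simp only: a_def)
    have "((1 / y) ^ 3) powi m = inverse ((y ^ 3) powi m)"
      by (simp add: divide_inverse power_inverse power_int_inverse)
    then show ?thesis
      unfolding * power_int_mult_distrib by (simp add: divide_inverse mult_ac)
  qed
  have "(a has_sum (infsum a (A 0) + infsum a (A 1) + infsum a (A (-1)))) (A 0 \<union> A 1 \<union> A (-1))"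
    by (intro has_sum_Un_disjoint hs dis)
  then have "jac t y = infsum a (A 0) + infsum a (A 1) + infsum a (A (-1))"
    unfolding un jac_def a_def[symmetric] by (simp add: infsumI)
  also have "infsum a (A 0) = jac (t ^ 9) (y ^ 3)"
    unfolding reidx jac_def
  proof (rule infsum_cong)
    fix m :: int
    have "t powi ((3 * m) ^ 2) = (t ^ 9) powi (m ^ 2)" using power_int_mult[of t 9 "m ^ 2"] by (simp add: power_mult_distrib)
    moreover have "y powi (3 * m) = (y ^ 3) powi m" using power_int_mult[of y 3 m] by simp
    ultimately show "a (3 * m + 0) = (t ^ 9) powi m\<^sup>2 * (y ^ 3) powi m" by (simp add: a_def)
  qed
  also have "infsum a (A 1) = theta1 t y"
    unfolding reidx theta1_def jac_def infsum_cmult_right'[symmetric]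
  proof (rule infsum_cong)
    fix m :: int
    have "(3 * m + 1) ^ 2 = 9 * m ^ 2 + 6 * m + 1" by (simp add: power2_eq_square algebra_simps)
    moreover have "t powi (9 * m ^ 2 + 6 * m + 1) = (t ^ 9) powi (m ^ 2) * (t ^ 6) powi m * t"
      using t(1) power_int_mult[of t 9 "m ^ 2"] power_int_mult[of t 6 m] by (simp add: power_int_add)
    moreover have "y powi (3 * m + 1) = (y ^ 3) powi m * y" using y power_int_mult[of y 3 m] by (simp add: power_int_add)
    ultimately show "a (3 * m + 1) = t * y * ((t ^ 9) powi m\<^sup>2 * (t ^ 6 * y ^ 3) powi m)"
      by (simp add: a_def power_int_mult_distrib mult_ac)
  qed
  also have "infsum a (A (-1)) = theta1 t (1 / y)"
    unfolding reidx theta1_def jac_def infsum_cmult_right'[symmetric]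
  proof (rule infsum_reindex_bij_witness[of _ uminus uminus])
    fix m :: int
    show "t * (1 / y) * ((t ^ 9) powi (- m)\<^sup>2 * (t ^ 6 * (1 / y) ^ 3) powi (- m)) = a (3 * m + - 1)"
      using eq[of "- m"] by simp
  qed auto
  finally show ?thesis .
qed

section \<open>The quintuple product identity\<close>

context
  fixes q w :: complex
  assumes q: "q \<noteq> 0" "norm q < 1" and w: "1 + w + w ^ 2 = 0"
begin

private lemma q_powers: "norm (q ^ 2) < 1" "norm (q ^ 3) < 1" "norm (q ^ 4) < 1" "norm (q ^ 6) < 1" "norm (q ^ 12) < 1"
  using power_less_one_norm[OF q(2)] by auto

text \<open>For \<open>q = t ^ 3\<close> this is \<open>(theta1 t y - theta1 t (1 / y)) / t\<close>,
  the antisymmetric combination whose derivative at 1 is wanted.\<close>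

definition "quint_sum y = y * jac (q ^ 3) (q ^ 2 * y ^ 3) - 1 / y * jac (q ^ 3) (q ^ 2 / y ^ 3)"
private definition "quint_cofactor y = 1 / y * (qp (q ^ 4) (q ^ 4) * qp (q ^ 4 * y ^ 2) (q ^ 4) * qp (q ^ 4 / y ^ 2) (q ^ 4)) * jac q (- y)"
text \<open>The product side up to a constant. In the fundamental annulus only 1, -1 and
  \<open>q\<close> can be zeros of it; \<open>quint_cofactor\<close> is what is left after removing
  \<open>1 - y ^ 2\<close>.\<close>

private definition "quint_prod y = 1 / y * jac (q ^ 2) (- (y ^ 2) / q ^ 2) * jac q (- y)"

private lemma quint_prod_eq:
  assumes "y \<noteq> 0"
  shows "quint_prod y = (1 - y ^ 2) * quint_cofactor y"
proof -
  have "q ^ 2 * (- (y ^ 2) / q ^ 2) = - (y ^ 2)" "q ^ 2 / (- (y ^ 2) / q ^ 2) = - (q ^ 4 / y ^ 2)"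
    using q assms by (simp_all add: field_simps flip: power_add)
  then have "jac (q ^ 2) (- (y ^ 2) / q ^ 2) = qp (q ^ 4) (q ^ 4) * qp (y ^ 2) (q ^ 4) * qp (q ^ 4 / y ^ 2) (q ^ 4)"
    using jacobi_triple_product[of "q ^ 2" "- (y ^ 2) / q ^ 2"] q q_powers assms by (simp flip: power_mult)
  moreover have "qp (y ^ 2) (q ^ 4) = (1 - y ^ 2) * qp (q ^ 4 * y ^ 2) (q ^ 4)"
    using qp_rec[OF q_powers(3), of "y ^ 2"] by (simp add: mult.commute)
  ultimately show ?thesis by (simp add: quint_prod_def quint_cofactor_def mult_ac)
qed

private lemma jac_neg_eq:
  assumes "y \<noteq> 0"
  shows "jac q (- y) = qp (q ^ 2) (q ^ 2) * qp (q * y) (q ^ 2) * qp (q / y) (q ^ 2)"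
    and "jac q (- y) = (1 - q / y) * (qp (q ^ 2) (q ^ 2) * qp (q * y) (q ^ 2) * qp (q ^ 3 / y) (q ^ 2))"
proof -
  show 1: "jac q (- y) = qp (q ^ 2) (q ^ 2) * qp (q * y) (q ^ 2) * qp (q / y) (q ^ 2)"
    using jacobi_triple_product[OF q, of "- y"] assms by simp
  have "q / y * q ^ 2 = q ^ 3 / y" by (simp add: power2_eq_square power3_eq_cube)
  then show "jac q (- y) = (1 - q / y) * (qp (q ^ 2) (q ^ 2) * qp (q * y) (q ^ 2) * qp (q ^ 3 / y) (q ^ 2))"
    unfolding 1 by (simp only: qp_rec[OF q_powers(1), of "q / y"]) (simp add: mult_ac)
qed

private lemma quint_prod_analytic: "y \<noteq> 0 \<Longrightarrow> quint_prod analytic_on {y}"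
  unfolding quint_prod_def[abs_def] using q q_powers by (intro analytic_intros) auto

private lemma quint_cofactor_analytic: "y \<noteq> 0 \<Longrightarrow> quint_cofactor analytic_on {y}"
  unfolding quint_cofactor_def[abs_def] using q q_powers by (intro analytic_intros) auto

private lemma quint_sum_analytic: "y \<noteq> 0 \<Longrightarrow> quint_sum analytic_on {y}"
  unfolding quint_sum_def[abs_def] using q q_powers by (intro analytic_intros) auto

private lemma quint_prod_shift:
  assumes y: "y \<noteq> 0"
  shows "quint_prod (q ^ 2 * y) = quint_prod y / (q * y) ^ 3"
proof -
  have e: "- ((q ^ 2 * y) ^ 2) / q ^ 2 = (q ^ 2) ^ 2 * (- (y ^ 2) / q ^ 2)" "- (q ^ 2 * y) = q ^ 2 * (- y)"
    by (simp_all add: power_mult_distrib)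
  show ?thesis
    unfolding quint_prod_def e using q y
    by (subst jac_shift; (simp; fail)?)+ (simp add: field_simps power2_eq_square power3_eq_cube)
qed

private lemma quint_sum_shift:
  assumes y: "y \<noteq> 0"
  shows "quint_sum (q ^ 2 * y) = quint_sum y / (q * y) ^ 3"
proof -
  have "q ^ 2 * (q ^ 2 * y) ^ 3 = (q ^ 3) ^ 2 * (q ^ 2 * y ^ 3)"
    by (simp add: power_mult_distrib flip: power_mult power_add)
  then have 1: "jac (q ^ 3) (q ^ 2 * (q ^ 2 * y) ^ 3) = jac (q ^ 3) (q ^ 2 * y ^ 3) / (q ^ 5 * y ^ 3)"
    using jac_shift[of "q ^ 3" "q ^ 2 * y ^ 3"] q y by (simp add: mult.assoc flip: power_add)
  have "q ^ 2 / y ^ 3 = (q ^ 3) ^ 2 * (q ^ 2 / (q ^ 2 * y) ^ 3)"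
    using q y by (simp add: power_mult_distrib field_simps flip: power_mult power_add)
  moreover have "q ^ 3 * (q ^ 2 / (q ^ 2 * y) ^ 3) = 1 / (q * y ^ 3)"
    using q y by (simp add: power_mult_distrib field_simps flip: power_mult power_add power_Suc)
  ultimately have "jac (q ^ 3) (q ^ 2 / y ^ 3) = jac (q ^ 3) (q ^ 2 / (q ^ 2 * y) ^ 3) / (1 / (q * y ^ 3))"
    using jac_shift[of "q ^ 3" "q ^ 2 / (q ^ 2 * y) ^ 3"] q y by simp
  then have 2: "jac (q ^ 3) (q ^ 2 / (q ^ 2 * y) ^ 3) = jac (q ^ 3) (q ^ 2 / y ^ 3) / (q * y ^ 3)"
    using q y by (simp add: field_simps)
  show ?thesis
    unfolding quint_sum_def 1 2 using q y by (simp add: field_simps power_mult_distrib) (simp add: power2_eq_square power3_eq_cube eval_nat_numeral algebra_simps)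
qed

private lemma quint_sum_zeros: "quint_sum 1 = 0" "quint_sum (- 1) = 0" "quint_sum q = 0"
proof -
  show "quint_sum 1 = 0" "quint_sum (- 1) = 0" by (simp_all add: quint_sum_def)
  have "(q ^ 3) ^ 2 * (q ^ 2 / q ^ 3) = q ^ 2 * q ^ 3" "q ^ 3 * (q ^ 2 / q ^ 3) = q ^ 2"
    using q by (simp_all add: field_simps flip: power_mult power_add)
  then have "jac (q ^ 3) (q ^ 2 * q ^ 3) = jac (q ^ 3) (q ^ 2 / q ^ 3) / q ^ 2"
    using jac_shift[of "q ^ 3" "q ^ 2 / q ^ 3"] q by simp
  then show "quint_sum q = 0" using q by (simp add: quint_sum_def power2_eq_square)
qed

private lemma quint_prod_annulus:
  assumes "quint_prod y = 0" "norm (q ^ 2) < norm y" "norm y \<le> 1"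
  shows "y = 1 \<or> y = - 1 \<or> y = q"
proof -
  have y: "y \<noteq> 0" using assms(2) by auto
  have y4: "norm (q ^ 4 / y ^ 2) < 1"
  proof -
    have "norm (q ^ 2) ^ 2 < norm y ^ 2" using assms(2) by (intro power_strict_mono) auto
    then show ?thesis using y by (simp add: norm_divide norm_power flip: power_mult)
  qed
  have "norm (q ^ 4 * y ^ 2) < 1"
    using q_powers(3) assms(3) by (metis norm_ge_zero norm_mult norm_mult_less_of_le_1 mult.commute norm_power power_le_one)
  then have nz: "qp (q ^ 4 * y ^ 2) (q ^ 4) \<noteq> 0" "qp (q ^ 4 / y ^ 2) (q ^ 4) \<noteq> 0" "qp (q ^ 4) (q ^ 4) \<noteq> 0"
    using y4 q_powers by (simp_all add: qp_nonzero)
  have "y ^ 2 = 1 \<or> jac q (- y) = 0"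
    using assms(1) nz y unfolding quint_prod_eq[OF y] quint_cofactor_def by auto
  then show ?thesis
  proof
    assume "y ^ 2 = 1" then show ?thesis by (auto simp: power2_eq_1_iff)
  next
    assume j: "jac q (- y) = 0"
    have "norm (q * y) < 1" using q assms(3) by (metis norm_mult_less_of_le_1 mult.commute)
    moreover have "norm (q ^ 3 / y) < 1"
    proof -
      have "norm q ^ 3 \<le> norm (q ^ 2)" using q by (simp add: norm_power power_decreasing)
      then have "norm q ^ 3 < norm y" using assms(2) by linarith
      then show ?thesis using y by (simp add: norm_divide norm_power)
    qed
    ultimately have "qp (q * y) (q ^ 2) \<noteq> 0" "qp (q ^ 3 / y) (q ^ 2) \<noteq> 0" "qp (q ^ 2) (q ^ 2) \<noteq> 0"
      using q_powers by (simp_all add: qp_nonzero)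
    then have "1 - q / y = 0" using j unfolding jac_neg_eq(2)[OF y] by auto
    then show ?thesis using y by (simp add: field_simps)
  qed
qed

private lemma quint_cofactor_1: "quint_cofactor 1 \<noteq> 0" "quint_cofactor 1 = qp (q ^ 4) (q ^ 4) ^ 3 * (qp (q ^ 2) (q ^ 2) * qp q (q ^ 2) ^ 2)"
proof -
  show 1: "quint_cofactor 1 = qp (q ^ 4) (q ^ 4) ^ 3 * (qp (q ^ 2) (q ^ 2) * qp q (q ^ 2) ^ 2)"
    using jac_neg_eq(1)[of 1] by (simp add: quint_cofactor_def power3_eq_cube power2_eq_square)
  show "quint_cofactor 1 \<noteq> 0" unfolding 1 using q_powers q by (simp add: qp_nonzero)
qed

text \<open>At \<open>y = w\<close> the first three products run over all cube roots of unity and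
  collapse to base \<open>q ^ 12\<close>. The other theta function lacks the root 1, which accounts
  for the divisor \<open>qp q (q ^ 2)\<close>.\<close>

private lemma quint_prod_w: "quint_prod w = w ^ 2 * ((1 - w ^ 2) * qp (q ^ 12) (q ^ 12)) * (qp (q ^ 2) (q ^ 2) * (qp (q ^ 3) (q ^ 6) / qp q (q ^ 2)))"
  and quint_prod_w_nz: "quint_prod w \<noteq> 0"
proof -
  note wp = cube_root_props[OF w]
  have w4: "w ^ 2 * w ^ 2 = w" using wp(1) by (simp add: power2_eq_square power3_eq_cube mult.assoc)
  have e: "q ^ 4 / w ^ 2 = w * q ^ 4" using wp(5) by (simp add: divide_inverse mult.commute)
  have "qp (q ^ 4) (q ^ 4) * qp (w * q ^ 4) (q ^ 4) * qp (w ^ 2 * q ^ 4) (q ^ 4) = qp ((q ^ 4) ^ 3) ((q ^ 4) ^ 3)"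
    by (rule qp_mult_cube_roots[OF q_powers(3) w])
  also have "(q ^ 4) ^ 3 = q ^ 12" by (simp flip: power_mult)
  finally have 1: "qp (q ^ 4) (q ^ 4) * qp (q ^ 4 * w ^ 2) (q ^ 4) * qp (q ^ 4 / w ^ 2) (q ^ 4) = qp (q ^ 12) (q ^ 12)"
    by (simp add: e mult_ac)
  have nz: "qp q (q ^ 2) \<noteq> 0" using q q_powers by (simp add: qp_nonzero)
  have qw: "q / w = q * w ^ 2" using wp(4) by (simp add: divide_inverse)
  have "qp q (q ^ 2) * qp (w * q) (q ^ 2) * qp (w ^ 2 * q) (q ^ 2) = qp (q ^ 3) ((q ^ 2) ^ 3)"
    by (rule qp_mult_cube_roots[OF q_powers(1) w])
  also have "(q ^ 2) ^ 3 = q ^ 6" by (simp flip: power_mult)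
  finally have "qp (q * w) (q ^ 2) * qp (q / w) (q ^ 2) = qp (q ^ 3) (q ^ 6) / qp q (q ^ 2)"
    unfolding qw using nz by (simp add: field_simps)
  then have 2: "jac q (- w) = qp (q ^ 2) (q ^ 2) * (qp (q ^ 3) (q ^ 6) / qp q (q ^ 2))"
    using jac_neg_eq(1)[OF wp(2)] by (simp add: mult.assoc)
  show 3: "quint_prod w = w ^ 2 * ((1 - w ^ 2) * qp (q ^ 12) (q ^ 12)) * (qp (q ^ 2) (q ^ 2) * (qp (q ^ 3) (q ^ 6) / qp q (q ^ 2)))"
    unfolding quint_prod_eq[OF wp(2)] quint_cofactor_def 1 2 wp(4) by simp
  have "w ^ 2 \<noteq> 1" using w4 wp(3) by (metis mult_1)
  then show "quint_prod w \<noteq> 0"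
    unfolding 3 using wp(2) nz q_powers by (simp add: qp_nonzero)
qed

private lemma quint_prod_discrete: "z \<noteq> 0 \<Longrightarrow> \<forall>\<^sub>F x in at z. quint_prod x \<noteq> 0"
  by (rule eventually_analytic_nonzero[OF quint_prod_analytic _ quint_prod_w_nz]) (use cube_root_props[OF w] in auto)

private lemma quint_quotient_residue:
  assumes s: "s = 1 \<or> s = - 1 \<or> s = q"
  shows "((\<lambda>y. (y - s) * (quint_sum y / quint_prod y)) \<longlongrightarrow> 0) (at s)"
proof -
  have s0: "s \<noteq> 0" using s q by auto
  have sq0: "quint_sum s = 0" using s quint_sum_zeros by auto
  have "quint_sum \<midarrow>s\<rightarrow> quint_sum s" by (rule isContD[OF analytic_at_imp_isCont[OF quint_sum_analytic[OF s0]]])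
  then have sql: "quint_sum \<midarrow>s\<rightarrow> 0" by (simp add: sq0)
  \<comment> \<open>Each of the three zeros of \<open>quint_prod\<close> is simple: dividing by
    \<open>y - s\<close> leaves a function with nonzero limit.\<close>
  have "\<exists>U L. L \<noteq> 0 \<and> U \<midarrow>s\<rightarrow> L \<and> (\<forall>\<^sub>F y in at s. quint_prod y = (y - s) * U y)"
  proof -
    consider "s = 1" | "s = - 1" | "s = q" using s by auto
    then show ?thesis
    proof cases
      case 1
      have "quint_cofactor \<midarrow>1\<rightarrow> quint_cofactor 1" by (rule isContD[OF analytic_at_imp_isCont[OF quint_cofactor_analytic]]) simp
      then have "(\<lambda>y. - (1 + y) * quint_cofactor y) \<midarrow>1\<rightarrow> - (1 + 1) * quint_cofactor 1" by (intro tendsto_intros)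
      moreover have "\<forall>\<^sub>F y in at 1. quint_prod y = (y - 1) * (- (1 + y) * quint_cofactor y)"
        using eventually_neq_at_within[of "0::complex" 1 UNIV]
        by eventually_elim (simp add: quint_prod_eq power2_eq_square algebra_simps)
      ultimately show ?thesis using quint_cofactor_1(1) 1 by (intro exI[of _ "\<lambda>y. - (1 + y) * quint_cofactor y"] exI[of _ "- (1 + 1) * quint_cofactor 1"]) auto
    next
      case 2
      have "quint_cofactor \<midarrow>- 1\<rightarrow> quint_cofactor (- 1)" by (rule isContD[OF analytic_at_imp_isCont[OF quint_cofactor_analytic]]) simp
      then have "(\<lambda>y. (1 - y) * quint_cofactor y) \<midarrow>- 1\<rightarrow> (1 - - 1) * quint_cofactor (- 1)" by (intro tendsto_intros)
      moreover have "\<forall>\<^sub>F y in at (- 1). quint_prod y = (y - - 1) * ((1 - y) * quint_cofactor y)"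
        using eventually_neq_at_within[of "0::complex" "- 1" UNIV]
        by eventually_elim (simp add: quint_prod_eq power2_eq_square algebra_simps)
      moreover have "quint_cofactor (- 1) \<noteq> 0"
        using jac_neg_eq(1)[of "- 1"] q_powers q by (simp add: quint_cofactor_def qp_nonzero)
      ultimately show ?thesis using 2 by (intro exI[of _ "\<lambda>y. (1 - y) * quint_cofactor y"] exI[of _ "(1 - - 1) * quint_cofactor (- 1)"]) auto
    next
      case 3
      \<comment> \<open>\<open>V\<close> is the cofactor with \<open>1 - q / y\<close>, the factor
        vanishing at \<open>q\<close>, taken out of \<open>jac q (- y)\<close>.\<close>
      define V where "V = (\<lambda>y. 1 / y * (qp (q ^ 4) (q ^ 4) * qp (q ^ 4 * y ^ 2) (q ^ 4) * qp (q ^ 4 / y ^ 2) (q ^ 4)) *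
          (qp (q ^ 2) (q ^ 2) * qp (q * y) (q ^ 2) * qp (q ^ 3 / y) (q ^ 2)))"
      have VM: "quint_cofactor y = (1 - q / y) * V y" if "y \<noteq> 0" for y
        using jac_neg_eq(2)[OF that] by (simp add: quint_cofactor_def V_def)
      have "V analytic_on {q}" unfolding V_def using q q_powers by (intro analytic_intros) auto
      then have "V \<midarrow>q\<rightarrow> V q" by (rule isContD[OF analytic_at_imp_isCont])
      then have "(\<lambda>y. (1 - y ^ 2) * (1 / y) * V y) \<midarrow>q\<rightarrow> (1 - q ^ 2) * (1 / q) * V q"
        using q by (intro tendsto_intros)
      moreover have "\<forall>\<^sub>F y in at q. quint_prod y = (y - q) * ((1 - y ^ 2) * (1 / y) * V y)"
        using eventually_neq_at_within[of "0::complex" q UNIV]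
      proof eventually_elim
        case (elim y)
        have "1 - q / y = (y - q) * (1 / y)" using elim by (simp add: field_simps)
        then show ?case by (simp only: quint_prod_eq[OF elim] VM[OF elim] mult_ac)
      qed
      moreover have "(1 - q ^ 2) * (1 / q) * V q \<noteq> 0"
      proof -
        have "q ^ 4 * q ^ 2 = q ^ 6" by (simp flip: power_add)
        moreover have "q ^ 4 / q ^ 2 = q ^ 2" using q by (simp add: field_simps flip: power_add)
        moreover have "q * q = q ^ 2" "q ^ 3 / q = q ^ 2" by (simp_all add: power2_eq_square power3_eq_cube)
        moreover have "1 - q ^ 2 \<noteq> 0" using q_powers(1) by auto
        ultimately show ?thesis using q q_powers by (simp add: V_def qp_nonzero)
      qed
      ultimately show ?thesis using 3 by blast
    qed
  qed
  then obtain U L where U: "L \<noteq> 0" "U \<midarrow>s\<rightarrow> L" "\<forall>\<^sub>F y in at s. quint_prod y = (y - s) * U y" by blast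
  have "(\<lambda>y. quint_sum y / U y) \<midarrow>s\<rightarrow> 0 / L" using U(1,2) by (intro tendsto_intros sql)
  then have "(\<lambda>y. quint_sum y / U y) \<midarrow>s\<rightarrow> 0" by simp
  moreover have "\<forall>\<^sub>F y in at s. quint_sum y / U y = (y - s) * (quint_sum y / quint_prod y)"
    using U(3) eventually_neq_at_within[of s s UNIV] by eventually_elim simp
  ultimately show ?thesis by (rule Lim_transform_eventually)
qed

lemma quintuple_product: "\<exists>C. \<forall>y. y \<noteq> 0 \<longrightarrow> norm y < 1 / norm (q ^ 2) \<longrightarrow> y \<notin> {y. quint_prod y = 0} \<longrightarrow> quint_sum y / quint_prod y = C"
proof (rule qshift_periodic_const)
  show "0 < norm (q ^ 2)" "norm (q ^ 2) < 1" using q_powers q by auto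
  show "(\<lambda>y. quint_sum y / quint_prod y) analytic_on {z}" if "z \<noteq> 0" "z \<notin> {y. quint_prod y = 0}" for z
    using that quint_sum_analytic quint_prod_analytic by (intro analytic_intros) auto
  show "\<forall>\<^sub>F x in at z. x \<notin> {y. quint_prod y = 0}" if "z \<noteq> 0" for z using quint_prod_discrete[OF that] by simp
  show "q ^ 2 * z \<in> {y. quint_prod y = 0} \<longleftrightarrow> z \<in> {y. quint_prod y = 0}" if "z \<noteq> 0" for z
    using quint_prod_shift[OF that] q that by simp
  show "quint_sum (q ^ 2 * z) / quint_prod (q ^ 2 * z) = quint_sum z / quint_prod z" if "z \<noteq> 0" for z
    using quint_prod_shift[OF that] quint_sum_shift[OF that] q that by simp
  show "((\<lambda>y. (y - s) * (quint_sum y / quint_prod y)) \<longlongrightarrow> 0) (at s)"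
    if "s \<in> {y. quint_prod y = 0}" "norm (q ^ 2) < norm s" "norm s \<le> 1" for s
    using quint_prod_annulus[of s] that by (intro quint_quotient_residue) auto
qed

text \<open>In \<open>quint_sum y = C * ((1 - y ^ 2) * quint_cofactor y)\<close> only the factor
  \<open>1 - y ^ 2\<close> contributes to the derivative at 1. The constant \<open>C\<close> is
  found at \<open>y = w\<close>, where both theta series in \<open>quint_sum\<close> have the
  argument \<open>q ^ 2\<close>.\<close>

lemma quint_sum_deriv:
  assumes d: "(quint_sum has_field_derivative d) (at 1)"
  shows "d = 2 * jac (q ^ 3) (q ^ 2) * psi q ^ 3 / psi (q ^ 3)"
proof -
  note wp = cube_root_props[OF w]
  obtain C where C: "\<And>y. y \<noteq> 0 \<Longrightarrow> norm y < 1 / norm (q ^ 2) \<Longrightarrow> quint_prod y \<noteq> 0 \<Longrightarrow> quint_sum y / quint_prod y = C"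
    using quintuple_product by blast
  have q21: "1 < 1 / norm (q ^ 2)" using q_powers q by (simp only: less_divide_eq_1_pos zero_less_norm_iff power_eq_0_iff simp_thms)
  have "quint_cofactor field_differentiable at 1" using quint_cofactor_analytic[of 1] analytic_on_imp_differentiable_at by force
  then obtain m where m: "(quint_cofactor has_field_derivative m) (at 1)" by (auto simp: field_differentiable_def)
  have "((\<lambda>y. C * ((1 - y ^ 2) * quint_cofactor y)) has_field_derivative (C * (- 2 * quint_cofactor 1))) (at 1)"
    by (rule derivative_eq_intros m refl | simp)+
  moreover have ev: "\<forall>\<^sub>F y in nhds 1. quint_sum y = C * ((1 - y ^ 2) * quint_cofactor y)"
  proof -
    have "open (ball 0 (1 / norm (q ^ 2)) - {0::complex})" by auto
    then have "\<forall>\<^sub>F y in nhds 1. y \<in> ball 0 (1 / norm (q ^ 2)) - {0::complex}"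
      by (rule eventually_nhds_in_open) (use q21 in auto)
    moreover have "\<forall>\<^sub>F y in nhds 1. y \<noteq> 1 \<longrightarrow> quint_prod y \<noteq> 0" using quint_prod_discrete[of 1] by (simp add: eventually_at_filter)
    ultimately show ?thesis
    proof eventually_elim
      case (elim y)
      show ?case
      proof (cases "y = 1")
        case True then show ?thesis using quint_sum_zeros by simp
      next
        case False
        then show ?thesis using C[of y] elim quint_prod_eq[of y] by (auto simp: field_simps)
      qed
    qed
  qed
  ultimately have "(quint_sum has_field_derivative (C * (- 2 * quint_cofactor 1))) (at 1)"
    using iffD2[OF DERIV_cong_ev[OF refl ev refl]] by simp
  then have d1: "d = C * (- 2 * quint_cofactor 1)" using d DERIV_unique by blast
  define j where "j = jac (q ^ 3) (q ^ 2)"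
  have "quint_sum w / quint_prod w = C" using C[OF wp(2) _ quint_prod_w_nz] wp(6) q21 by simp
  moreover have "quint_sum w = (w - w ^ 2) * j" using wp(1,4) by (simp add: quint_sum_def j_def algebra_simps)
  ultimately have "C * quint_prod w = (w - w ^ 2) * j" using quint_prod_w_nz by (simp add: field_simps)
  define X where "X = qp (q ^ 12) (q ^ 12) * (qp (q ^ 2) (q ^ 2) * (qp (q ^ 3) (q ^ 6) / qp q (q ^ 2)))"
  have nzs: "qp (q ^ 12) (q ^ 12) \<noteq> 0" "qp (q ^ 2) (q ^ 2) \<noteq> 0" "qp (q ^ 3) (q ^ 6) \<noteq> 0" "qp q (q ^ 2) \<noteq> 0"
    using q q_powers by (simp_all add: qp_nonzero)
  have TX: "quint_prod w = (w ^ 2 - w) * X"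
  proof -
    have "w ^ 2 * (1 - w ^ 2) = w ^ 2 - w" using wp(1) by (simp add: power2_eq_square power3_eq_cube algebra_simps)
    then show ?thesis unfolding quint_prod_w X_def by (metis mult.assoc)
  qed
  have "C * ((w ^ 2 - w) * X) = (w - w ^ 2) * j" using \<open>C * quint_prod w = _\<close> TX by simp
  then have "(w ^ 2 - w) * (C * X + j) = 0" by (simp add: algebra_simps)
  moreover have "w ^ 2 - w \<noteq> 0" using wp(2,3) by (simp add: power2_eq_square)
  ultimately have "C * X = - j" by (simp add: add_eq_0_iff2)
  then have "C = - j / X" using nzs by (simp add: X_def field_simps)
  then have "d = 2 * j * (quint_cofactor 1 / X)" using d1 by simp
  also have "quint_cofactor 1 / X = psi q ^ 3 / psi (q ^ 3)"
  proof -
    have "psi (q ^ 3) = qp (q ^ 12) (q ^ 12) * qp (q ^ 3) (q ^ 6)"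
      using psi_eq(2)[of "q ^ 3"] q q_powers by (simp flip: power_mult)
    then show ?thesis unfolding quint_cofactor_1(2) X_def psi_eq(2)[OF q] using nzs
      by (simp add: field_simps power3_eq_cube power2_eq_square)
  qed
  finally show ?thesis by (simp add: j_def)
qed

end

text \<open>Inversion changes the sign of the derivative at 1, so the antisymmetric combination
  \<open>quint_sum (t ^ 3)\<close> has derivative \<open>2 * d / t\<close> there.\<close>

lemma theta1_deriv:
  assumes t: "t \<noteq> 0" "norm t < 1" and w: "1 + w + w ^ 2 = (0::complex)" and d: "(theta1 t has_field_derivative d) (at 1)"
  shows "d = theta1 t 1 * psi (t ^ 3) ^ 3 / psi (t ^ 9)"
proof -
  have t3: "t ^ 3 \<noteq> 0" "norm (t ^ 3) < 1" using t power_less_one_norm[OF t(2)] by auto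
  have e: "(t ^ 3) ^ 3 = t ^ 9" "(t ^ 3) ^ 2 = t ^ 6" by (simp_all flip: power_mult)
  define X where "X = jac (t ^ 9) (t ^ 6) * psi (t ^ 3) ^ 3 / psi (t ^ 9)"
  have "quint_sum (t ^ 3) = (\<lambda>y. (theta1 t y - theta1 t (1 / y)) / t)"
    using t by (auto simp: quint_sum_def[OF t3 w] theta1_def e power_one_over field_simps)
  moreover have "((\<lambda>y. (theta1 t y - theta1 t (1 / y)) / t) has_field_derivative (d - - d) / t) (at 1)"
    by (intro DERIV_cdivide DERIV_diff d deriv_zero_of_symmetric(1)[OF d])
  ultimately have "(d - - d) / t = 2 * jac (t ^ 9) (t ^ 6) * psi (t ^ 3) ^ 3 / psi (t ^ 9)"
    using quint_sum_deriv[OF t3 w, of "(d - - d) / t"] by (simp add: e)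
  then have "(d - - d) / t = 2 * X" by (simp add: X_def)
  then have "d = t * X" using t by (simp add: field_simps)
  then show ?thesis by (simp add: theta1_def X_def)
qed

text \<open>\<open>?A\<close> is the triple product with the factor for the root 1 moved into
  \<open>psi t\<close>. \<open>?B\<close> splits the exponents 3, 9, 15 modulo 18. \<open>?C\<close>
  and \<open>?E\<close> trisect at 1 and at \<open>w\<close>: the outer classes enter with total
  coefficient 2 and \<open>w + w ^ 2 = - 1\<close>.\<close>

lemma jac_values:
  assumes t: "t \<noteq> 0" "norm t < 1" and w: "1 + w + w ^ 2 = 0"
  shows "jac t w = psi t * qp (- (t ^ 3)) (t ^ 6)" (is ?A)
    and "theta1 t 1 = t * psi (t ^ 9) * qp (- (t ^ 3)) (t ^ 6)" (is ?B)
    and "jac t 1 = jac t w + 3 * theta1 t 1" (is ?C)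
    and "jac t w = jac (t ^ 9) 1 - theta1 t 1" (is ?E)
    and "qp (- (t ^ 3)) (t ^ 6) \<noteq> 0" (is ?F)
proof -
  note wp = cube_root_props[OF w]
  note tn = power_less_one_norm[OF t(2)]
  have w4: "w ^ 2 * w ^ 2 = w" using wp(1) by (simp add: power2_eq_square power3_eq_cube mult.assoc)
  have nz: "qp (- t) (t ^ 2) \<noteq> 0" using t tn[of 2] by (simp add: qp_nonzero)
  have tw: "t / w = t * w ^ 2" using wp(4) by (simp add: divide_inverse)
  have "(t ^ 2) ^ 3 = t ^ 6" "(- t) ^ 3 = - (t ^ 3)" by (simp_all flip: power_mult)
  then have "qp (- t) (t ^ 2) * qp (w * - t) (t ^ 2) * qp (w ^ 2 * - t) (t ^ 2) = qp (- (t ^ 3)) (t ^ 6)"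
    using qp_mult_cube_roots[of "t ^ 2" w "- t"] w tn[of 2] by simp
  then have "qp (- (t * w)) (t ^ 2) * qp (- (t / w)) (t ^ 2) = qp (- (t ^ 3)) (t ^ 6) / qp (- t) (t ^ 2)"
    unfolding tw using nz by (simp add: field_simps)
  then show ?A using jacobi_triple_product[OF t wp(2)] psi_eq(1)[OF t] by (simp add: mult.assoc)
  have 18: "norm (t ^ 18) < 1" "norm (t ^ 9) < 1" "norm (t ^ 6) < 1" using tn by auto
  have e: "(t ^ 9) ^ 2 = t ^ 18" "t ^ 9 * t ^ 6 = t ^ 15" "t ^ 9 / t ^ 6 = t ^ 3" "(t ^ 6) ^ 3 = t ^ 18"
     "t ^ 3 * t ^ 6 = t ^ 9" "t ^ 3 * (t ^ 6) ^ 2 = t ^ 15"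
    using t by (simp_all add: power_diff[symmetric] flip: power_mult power_add)
  have "jac (t ^ 9) (t ^ 6) = qp (t ^ 18) (t ^ 18) * qp (- (t ^ 15)) (t ^ 18) * qp (- (t ^ 3)) (t ^ 18)"
    using jacobi_triple_product[of "t ^ 9" "t ^ 6"] t 18 by (simp add: e)
  moreover have "qp (- (t ^ 3)) (t ^ 6) = qp (- (t ^ 3)) (t ^ 18) * qp (- (t ^ 9)) (t ^ 18) * qp (- (t ^ 15)) (t ^ 18)"
    using qp_split3[OF 18(3), of "- (t ^ 3)"] by (simp add: e)
  moreover have "psi (t ^ 9) = qp (t ^ 18) (t ^ 18) / qp (- (t ^ 9)) (t ^ 18)"
    using psi_eq(1)[of "t ^ 9"] t 18 by (simp add: e)
  moreover have "qp (- (t ^ 9)) (t ^ 18) \<noteq> 0" using 18 by (simp add: qp_nonzero)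
  ultimately show ?B by (simp add: theta1_def)
  have th_w: "theta1 t w = w * theta1 t 1" "theta1 t (w ^ 2) = w ^ 2 * theta1 t 1"
  proof -
    have "w ^ 6 = 1" using wp(1) power_mult[of w 3 2] by simp
    then show "theta1 t w = w * theta1 t 1" "theta1 t (w ^ 2) = w ^ 2 * theta1 t 1"
      using wp(1) by (simp_all add: theta1_def flip: power_mult)
  qed
  have "jac t w = jac (t ^ 9) 1 + w * theta1 t 1 + w ^ 2 * theta1 t 1"
    using jac_trisect[OF t wp(2)] wp th_w by simp
  also have "\<dots> = jac (t ^ 9) 1 + (1 + w + w ^ 2) * theta1 t 1 - theta1 t 1" by (simp add: algebra_simps)
  finally show E: ?E using w by simp
  show ?C using jac_trisect[OF t, of 1] E by simp
  show ?F using 18 tn[of 3] by (simp add: qp_nonzero)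
qed

section \<open>The Appell sum at a cube root of unity\<close>

context
  fixes t w :: complex
  assumes t: "t \<noteq> 0" "norm t < 1" and w: "1 + w + w ^ 2 = 0"
begin

definition "appell9 x = appell (t ^ 9) x / psi (t ^ 9)"

text \<open>
  \<open>main_terms\<close> satisfies the difference equation of \<open>appell t x / psi t\<close>; \<open>theta_part\<close> solves the homogeneous
  equation and cancels the poles of \<open>main_terms\<close> at the primitive cube roots of unity.
\<close>

private definition "main_terms x = (appell9 (t ^ 6 * x ^ 3) - 1) / x - x * appell9 (x ^ 3) / t + x ^ 3 * appell9 (x ^ 3 / t ^ 6) / t ^ 6 + 1"

text \<open>For nonzero \<open>x\<close> it vanishes exactly where \<open>x ^ 3\<close> is an
  integral power of \<open>t ^ 6\<close>. This set contains the poles of all the Appell sums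
  involved.\<close>

private definition "cube_theta x = jac (t ^ 3) (- (x ^ 3) / t ^ 3)"

text \<open>Determined by the condition \<open>polar_coeff w = 0\<close>; the cube of the eta-type
  product is the value of \<open>cube_cofactor\<close> at 1.\<close>

private definition "theta_coeff = qp (t ^ 6) (t ^ 6) ^ 3 / (t * psi (t ^ 9) * jac t w)"

private definition "theta_part x = theta_coeff * x * jac t x / cube_theta x"

private definition "defect x = appell t x / psi t - main_terms x - theta_part x"

private definition "cube_cofactor X = qp (t ^ 6) (t ^ 6) * qp (t ^ 6 * X) (t ^ 6) * qp (t ^ 6 / X) (t ^ 6)"

private lemma t_powers: "norm (t ^ 2) < 1" "norm (t ^ 3) < 1" "norm (t ^ 6) < 1" "norm (t ^ 9) < 1" "norm (t ^ 18) < 1"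
  using power_less_one_norm[OF t(2)] by auto

private lemma t9_props: "t ^ 9 \<noteq> 0" "norm (t ^ 9) < 1" "(t ^ 9) ^ 2 = t ^ 18"
  using t t_powers by (auto simp flip: power_mult)

private lemma psi_nz: "psi t \<noteq> 0" "psi (t ^ 9) \<noteq> 0" "jac t w \<noteq> 0" "qp (t ^ 6) (t ^ 6) \<noteq> 0" "psi (t ^ 3) \<noteq> 0"
proof -
  show p: "psi t \<noteq> 0" by (rule psi_nonzero[OF t])
  show "psi (t ^ 9) \<noteq> 0" by (rule psi_nonzero[OF t9_props(1,2)])
  show "psi (t ^ 3) \<noteq> 0" using t t_powers by (intro psi_nonzero) auto
  show "jac t w \<noteq> 0" using jac_values(1,5)[OF t w] p by simp
  show "qp (t ^ 6) (t ^ 6) \<noteq> 0" using t_powers by (simp add: qp_nonzero)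
qed

private lemma cube_theta_eq:
  assumes "x \<noteq> 0"
  shows "cube_theta x = (1 - x ^ 3) * cube_cofactor (x ^ 3)"
    and "cube_theta x = qp (t ^ 6) (t ^ 6) * qp (x ^ 3) (t ^ 6) * qp (t ^ 6 / x ^ 3) (t ^ 6)"
proof -
  have e: "(t ^ 3) ^ 2 = t ^ 6" "t ^ 3 * (- (x ^ 3) / t ^ 3) = - (x ^ 3)" "t ^ 3 / (- (x ^ 3) / t ^ 3) = - (t ^ 6 / x ^ 3)"
    using t assms by (simp_all add: field_simps flip: power_mult power_add)
  show 1: "cube_theta x = qp (t ^ 6) (t ^ 6) * qp (x ^ 3) (t ^ 6) * qp (t ^ 6 / x ^ 3) (t ^ 6)"
    using jacobi_triple_product[of "t ^ 3" "- (x ^ 3) / t ^ 3"] t t_powers assms by (simp add: cube_theta_def e)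
  show "cube_theta x = (1 - x ^ 3) * cube_cofactor (x ^ 3)"
    unfolding 1 cube_cofactor_def using qp_rec[OF t_powers(3), of "x ^ 3"] by (simp add: mult_ac)
qed

private lemma cube_theta_nonpole:
  assumes x: "x \<noteq> 0" and Z: "cube_theta x \<noteq> 0"
  shows "x ^ 3 * (t ^ 6) powi n \<noteq> 1"
proof
  assume n: "x ^ 3 * (t ^ 6) powi n = 1"
  show False
  proof (cases "n \<ge> 0")
    case True
    then have "x ^ 3 * (t ^ 6) ^ nat n = 1" using n by (simp add: power_int_def)
    then have "qp (x ^ 3) (t ^ 6) = 0" using qp_eq_0_iff[OF t_powers(3)] by blast
    then show False using Z cube_theta_eq(2)[OF x] by simp
  next
    case False
    define k where "k = nat (- n) - 1"
    have k: "nat (- n) = Suc k" using False by (simp add: k_def)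
    have pw: "(t ^ 6) powi n = 1 / (t ^ 6) ^ Suc k" using False k by (simp add: power_int_def power_inverse divide_inverse del: power_Suc)
    have e: "x ^ 3 = (t ^ 6) ^ Suc k" using n[unfolded pw] t by (simp add: field_simps del: power_Suc)
    have "t ^ 6 / x ^ 3 * (t ^ 6) ^ k = (t ^ 6) ^ Suc k / x ^ 3" by simp
    also have "\<dots> = 1" unfolding e[symmetric] using x by simp
    finally have "t ^ 6 / x ^ 3 * (t ^ 6) ^ k = 1" .
    then have "qp (t ^ 6 / x ^ 3) (t ^ 6) = 0" using qp_eq_0_iff[OF t_powers(3)] by blast
    then show False using Z cube_theta_eq(2)[OF x] by simp
  qed
qed

text \<open>\<open>(t ^ 9) ^ 2\<close> is the cube of \<open>t ^ 6\<close>, so the poles in base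
  \<open>t ^ 9\<close>, also after multiplying the argument by \<open>t ^ 6\<close> or its inverse,
  have \<open>x ^ 3\<close> in the powers of \<open>t ^ 6\<close>. For base \<open>t\<close> one
  takes cubes.\<close>

private lemma nonpoles:
  assumes x: "x \<noteq> 0" and Z: "cube_theta x \<noteq> 0"
  shows "x * (t ^ 2) powi n \<noteq> 1" "x ^ 3 * ((t ^ 9) ^ 2) powi n \<noteq> 1"
    "t ^ 6 * x ^ 3 * ((t ^ 9) ^ 2) powi n \<noteq> 1" "x ^ 3 / t ^ 6 * ((t ^ 9) ^ 2) powi n \<noteq> 1"
proof -
  note N = cube_theta_nonpole[OF x Z]
  have e: "((t ^ 9) ^ 2) powi n = (t ^ 6) powi (3 * n)"
    using power_int_mult[of "t ^ 6" 3 n] by (simp flip: power_mult)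
  show "x ^ 3 * ((t ^ 9) ^ 2) powi n \<noteq> 1" unfolding e by (rule N)
  have "t ^ 6 * x ^ 3 * (t ^ 6) powi (3 * n) = x ^ 3 * (t ^ 6) powi (3 * n + 1)"
    using t by (simp add: power_int_add)
  then show "t ^ 6 * x ^ 3 * ((t ^ 9) ^ 2) powi n \<noteq> 1" unfolding e using N by metis
  have "x ^ 3 / t ^ 6 * (t ^ 6) powi (3 * n) = x ^ 3 * (t ^ 6) powi (3 * n - 1)"
    using t by (simp add: power_int_diff)
  then show "x ^ 3 / t ^ 6 * ((t ^ 9) ^ 2) powi n \<noteq> 1" unfolding e using N by metis
  show "x * (t ^ 2) powi n \<noteq> 1"
  proof
    assume "x * (t ^ 2) powi n = 1"
    then have "(x * (t ^ 2) powi n) ^ 3 = 1" by simp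
    moreover have "((t ^ 2) powi n) ^ 3 = (t ^ 6) powi n"
    proof -
      have "((t ^ 2) powi n) ^ 3 = ((t ^ 2) powi n) powi 3" by simp
      also have "\<dots> = (t ^ 2) powi (n * 3)" by (rule power_int_mult[symmetric])
      also have "\<dots> = ((t ^ 2) powi 3) powi n" by (subst mult.commute) (rule power_int_mult)
      finally show ?thesis by (simp flip: power_mult)
    qed
    ultimately show False using N[of n] by (simp add: power_mult_distrib)
  qed
qed

private lemma cube_theta_shift: "x \<noteq> 0 \<Longrightarrow> cube_theta (t ^ 2 * x) = - cube_theta x / x ^ 3"
proof -
  assume x: "x \<noteq> 0"
  have "- ((t ^ 2 * x) ^ 3) / t ^ 3 = (t ^ 3) ^ 2 * (- (x ^ 3) / t ^ 3)" by (simp add: power_mult_distrib flip: power_mult)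
  then show ?thesis using jac_shift[of "t ^ 3" "- (x ^ 3) / t ^ 3"] t x by (simp add: cube_theta_def)
qed

private lemma cube_theta_analytic: "x \<noteq> 0 \<Longrightarrow> cube_theta analytic_on {x}"
  unfolding cube_theta_def[abs_def] using t t_powers by (intro analytic_intros) auto

lemma appell9_shift:
  assumes "z \<noteq> 0" "\<And>n. z * ((t ^ 9) ^ 2) powi n \<noteq> 1"
  shows "appell9 (t ^ 18 * z) = - (t ^ 9) * z ^ 2 * appell9 z + (1 - t ^ 9 * z)"
  using appell_shift[OF t9_props(1,2) assms] psi_nz(2) by (simp add: appell9_def t9_props(3) add_divide_distrib diff_divide_distrib)

lemma appell9_analytic:
  assumes "z \<noteq> 0" "\<And>n. z * ((t ^ 9) ^ 2) powi n \<noteq> 1"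
  shows "appell9 analytic_on {z}"
  unfolding appell9_def[abs_def] using appell_on_analytic[OF t9_props(1,2) assms(1), of UNIV] assms(2) psi_nz
  by (intro analytic_intros) auto

lemma appell9_analytic_comp:
  assumes "g analytic_on {z}" "g z \<noteq> 0" "\<And>n. g z * ((t ^ 9) ^ 2) powi n \<noteq> 1"
  shows "(\<lambda>z. appell9 (g z)) analytic_on {z}"
proof -
  have "appell9 analytic_on (g ` {z})" using appell9_analytic[OF assms(2,3)] by simp
  from analytic_on_compose[OF assms(1) this] show ?thesis by (simp only: o_def)
qed

text \<open>The substitution \<open>x \<mapsto> t ^ 2 * x\<close> multiplies \<open>x ^ 3\<close> by
  \<open>t ^ 6\<close> and moves the arguments \<open>x ^ 3 / t ^ 6\<close>, \<open>x ^ 3\<close>,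
  \<open>t ^ 6 * x ^ 3\<close> one place on. The last becomes \<open>t ^ 18\<close> times the first,
  where \<open>appell9_shift\<close> applies.\<close>

private lemma main_terms_shift:
  assumes x: "x \<noteq> 0" and Z: "cube_theta x \<noteq> 0"
  shows "main_terms (t ^ 2 * x) = - t * x ^ 2 * main_terms x + (1 - t * x)"
proof -
  note N = nonpoles[OF x Z]
  have 1: "appell9 (t ^ 6 * (t ^ 2 * x) ^ 3) = - (t ^ 9) * (x ^ 3 / t ^ 6) ^ 2 * appell9 (x ^ 3 / t ^ 6) + (1 - t ^ 9 * (x ^ 3 / t ^ 6))"
  proof -
    have "t ^ 6 * (t ^ 2 * x) ^ 3 = t ^ 18 * (x ^ 3 / t ^ 6)"
      using t by (simp add: power_mult_distrib field_simps flip: power_mult power_add)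
    then show ?thesis using appell9_shift[of "x ^ 3 / t ^ 6"] N(4) x t by simp
  qed
  have 2: "(t ^ 2 * x) ^ 3 = t ^ 6 * x ^ 3" by (simp add: power_mult_distrib flip: power_mult)
  have 3: "t ^ 6 * x ^ 3 / t ^ 6 = x ^ 3" using t by simp
  define a where "a = appell9 (x ^ 3 / t ^ 6)"
  define b where "b = appell9 (t ^ 6 * x ^ 3)"
  define c where "c = appell9 (x ^ 3)"
  have "main_terms (t ^ 2 * x) = (- (t ^ 9) * (x ^ 3 / t ^ 6) ^ 2 * a + (1 - t ^ 9 * (x ^ 3 / t ^ 6)) - 1) / (t ^ 2 * x)
      - t ^ 2 * x * b / t + t ^ 6 * x ^ 3 * c / t ^ 6 + 1"
    unfolding main_terms_def 1 unfolding 2 3 a_def b_def c_def by simp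
  also have "\<dots> = - t * x ^ 2 * ((b - 1) / x - x * c / t + x ^ 3 * a / t ^ 6 + 1) + (1 - t * x)"
    using t x by (simp add: field_simps) (simp add: algebra_simps eval_nat_numeral)
  finally show ?thesis by (simp only: main_terms_def a_def b_def c_def)
qed

private lemma theta_part_shift:
  assumes x: "x \<noteq> 0" and Z: "cube_theta x \<noteq> 0"
  shows "theta_part (t ^ 2 * x) = - t * x ^ 2 * theta_part x"
  unfolding theta_part_def cube_theta_shift[OF x] jac_shift[OF t(1) x] using t x Z
  by (simp add: field_simps) (simp add: power2_eq_square power3_eq_cube)

private lemma defect_shift:
  assumes x: "x \<noteq> 0" and Z: "cube_theta x \<noteq> 0"
  shows "defect (t ^ 2 * x) = - t * x ^ 2 * defect x"
proof -
  have "appell t (t ^ 2 * x) / psi t = - t * x ^ 2 * (appell t x / psi t) + (1 - t * x)"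
    using appell_shift[OF t x nonpoles(1)[OF x Z]] psi_nz(1) by (simp add: add_divide_distrib diff_divide_distrib)
  moreover have "- t * x ^ 2 * A + K - (- t * x ^ 2 * B + K) - (- t * x ^ 2 * C) = - t * x ^ 2 * (A - B - C)" for A B C K
    by (simp add: algebra_simps)
  ultimately show ?thesis by (simp only: defect_def main_terms_shift[OF x Z] theta_part_shift[OF x Z])
qed

private lemma defect_analytic:
  assumes x: "x \<noteq> 0" and Z: "cube_theta x \<noteq> 0"
  shows "defect analytic_on {x}"
proof -
  note N = nonpoles[OF x Z]
  have "(\<lambda>x. appell9 (t ^ 6 * x ^ 3)) analytic_on {x}" "(\<lambda>x. appell9 (x ^ 3)) analytic_on {x}" "(\<lambda>x. appell9 (x ^ 3 / t ^ 6)) analytic_on {x}"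
    using N x t by (intro appell9_analytic_comp analytic_intros; simp)+
  moreover have "(\<lambda>x. appell t x) analytic_on {x}" by (intro appell_on_analytic[OF t x]) (use N in auto)
  ultimately show ?thesis
    unfolding defect_def[abs_def] main_terms_def[abs_def] theta_part_def[abs_def]
    using x Z t psi_nz cube_theta_analytic[OF x] t_powers by (intro analytic_intros) auto
qed

private lemma cube_theta_discrete: "x \<noteq> 0 \<Longrightarrow> \<forall>\<^sub>F y in at x. cube_theta y \<noteq> 0"
proof (rule eventually_analytic_nonzero[where w = "- 1", OF cube_theta_analytic])
  have "t ^ 6 * - 1 = - (t ^ 6)" by simp
  then show "cube_theta (- 1) \<noteq> 0" using cube_theta_eq(1)[of "- 1"] t_powers by (simp add: cube_cofactor_def qp_nonzero)
qed auto

private lemma cube_theta_annulus: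
  assumes "cube_theta s = 0" "norm (t ^ 2) < norm s" "norm s \<le> 1"
  shows "s ^ 3 = 1"
proof -
  have s: "s \<noteq> 0" using assms(2) by auto
  have "norm (t ^ 2) ^ 3 < norm s ^ 3" using assms(2) by (intro power_strict_mono) auto
  then have 1: "norm (t ^ 6 / s ^ 3) < 1" using s by (simp add: norm_divide norm_power flip: power_mult)
  have 2: "norm (t ^ 6 * s ^ 3) < 1"
    using t_powers(3) assms(3) norm_mult_less_of_le_1[of "s ^ 3" "t ^ 6" 1] by (simp add: norm_power power_le_one mult.commute)
  have "cube_cofactor (s ^ 3) \<noteq> 0" unfolding cube_cofactor_def using 1 2 t_powers by (simp add: qp_nonzero)
  then show ?thesis using assms(1) unfolding cube_theta_eq(1)[OF s] by simp
qed

section \<open>Cancellation of the poles at the cube roots of unity\<close>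

lemma appell9_split:
  assumes "x \<noteq> 0" "cube_theta x \<noteq> 0"
  shows "(1 - x ^ 3) * appell9 (x ^ 3) = (1 + (1 - x ^ 3) * appell_on (t ^ 9) (x ^ 3) (- {0})) / psi (t ^ 9)"
proof -
  have "x ^ 3 \<noteq> 1" using cube_theta_eq(1)[OF assms(1)] assms(2) by auto
  moreover have "appell (t ^ 9) (x ^ 3) = 1 / (1 - x ^ 3) + appell_on (t ^ 9) (x ^ 3) (- {0})"
    using nonpoles[OF assms] assms by (intro appell_split[OF t9_props(1,2)]) auto
  ultimately have "(1 - x ^ 3) * appell (t ^ 9) (x ^ 3) = 1 + (1 - x ^ 3) * appell_on (t ^ 9) (x ^ 3) (- {0})"
    by (simp add: algebra_simps)
  then show ?thesis by (simp add: appell9_def)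
qed

private definition "main_regular x = (appell9 (t ^ 6 * x ^ 3) - 1) / x + x ^ 3 * appell9 (x ^ 3 / t ^ 6) / t ^ 6 + 1"
text \<open>The coefficient of \<open>x / (1 - x ^ 3)\<close> in
  \<open>main_terms x + theta_part x\<close>, joining the theta quotient with the term
  \<open>n = 0\<close> of the middle Appell sum.\<close>

private definition "polar_coeff x = theta_coeff * jac t x / cube_cofactor (x ^ 3) - 1 / (t * psi (t ^ 9))"
private definition "punctured_part x = appell_on (t ^ 9) (x ^ 3) (- {0}) / (t * psi (t ^ 9))"

private lemma main_plus_theta:
  assumes "x \<noteq> 0" "cube_theta x \<noteq> 0"
  shows "main_terms x + theta_part x = main_regular x + x * (polar_coeff x / (1 - x ^ 3)) - x * punctured_part x"
proof -
  have x1: "1 - x ^ 3 \<noteq> 0" "cube_cofactor (x ^ 3) \<noteq> 0" using cube_theta_eq(1)[OF assms(1)] assms(2) by auto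
  have "appell9 (x ^ 3) = (1 / (1 - x ^ 3) + appell_on (t ^ 9) (x ^ 3) (- {0})) / psi (t ^ 9)"
    using appell9_split[OF assms] x1(1) psi_nz(2) by (simp add: field_simps)
  moreover have "theta_part x = x * (theta_coeff * jac t x / cube_cofactor (x ^ 3)) / (1 - x ^ 3)"
    unfolding theta_part_def cube_theta_eq(1)[OF assms(1)] by (simp add: mult_ac)
  ultimately have "theta_part x - x * appell9 (x ^ 3) / t = x * (polar_coeff x / (1 - x ^ 3)) - x * punctured_part x"
  proof -
    have "x * G / u - x * ((1 / u + a) / p) / t = x * ((G - 1 / (t * p)) / u) - x * (a / (t * p))"
      if "u \<noteq> 0" "p \<noteq> 0" for x G u a p :: complex
      using that t by (simp add: field_simps)
    moreover assume "appell9 (x ^ 3) = (1 / (1 - x ^ 3) + appell_on (t ^ 9) (x ^ 3) (- {0})) / psi (t ^ 9)"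
      "theta_part x = x * (theta_coeff * jac t x / cube_cofactor (x ^ 3)) / (1 - x ^ 3)"
    ultimately show ?thesis unfolding polar_coeff_def punctured_part_def using psi_nz(2) x1(1) by (simp only: not_False_eq_True)
  qed
  then show ?thesis by (simp add: main_terms_def main_regular_def algebra_simps)
qed

text \<open>The exponents of \<open>t ^ 6\<close> that occur in the first two cases are
  \<open>3 * n + 1\<close> and \<open>3 * n - 1\<close>, never 0. So the two outer Appell sums are
  regular at every cube root of unity.\<close>

lemma cube_root_nonpoles:
  assumes s: "s ^ 3 = 1"
  shows "t ^ 6 * s ^ 3 * ((t ^ 9) ^ 2) powi n \<noteq> 1" "s ^ 3 / t ^ 6 * ((t ^ 9) ^ 2) powi n \<noteq> 1"
    "n \<noteq> 0 \<Longrightarrow> s ^ 3 * ((t ^ 9) ^ 2) powi n \<noteq> 1" "s \<noteq> 1 \<Longrightarrow> s * (t ^ 2) powi n \<noteq> 1"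
proof -
  have t3: "t ^ 3 \<noteq> 0" "norm (t ^ 3) < 1" using t t_powers by auto
  have P: "(t ^ 6) powi m \<noteq> 1" if "m \<noteq> 0" for m
    using q2_powi_ne_1[OF t3 that] by (simp flip: power_mult)
  have e: "((t ^ 9) ^ 2) powi n = (t ^ 6) powi (3 * n)"
    using power_int_mult[of "t ^ 6" 3 n] by (simp flip: power_mult)
  have "t ^ 6 * (t ^ 6) powi (3 * n) = (t ^ 6) powi (3 * n + 1)" "(t ^ 6) powi (3 * n) / t ^ 6 = (t ^ 6) powi (3 * n - 1)"
    using t by (simp_all add: power_int_add power_int_diff)
  moreover have "3 * n + 1 \<noteq> 0" "3 * n - 1 \<noteq> 0" by presburger+
  ultimately show "t ^ 6 * s ^ 3 * ((t ^ 9) ^ 2) powi n \<noteq> 1" "s ^ 3 / t ^ 6 * ((t ^ 9) ^ 2) powi n \<noteq> 1"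
    unfolding e s using P by simp_all
  show "s ^ 3 * ((t ^ 9) ^ 2) powi n \<noteq> 1" if "n \<noteq> 0" unfolding e s using P that by simp
  show "s * (t ^ 2) powi n \<noteq> 1" if "s \<noteq> 1"
  proof (cases "n = 0")
    case True then show ?thesis using that by simp
  next
    case False
    show ?thesis
    proof
      assume a: "s * (t ^ 2) powi n = 1"
      have "((t ^ 2) powi n) ^ 3 = (t ^ 6) powi n"
      proof -
        have "((t ^ 2) powi n) ^ 3 = ((t ^ 2) powi n) powi 3" by simp
        also have "\<dots> = (t ^ 2) powi (n * 3)" by (rule power_int_mult[symmetric])
        also have "\<dots> = ((t ^ 2) powi 3) powi n" by (subst mult.commute) (rule power_int_mult)
        finally show ?thesis by (simp flip: power_mult)
      qed
      moreover have "s ^ 3 * ((t ^ 2) powi n) ^ 3 = 1" using a by (metis power_mult_distrib power_one)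
      ultimately show False using s P[OF False] by simp
    qed
  qed
qed

private lemma cube_root_lims:
  assumes s: "s ^ 3 = 1"
  shows "main_regular analytic_on {s}" "punctured_part analytic_on {s}" "polar_coeff analytic_on {s}" "cube_cofactor 1 = qp (t ^ 6) (t ^ 6) ^ 3"
proof -
  have s0: "s \<noteq> 0" using s by auto
  note N = cube_root_nonpoles[OF s]
  have "(\<lambda>x. appell9 (t ^ 6 * x ^ 3)) analytic_on {s}" "(\<lambda>x. appell9 (x ^ 3 / t ^ 6)) analytic_on {s}"
    using N s0 t by (intro appell9_analytic_comp analytic_intros; simp)+
  then show "main_regular analytic_on {s}" unfolding main_regular_def[abs_def] using s0 t by (intro analytic_intros) auto
  have "(\<lambda>x. appell_on (t ^ 9) x (- {0})) analytic_on {s ^ 3}"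
    unfolding s by (rule appell_on_punctured_analytic[OF t9_props(1,2)])
  then have "(\<lambda>x. appell_on (t ^ 9) x (- {0})) analytic_on ((\<lambda>x. x ^ 3) ` {s})" by simp
  from analytic_on_compose[OF _ this] have "(\<lambda>x. appell_on (t ^ 9) (x ^ 3) (- {0})) analytic_on {s}"
    by (simp add: o_def analytic_intros)
  then show "punctured_part analytic_on {s}" unfolding punctured_part_def[abs_def] using t psi_nz by (intro analytic_intros) auto
  show h1: "cube_cofactor 1 = qp (t ^ 6) (t ^ 6) ^ 3" by (simp add: cube_cofactor_def power3_eq_cube)
  have "cube_cofactor (s ^ 3) \<noteq> 0" unfolding s h1 using psi_nz by simp
  moreover have "(\<lambda>x. cube_cofactor (x ^ 3)) analytic_on {s}"
    unfolding cube_cofactor_def using s0 t_powers by (intro analytic_intros) auto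
  ultimately show "polar_coeff analytic_on {s}"
    unfolding polar_coeff_def[abs_def] using s0 t psi_nz by (intro analytic_intros) auto
qed

lemma analytic_LIM: "f analytic_on {s} \<Longrightarrow> f \<midarrow>s\<rightarrow> f s"
  by (rule isContD[OF analytic_at_imp_isCont])

text \<open>At a primitive cube root \<open>appell t\<close> is regular and
  \<open>polar_coeff\<close> vanishes. At 1 the left side contributes \<open>- 1 / psi t\<close>,
  and \<open>polar_coeff 1 * psi t = 3\<close> because the theta values at 1 and \<open>w\<close>
  differ by \<open>3 * theta1 t 1\<close>.\<close>

private lemma defect_residue:
  assumes s: "s ^ 3 = 1"
  shows "((\<lambda>x. (x - s) * defect x) \<longlongrightarrow> 0) (at s)"
proof -
  have s0: "s \<noteq> 0" using s by auto
  note lims = cube_root_lims(1-3)[OF s, THEN analytic_LIM]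
  have quint_sum: "3 * s ^ 2 \<noteq> 0" using s0 by simp
  define K where "K = (if s = 1 then - 1 / psi t else 0)"
  have a: "((\<lambda>x. (x - s) * (appell t x / psi t)) \<longlongrightarrow> K) (at s)"
  proof (cases "s = 1")
    case True
    have ac: "(\<lambda>x. appell_on t x (- {0})) \<midarrow>1\<rightarrow> appell_on t 1 (- {0})"
      by (rule analytic_LIM[OF appell_on_punctured_analytic[OF t]])
    have "(\<lambda>x. (- 1 + (x - 1) * appell_on t x (- {0})) / psi t) \<midarrow>1\<rightarrow> (- 1 + (1 - 1) * appell_on t 1 (- {0})) / psi t"
      using psi_nz by (intro tendsto_intros ac)
    then have "(\<lambda>x. (- 1 + (x - 1) * appell_on t x (- {0})) / psi t) \<midarrow>1\<rightarrow> K" using True by (simp add: K_def)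
    moreover have "\<forall>\<^sub>F x in at 1. (- 1 + (x - 1) * appell_on t x (- {0})) / psi t = (x - 1) * (appell t x / psi t)"
      using cube_theta_discrete[OF one_neq_zero] eventually_neq_at_within[of "0::complex" 1 UNIV] eventually_neq_at_within[of "1::complex" 1 UNIV]
    proof eventually_elim
      case (elim x)
      have "appell t x = 1 / (1 - x) + appell_on t x (- {0})"
        using nonpoles(1)[OF elim(2,1)] elim by (intro appell_split[OF t]) auto
      then have "(x - 1) * appell t x = - 1 + (x - 1) * appell_on t x (- {0})" using elim by (simp add: field_simps)
      then show ?case by simp
    qed
    ultimately show ?thesis unfolding True by (rule Lim_transform_eventually)
  next
    case False
    have "(\<lambda>x. appell t x) analytic_on {s}"
      using cube_root_nonpoles(4)[OF s False] by (intro appell_on_analytic[OF t s0]) auto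
    then have "(\<lambda>x. (x - s) * (appell t x / psi t)) \<midarrow>s\<rightarrow> (s - s) * (appell t s / psi t)"
      using psi_nz by (intro tendsto_intros analytic_LIM)
    then show ?thesis using False by (simp add: K_def)
  qed
  \<comment> \<open>Since \<open>s ^ 3 = 1\<close>, the factor \<open>x - s\<close> cancels against
    \<open>1 - x ^ 3\<close> and leaves \<open>- (x ^ 2 + x * s + s ^ 2)\<close>, with value
    \<open>- (3 * s ^ 2)\<close> at \<open>s\<close>.\<close>
  have "(\<lambda>x. (x - s) * main_regular x + x * polar_coeff x * (- 1 / (x ^ 2 + x * s + s ^ 2)) - (x - s) * (x * punctured_part x)) \<midarrow>s\<rightarrow>
      (s - s) * main_regular s + s * polar_coeff s * (- 1 / (s ^ 2 + s * s + s ^ 2)) - (s - s) * (s * punctured_part s)"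
    using quint_sum by (intro tendsto_intros lims) (auto simp: power2_eq_square)
  also have "(s - s) * main_regular s + s * polar_coeff s * (- 1 / (s ^ 2 + s * s + s ^ 2)) - (s - s) * (s * punctured_part s) = - (s * polar_coeff s / (3 * s ^ 2))"
    by (simp add: power2_eq_square)
  also have "- (s * polar_coeff s / (3 * s ^ 2)) = K"
  proof (cases "s = 1")
    case True
    have "jac t 1 = jac t w + 3 * theta1 t 1" by (rule jac_values(3)[OF t w])
    moreover have "theta1 t 1 * psi t = t * psi (t ^ 9) * jac t w"
      unfolding jac_values(1,2)[OF t w] by simp
    ultimately have "(jac t 1 - jac t w) * psi t = 3 * (t * psi (t ^ 9) * jac t w)" by (simp add: algebra_simps)
    moreover have "polar_coeff 1 = (jac t 1 - jac t w) / (t * psi (t ^ 9) * jac t w)"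
      using cube_root_lims(4)[of 1] psi_nz t by (simp add: polar_coeff_def theta_coeff_def diff_divide_distrib)
    ultimately have "polar_coeff 1 * psi t = 3 * (t * psi (t ^ 9) * jac t w) / (t * psi (t ^ 9) * jac t w)"
      by (simp only: times_divide_eq_left)
    then have "polar_coeff 1 * psi t = 3" using psi_nz t by simp
    then show ?thesis using True psi_nz by (simp add: K_def field_simps)
  next
    case False
    \<comment> \<open>Such an \<open>s\<close> is itself a primitive cube root, so
      \<open>jac t s = jac t w\<close> by the same product formula.\<close>
    have "(s - 1) * (1 + s + s ^ 2) = 0" using s by (simp add: algebra_simps power2_eq_square power3_eq_cube)
    then have ss: "1 + s + s ^ 2 = 0" using False by simp
    have "jac t s = jac t w" using jac_values(1)[OF t ss] jac_values(1)[OF t w] by simp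
    then have "polar_coeff s = 0" using s cube_root_lims(4)[OF s] psi_nz t by (simp add: polar_coeff_def theta_coeff_def)
    then show ?thesis using False by (simp add: K_def)
  qed
  finally have b: "(\<lambda>x. (x - s) * main_regular x + x * polar_coeff x * (- 1 / (x ^ 2 + x * s + s ^ 2)) - (x - s) * (x * punctured_part x)) \<midarrow>s\<rightarrow> K" .
  have "(\<lambda>x. (x - s) * (appell t x / psi t) - ((x - s) * main_regular x + x * polar_coeff x * (- 1 / (x ^ 2 + x * s + s ^ 2)) - (x - s) * (x * punctured_part x))) \<midarrow>s\<rightarrow> K - K"
    by (intro tendsto_diff a b)
  then have "(\<lambda>x. (x - s) * (appell t x / psi t) - ((x - s) * main_regular x + x * polar_coeff x * (- 1 / (x ^ 2 + x * s + s ^ 2)) - (x - s) * (x * punctured_part x))) \<midarrow>s\<rightarrow> 0"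
    by simp
  moreover have "\<forall>\<^sub>F x in at s. (x - s) * (appell t x / psi t) - ((x - s) * main_regular x + x * polar_coeff x * (- 1 / (x ^ 2 + x * s + s ^ 2)) - (x - s) * (x * punctured_part x)) = (x - s) * defect x"
    using cube_theta_discrete[OF s0] eventually_neq_at_within[of "0::complex" s UNIV]
  proof eventually_elim
    case (elim x)
    have x1: "1 - x ^ 3 \<noteq> 0" using cube_theta_eq(1)[OF elim(2)] elim(1) by auto
    have e: "1 - x ^ 3 = - ((x - s) * (x ^ 2 + x * s + s ^ 2))"
      using s by (simp add: algebra_simps power2_eq_square power3_eq_cube)
    have "a / - (a * b) = - 1 / b" if "- (a * b) \<noteq> 0" for a b :: complex
      using that by simp
    from this[OF x1[unfolded e]] have q: "- 1 / (x ^ 2 + x * s + s ^ 2) = (x - s) / (1 - x ^ 3)"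
      by (simp only: e)
    have gen: "(x - s) * a - ((x - s) * R + x * g * ((x - s) / u) - (x - s) * (x * A))
        = (x - s) * (a - (R + x * (g / u) - x * A))" for a R g u A
      by (simp add: algebra_simps divide_inverse)
    have D: "defect x = appell t x / psi t - (main_terms x + theta_part x)" by (simp add: defect_def)
    show ?case unfolding q D main_plus_theta[OF elim(2,1)] by (rule gen)
  qed
  ultimately show ?thesis by (rule Lim_transform_eventually)
qed

private lemma defect_zero:
  assumes x: "x \<noteq> 0" "norm x < 1 / norm (t ^ 2)" "cube_theta x \<noteq> 0"
  shows "defect x = 0"
proof (rule qshift_zero[where p = "t ^ 2" and D = defect and S = "{x. cube_theta x = 0}" and k = 2 and \<mu> = "- t" and z = x])
  show "defect analytic_on {z}" if "z \<noteq> 0" "z \<notin> {x. cube_theta x = 0}" for z using that defect_analytic by auto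
  show "\<forall>\<^sub>F x in at z. x \<notin> {x. cube_theta x = 0}" if "z \<noteq> 0" for z using cube_theta_discrete[OF that] by simp
  show "t ^ 2 * z \<in> {x. cube_theta x = 0} \<longleftrightarrow> z \<in> {x. cube_theta x = 0}" if "z \<noteq> 0" for z using cube_theta_shift[OF that] that by simp
  show "defect (t ^ 2 * z) = - t * z ^ 2 * defect z" if "z \<noteq> 0" "z \<notin> {x. cube_theta x = 0}" for z
    using defect_shift that by auto
  show "((\<lambda>z. (z - s) * defect z) \<longlongrightarrow> 0) (at s)" if "s \<in> {x. cube_theta x = 0}" "norm (t ^ 2) < norm s" "norm s \<le> 1" for s
    using cube_theta_annulus[of s] that by (intro defect_residue) auto
qed (use x t t_powers in auto)

text \<open>\<open>cube_cofactor\<close> is invariant under inversion and has derivative 0 at 1, so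
  only \<open>jac t\<close> contributes. In the trisection of \<open>jac t (w * y)\<close> at
  \<open>y = 1\<close>, class 0 is invariant as well, and the other classes give
  \<open>(w - w ^ 2) * d\<close>.\<close>

private lemma polar_coeff_deriv:
  assumes d: "(theta1 t has_field_derivative d) (at 1)"
  shows "(polar_coeff has_field_derivative ((1 - w) * d / (t * psi (t ^ 9) * jac t w))) (at w)" "polar_coeff w = 0"
proof -
  note wp = cube_root_props[OF w]
  define H where "H = qp (t ^ 6) (t ^ 6) ^ 3"
  have H: "H \<noteq> 0" "cube_cofactor 1 = H" using psi_nz cube_root_lims(4)[OF wp(1)] by (auto simp: H_def)
  have "cube_cofactor field_differentiable at 1"
  proof -
    have "cube_cofactor analytic_on {1}" unfolding cube_cofactor_def[abs_def] using t_powers by (intro analytic_intros) auto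
    then show ?thesis using analytic_on_imp_differentiable_at by blast
  qed
  then obtain h' where h': "(cube_cofactor has_field_derivative h') (at 1)" by (auto simp: field_differentiable_def)
  have "h' = 0" by (rule deriv_zero_of_symmetric(2)[OF h']) (simp add: cube_cofactor_def mult_ac)
  then have "(cube_cofactor has_field_derivative 0) (at (w ^ 3))" using h' wp by simp
  moreover have "((\<lambda>x. x ^ 3) has_field_derivative (3 * w ^ 2)) (at w)" by (auto intro!: derivative_eq_intros)
  ultimately have hd: "((\<lambda>x. cube_cofactor (x ^ 3)) has_field_derivative 0 * (3 * w ^ 2)) (at w)"
    by (rule DERIV_chain2)
  have t0: "((\<lambda>y. jac (t ^ 9) (y ^ 3)) has_field_derivative 0) (at 1)"
  proof -
    have "(\<lambda>y. jac (t ^ 9) (y ^ 3)) analytic_on {1}" using t9_props by (intro analytic_intros) auto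
    then have "(\<lambda>y. jac (t ^ 9) (y ^ 3)) field_differentiable at 1" using analytic_on_imp_differentiable_at by blast
    then obtain e where e: "((\<lambda>y. jac (t ^ 9) (y ^ 3)) has_field_derivative e) (at 1)" by (auto simp: field_differentiable_def)
    have "e = 0" by (rule deriv_zero_of_symmetric(2)[OF e]) (simp only: power_one_over jac_inverse)
    then show ?thesis using e by simp
  qed
  have "(jac t has_field_derivative (1 - w) * d) (at w)"
  proof -
    have th: "theta1 t (w * y) = w * theta1 t y" "theta1 t (w ^ 2 * y) = w ^ 2 * theta1 t y" for y
    proof -
      have "w ^ 6 = 1" using wp(1) power_mult[of w 3 2] by simp
      then show "theta1 t (w * y) = w * theta1 t y" "theta1 t (w ^ 2 * y) = w ^ 2 * theta1 t y"
        using wp(1) by (simp_all add: theta1_def power_mult_distrib flip: power_mult)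
    qed
    have "jac t (w * y) = jac (t ^ 9) (y ^ 3) + w * theta1 t y + w ^ 2 * theta1 t (1 / y)" if "y \<noteq> 0" for y
    proof -
      have "1 / (w * y) = w ^ 2 * (1 / y)" using wp(4) by (metis divide_divide_eq_left times_divide_eq_right mult.right_neutral)
      then have "theta1 t (1 / (w * y)) = w ^ 2 * theta1 t (1 / y)" by (simp only: th)
      then show ?thesis using jac_trisect[OF t, of "w * y"] wp that th by (simp add: power_mult_distrib)
    qed
    then have ev: "\<forall>\<^sub>F y in nhds 1. jac t (w * y) = jac (t ^ 9) (y ^ 3) + w * theta1 t y + w ^ 2 * theta1 t (1 / y)"
      by (intro eventually_mono[OF t1_space_nhds[of 1 "0::complex"]]) auto
    have "((\<lambda>y. jac (t ^ 9) (y ^ 3) + w * theta1 t y + w ^ 2 * theta1 t (1 / y)) has_field_derivative (0 + w * d + w ^ 2 * - d)) (at 1)"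
      by (intro DERIV_add t0 DERIV_cmult d deriv_zero_of_symmetric(1)[OF d])
    then have "((\<lambda>y. jac t (w * y)) has_field_derivative (0 + w * d + w ^ 2 * - d)) (at 1)"
      using iffD2[OF DERIV_cong_ev[OF refl ev refl]] by blast
    moreover have "(jac t has_field_derivative deriv (jac t) w) (at w)"
      using jac_analytic[OF t(2) wp(2)] analytic_on_imp_differentiable_at DERIV_deriv_iff_field_differentiable by blast
    then have "((\<lambda>y. jac t (w * y)) has_field_derivative deriv (jac t) w * w) (at 1)"
      using DERIV_chain2[of "jac t" "deriv (jac t) w" "\<lambda>y. w * y" 1 w UNIV] by (auto intro!: derivative_eq_intros)
    ultimately have "deriv (jac t) w * w = 0 + w * d + w ^ 2 * - d" using DERIV_unique by blast
    then have "w * deriv (jac t) w = w * ((1 - w) * d)" by (simp add: algebra_simps power2_eq_square)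
    then have "deriv (jac t) w = (1 - w) * d" using wp(2) by simp
    then show ?thesis using \<open>(jac t has_field_derivative deriv (jac t) w) (at w)\<close> by simp
  qed
  then have "((\<lambda>x. theta_coeff * jac t x / cube_cofactor (x ^ 3) - 1 / (t * psi (t ^ 9))) has_field_derivative
     ((theta_coeff * ((1 - w) * d) * cube_cofactor (w ^ 3) - theta_coeff * jac t w * (0 * (3 * w ^ 2))) / (cube_cofactor (w ^ 3) * cube_cofactor (w ^ 3)) - 0)) (at w)"
    using H wp by (intro DERIV_diff DERIV_divide DERIV_cmult hd DERIV_const) auto
  moreover have "(theta_coeff * ((1 - w) * d) * cube_cofactor (w ^ 3) - theta_coeff * jac t w * (0 * (3 * w ^ 2))) / (cube_cofactor (w ^ 3) * cube_cofactor (w ^ 3)) - 0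
     = (1 - w) * d / (t * psi (t ^ 9) * jac t w)"
    using H wp psi_nz t by (simp add: theta_coeff_def H_def[symmetric])
  ultimately show "(polar_coeff has_field_derivative ((1 - w) * d / (t * psi (t ^ 9) * jac t w))) (at w)"
    by (simp only: polar_coeff_def[abs_def])
  show "polar_coeff w = 0" using H wp psi_nz t by (simp add: polar_coeff_def theta_coeff_def H_def[symmetric])
qed

text \<open>Three further facts simplify the limit. The punctured middle sum vanishes at 1;
  inversion merges the two outer Appell sums into one; and
  \<open>(1 - w) * (w ^ 2 - 1) = - 3\<close>.\<close>

theorem appell_at_cube_root:
  "(1 - w) * appell t w / psi t = - 3 * (appell9 (t ^ 6) - 1) + psi (t ^ 3) ^ 3 / (psi t * psi (t ^ 9))"
proof -
  note wp = cube_root_props[OF w]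
  have "theta1 t analytic_on {1}" unfolding theta1_def[abs_def] using t t_powers by (intro analytic_intros) auto
  then obtain d where d: "(theta1 t has_field_derivative d) (at 1)"
    using analytic_on_imp_differentiable_at by (metis field_differentiable_def insertI1)
  define e where "e = (1 - w) * d / (t * psi (t ^ 9) * jac t w)"
  have dv: "d = theta1 t 1 * psi (t ^ 3) ^ 3 / psi (t ^ 9)" by (rule theta1_deriv[OF t w d])
  \<comment> \<open>As \<open>polar_coeff w = 0\<close>, this is a difference quotient.\<close>
  have g: "(\<lambda>x. polar_coeff x / (x - w)) \<midarrow>w\<rightarrow> e"
    using polar_coeff_deriv[OF d] unfolding e_def has_field_derivative_iff by simp
  note lims = cube_root_lims(1-3)[OF wp(1), THEN analytic_LIM]
  have w3: "w ^ 2 + w * w + w ^ 2 = 3 * w ^ 2" "3 * w ^ 2 \<noteq> 0" using wp(2) by (auto simp: power2_eq_square)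
  have 1: "(\<lambda>x. main_regular x + x * (polar_coeff x / (x - w) * (- 1 / (x ^ 2 + x * w + w ^ 2))) - x * punctured_part x) \<midarrow>w\<rightarrow>
      main_regular w + w * (e * (- 1 / (w ^ 2 + w * w + w ^ 2))) - w * punctured_part w"
    using w3 by (intro tendsto_intros lims g) auto
  have "(\<lambda>x. appell t x) analytic_on {w}"
    using cube_root_nonpoles(4)[OF wp(1,3)] by (intro appell_on_analytic[OF t wp(2)]) auto
  then have 2: "(\<lambda>x. appell t x / psi t) \<midarrow>w\<rightarrow> appell t w / psi t"
    using psi_nz by (intro tendsto_intros analytic_LIM)
  have "\<forall>\<^sub>F x in at w. main_regular x + x * (polar_coeff x / (x - w) * (- 1 / (x ^ 2 + x * w + w ^ 2))) - x * punctured_part x = appell t x / psi t"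
  proof -
    have "1 < 1 / norm (t ^ 2)" using t_powers t by (simp only: less_divide_eq_1_pos zero_less_norm_iff power_eq_0_iff simp_thms)
    then have "\<forall>\<^sub>F x in nhds w. x \<in> ball 0 (1 / norm (t ^ 2))"
      using wp(6) by (intro eventually_nhds_in_open) auto
    then have "\<forall>\<^sub>F x in at w. x \<in> ball 0 (1 / norm (t ^ 2))" by (auto simp: eventually_at_filter elim: eventually_mono)
    then show ?thesis
      using cube_theta_discrete[OF wp(2)] eventually_neq_at_within[of "0::complex" w UNIV] eventually_neq_at_within[of w w UNIV]
    proof eventually_elim
      case (elim x)
      have "defect x = 0" using elim by (intro defect_zero) auto
      then have "appell t x / psi t = main_terms x + theta_part x" by (simp add: defect_def algebra_simps)
      also have "\<dots> = main_regular x + x * (polar_coeff x / (1 - x ^ 3)) - x * punctured_part x" by (rule main_plus_theta) (use elim in auto)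
      also have "1 - x ^ 3 = (x - w) * - (x ^ 2 + x * w + w ^ 2)"
        using wp(1) by (simp add: algebra_simps power2_eq_square power3_eq_cube)
      also have "polar_coeff x / ((x - w) * - (x ^ 2 + x * w + w ^ 2)) = polar_coeff x / (x - w) * (- 1 / (x ^ 2 + x * w + w ^ 2))"
      proof -
        have "g / (a * - b) = g / a * (- 1 / b)" for g a b :: complex by (simp add: divide_inverse)
        then show ?thesis by blast
      qed
      finally show ?case by simp
    qed
  qed
  from LIM_unique_eventually[OF 1 2 this]
  have v: "appell t w / psi t = main_regular w + w * (e * (- 1 / (3 * w ^ 2))) - w * punctured_part w" by (simp only: w3)
  have A: "punctured_part w = 0" unfolding punctured_part_def wp(1) using appell_on_1[OF t9_props(1,2)] by simp
  have f: "appell9 (1 / t ^ 6) = - (t ^ 6) * appell9 (t ^ 6)"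
    using appell_on_inverse[OF t9_props(1,2), of "t ^ 6" UNIV] t by (simp add: appell9_def)
  have R: "main_regular w = (appell9 (t ^ 6) - 1) * (w ^ 2 - 1)"
  proof -
    have "main_regular w = (appell9 (t ^ 6) - 1) * (1 / w) + appell9 (1 / t ^ 6) / t ^ 6 + 1" by (simp add: main_regular_def wp(1))
    also have "appell9 (1 / t ^ 6) / t ^ 6 = - appell9 (t ^ 6)" using f t by simp
    finally show ?thesis unfolding wp(4) by (simp add: algebra_simps)
  qed
  have m3: "(1 - w) * (w ^ 2 - 1) = - 3"
  proof -
    have "(1 - w) * (w ^ 2 - 1) = (1 + w + w ^ 2) - w ^ 3 - 2" by (simp add: algebra_simps power2_eq_square power3_eq_cube)
    then show ?thesis using w wp(1) by simp
  qed
  have w4: "(1 - w) * (w * (- 1 / (3 * w ^ 2)) * (1 - w)) = 1"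
  proof -
    have "(1 - w) * (1 - w) = (1 + w + w ^ 2) - 3 * w" by (simp add: algebra_simps power2_eq_square)
    then have "(1 - w) * (1 - w) = - 3 * w" using w by simp
    moreover have "(1 - w) * (w * (- 1 / (3 * w ^ 2)) * (1 - w)) = ((1 - w) * (1 - w)) * (w * (- 1 / (3 * w ^ 2)))" by (simp only: mult_ac)
    ultimately show ?thesis using wp(2) by (simp add: power2_eq_square)
  qed
  have "(1 - w) * (appell t w / psi t) = (1 - w) * (w ^ 2 - 1) * (appell9 (t ^ 6) - 1)
      + ((1 - w) * (w * (- 1 / (3 * w ^ 2)) * (1 - w))) * (d / (t * psi (t ^ 9) * jac t w))"
  proof -
    have "(1 - w) * (F * b + w * ((1 - w) * d / K * c) - w * 0) = (1 - w) * b * F + ((1 - w) * (w * c * (1 - w))) * (d / K)"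
      for F b c K by (simp add: algebra_simps divide_inverse)
    then show ?thesis unfolding v A R e_def by blast
  qed
  also have "\<dots> = - 3 * (appell9 (t ^ 6) - 1) + d / (t * psi (t ^ 9) * jac t w)" by (simp only: m3 w4 mult_1)
  also have "d / (t * psi (t ^ 9) * jac t w) = psi (t ^ 3) ^ 3 / (psi t * psi (t ^ 9))"
    unfolding dv jac_values(1,2)[OF t w] using psi_nz jac_values(5)[OF t w] t by simp
  finally show ?thesis by simp
qed

end

section \<open>Partitions without repeated odd parts\<close>

definition no_rep_upto :: "nat \<Rightarrow> nat multiset set" where
  "no_rep_upto m = {p. set_mset p \<subseteq> {1..m} \<and> (\<forall>k. odd k \<longrightarrow> count p k \<le> 1)}"

definition weight :: "complex \<Rightarrow> complex \<Rightarrow> nat multiset \<Rightarrow> complex" where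
  "weight z q p = z ^ size p * q ^ sum_mset p"

lemma weight_union: "weight z q (p + r) = weight z q p * weight z q r"
  by (simp add: weight_def power_add mult_ac)

lemma weight_replicate: "weight z q (replicate_mset j m) = (z * q ^ m) ^ j"
  by (simp add: weight_def power_mult_distrib mult.commute flip: power_mult)

definition multiplicities :: "nat \<Rightarrow> nat set" where
  "multiplicities m = (if odd m then {0, 1} else UNIV)"

lemma no_rep_upto_0: "no_rep_upto 0 = {{#}}"
  by (auto simp: no_rep_upto_def)

lemma no_rep_upto_Suc_bij:
  "bij_betw (\<lambda>(p, j). p + replicate_mset j (Suc m)) (no_rep_upto m \<times> multiplicities (Suc m)) (no_rep_upto (Suc m))"
proof (rule bij_betwI[where g = "\<lambda>p. (filter_mset (\<lambda>k. k \<noteq> Suc m) p, count p (Suc m))"])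
  show "(\<lambda>(p, j). p + replicate_mset j (Suc m)) \<in> no_rep_upto m \<times> multiplicities (Suc m) \<rightarrow> no_rep_upto (Suc m)"
  proof safe
    fix p j assume p: "p \<in> no_rep_upto m" and j: "j \<in> multiplicities (Suc m)"
    have 0: "count p (Suc m) = 0" using p by (auto simp: no_rep_upto_def count_eq_zero_iff)
    have ps: "set_mset p \<subseteq> {1..m}" "\<And>k. odd k \<Longrightarrow> count p k \<le> 1" using p by (auto simp: no_rep_upto_def)
    have "set_mset (p + replicate_mset j (Suc m)) \<subseteq> insert (Suc m) (set_mset p)"
      by (auto simp: in_replicate_mset)
    also have "\<dots> \<subseteq> {1..Suc m}" using ps(1) by (intro insert_subsetI order_trans[OF ps(1)]) auto
    finally have 1: "set_mset (p + replicate_mset j (Suc m)) \<subseteq> {1..Suc m}" .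
    have 2: "count (p + replicate_mset j (Suc m)) k \<le> 1" if k: "odd k" for k
    proof (cases "k = Suc m")
      case True
      then have "j \<in> {0, 1}" using j k by (simp add: multiplicities_def)
      then show ?thesis using 0 True by auto
    next
      case False
      then show ?thesis using ps(2)[OF k] by simp
    qed
    show "p + replicate_mset j (Suc m) \<in> no_rep_upto (Suc m)"
      unfolding no_rep_upto_def using 1 2 by blast
  qed
  show "(\<lambda>p. (filter_mset (\<lambda>k. k \<noteq> Suc m) p, count p (Suc m))) \<in> no_rep_upto (Suc m) \<rightarrow> no_rep_upto m \<times> multiplicities (Suc m)"
  proof (rule funcsetI)
    fix p assume p: "p \<in> no_rep_upto (Suc m)"
    have "count p (Suc m) \<in> multiplicities (Suc m)"
    proof (cases "odd (Suc m)")
      case True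
      then have "count p (Suc m) \<le> 1" using p by (simp add: no_rep_upto_def)
      then have "count p (Suc m) = 0 \<or> count p (Suc m) = 1" by linarith
      then show ?thesis using True by (auto simp: multiplicities_def)
    qed (simp add: multiplicities_def)
    moreover have "filter_mset (\<lambda>k. k \<noteq> Suc m) p \<in> no_rep_upto m"
    proof -
      have "set_mset p \<subseteq> {1..Suc m}" "\<And>k. odd k \<Longrightarrow> count p k \<le> 1" using p by (auto simp: no_rep_upto_def)
      moreover have "{1..Suc m} - {Suc m} \<subseteq> {1..m}" by auto
      ultimately show ?thesis unfolding no_rep_upto_def by auto
    qed
    ultimately show "(filter_mset (\<lambda>k. k \<noteq> Suc m) p, count p (Suc m)) \<in> no_rep_upto m \<times> multiplicities (Suc m)" by blast
  qed
  show "(filter_mset (\<lambda>k. k \<noteq> Suc m) ((\<lambda>(p, j). p + replicate_mset j (Suc m)) x), count ((\<lambda>(p, j). p + replicate_mset j (Suc m)) x) (Suc m)) = x"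
    if x0: "x \<in> no_rep_upto m \<times> multiplicities (Suc m)" for x
  proof -
    obtain p j where x: "x = (p, j)" "p \<in> no_rep_upto m" using x0 by auto
    have "Suc m \<notin># p" using x by (auto simp: no_rep_upto_def)
    then have "filter_mset (\<lambda>k. k \<noteq> Suc m) p = p" "count p (Suc m) = 0"
      by (auto simp: filter_mset_eq_conv count_eq_zero_iff intro!: multiset_eqI)
    then show ?thesis by (simp add: x)
  qed
  show "(\<lambda>(p, j). p + replicate_mset j (Suc m)) (filter_mset (\<lambda>k. k \<noteq> Suc m) p, count p (Suc m)) = p" for p
    by (auto intro!: multiset_eqI)
qed

text \<open>The sum of \<open>(z * q ^ m) ^ j\<close> over the permitted multiplicities
  \<open>j\<close> of the part \<open>m\<close>.\<close>

definition part_factor :: "complex \<Rightarrow> complex \<Rightarrow> nat \<Rightarrow> complex" where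
  "part_factor z q m = (if odd m then 1 + z * q ^ m else 1 / (1 - z * q ^ m))"

lemma has_sum_multiplicities:
  assumes "norm z \<le> 1" "norm q < 1" "m > 0"
  shows "((\<lambda>j. (z * q ^ m) ^ j) has_sum part_factor z q m) (multiplicities m)"
    "(\<lambda>j. norm ((z * q ^ m) ^ j)) summable_on multiplicities m"
proof -
  have n: "norm (z * q ^ m) < 1"
    by (rule norm_mult_less_of_le_1[OF assms(1)]) (use assms power_less_one_norm in auto)
  have "summable (\<lambda>j. norm (z * q ^ m) ^ j)" using n by (intro summable_geometric) auto
  then have s: "(\<lambda>j. norm ((z * q ^ m) ^ j)) summable_on UNIV"
    by (simp add: summable_on_UNIV_nonneg_real_iff norm_power)
  show "(\<lambda>j. norm ((z * q ^ m) ^ j)) summable_on multiplicities m"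
    by (rule summable_on_subset_banach[OF s]) auto
  show "((\<lambda>j. (z * q ^ m) ^ j) has_sum part_factor z q m) (multiplicities m)"
  proof (cases "odd m")
    case True
    then show ?thesis by (simp add: multiplicities_def part_factor_def has_sum_finiteI)
  next
    case False
    have "(\<lambda>j. (z * q ^ m) ^ j) summable_on UNIV" using s by (rule abs_summable_summable)
    then have h: "((\<lambda>j. (z * q ^ m) ^ j) has_sum (\<Sum>\<^sub>\<infinity>j. (z * q ^ m) ^ j)) UNIV" by (rule has_sum_infsum)
    from sums_unique2[OF has_sum_imp_sums[OF h] geometric_sums[OF n]] show ?thesis
      using h False by (simp add: multiplicities_def part_factor_def)
  qed
qed

text \<open>Induction on the bound for the parts. Absolute summability is carried along because it
  justifies summing over pairs of a smaller partition and a multiplicity.\<close>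

lemma has_sum_no_rep_upto:
  assumes "norm z \<le> 1" "norm q < 1"
  shows "(weight z q has_sum (\<Prod>i\<in>{1..m}. part_factor z q i)) (no_rep_upto m) \<and> (\<lambda>p. norm (weight z q p)) summable_on no_rep_upto m"
proof (induction m)
  case 0
  then show ?case by (simp add: no_rep_upto_0 weight_def has_sum_finiteI)
next
  case (Suc m)
  let ?h = "\<lambda>(p, j). weight z q p * (z * q ^ Suc m) ^ j"
  have eq: "(\<lambda>x. weight z q ((\<lambda>(p, j). p + replicate_mset j (Suc m)) x)) = ?h"
    by (auto simp: weight_union weight_replicate)
  have m: "((\<lambda>j. (z * q ^ Suc m) ^ j) has_sum part_factor z q (Suc m)) (multiplicities (Suc m))"
    "(\<lambda>j. norm ((z * q ^ Suc m) ^ j)) summable_on multiplicities (Suc m)"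
    using has_sum_multiplicities[OF assms, of "Suc m"] by auto
  have abs: "(\<lambda>x. norm (?h x)) summable_on no_rep_upto m \<times> multiplicities (Suc m)"
  proof -
    have "(\<lambda>(p, j). norm (weight z q p * (z * q ^ Suc m) ^ j)) summable_on no_rep_upto m \<times> multiplicities (Suc m)"
    proof (rule summable_on_SigmaI)
      show "((\<lambda>j. (case (p, j) of (p, j) \<Rightarrow> norm (weight z q p * (z * q ^ Suc m) ^ j))) has_sum norm (weight z q p) * (\<Sum>\<^sub>\<infinity>j\<in>multiplicities (Suc m). norm ((z * q ^ Suc m) ^ j))) (multiplicities (Suc m))" for p
        unfolding case_prod_conv norm_mult[of "weight z q p"] using m(2) by (intro has_sum_cmult_right has_sum_infsum)
      show "(\<lambda>p. norm (weight z q p) * (\<Sum>\<^sub>\<infinity>j\<in>multiplicities (Suc m). norm ((z * q ^ Suc m) ^ j))) summable_on no_rep_upto m"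
        using Suc by (intro summable_on_cmult_left) auto
    qed auto
    then show ?thesis by (simp add: case_prod_unfold)
  qed
  have "(?h has_sum (\<Prod>i\<in>{1..m}. part_factor z q i) * part_factor z q (Suc m)) (no_rep_upto m \<times> multiplicities (Suc m))"
  proof (rule has_sum_SigmaI)
    show "((\<lambda>j. ?h (p, j)) has_sum weight z q p * part_factor z q (Suc m)) (multiplicities (Suc m))" for p
      using has_sum_cmult_right[OF m(1), of "weight z q p"] by simp
    show "((\<lambda>p. weight z q p * part_factor z q (Suc m)) has_sum (\<Prod>i\<in>{1..m}. part_factor z q i) * part_factor z q (Suc m)) (no_rep_upto m)"
      using Suc by (intro has_sum_cmult_left) auto
    show "?h summable_on no_rep_upto m \<times> multiplicities (Suc m)" using abs by (rule abs_summable_summable)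
  qed
  moreover have "(\<lambda>p. norm (weight z q p)) summable_on no_rep_upto (Suc m)"
    using summable_on_reindex_bij_betw[OF no_rep_upto_Suc_bij[of m], of "\<lambda>p. norm (weight z q p)"] abs
    unfolding eq[THEN fun_cong] by simp
  ultimately show ?case
    using has_sum_reindex_bij_betw[OF no_rep_upto_Suc_bij[of m], of "weight z q"] unfolding eq by simp
qed

text \<open>Only even bounds occur: the rank sees the largest part through half of it rounded up, so
  the parts \<open>2 * k + 1\<close> and \<open>2 * k + 2\<close> belong together.\<close>

lemma prod_part_factor:
  "(\<Prod>i\<in>{1..2 * k}. part_factor z q i) = qp_fin (- z * q) (q ^ 2) k / qp_fin (z * q ^ 2) (q ^ 2) k"
proof (induction k)
  case (Suc k)
  have "{1..2 * Suc k} = insert (2 * k + 2) (insert (2 * k + 1) {1..2 * k})" by auto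
  then have "(\<Prod>i\<in>{1..2 * Suc k}. part_factor z q i) = (\<Prod>i\<in>{1..2 * k}. part_factor z q i) * part_factor z q (2 * k + 1) * part_factor z q (2 * k + 2)"
    by simp
  moreover have "part_factor z q (2 * k + 1) = 1 - (- z * q) * (q ^ 2) ^ k" "part_factor z q (2 * k + 2) = 1 / (1 - (z * q ^ 2) * (q ^ 2) ^ k)"
  proof -
    have "q ^ (2 * k + 1) = q * (q ^ 2) ^ k" "q ^ (2 * k + 2) = q ^ 2 * (q ^ 2) ^ k"
      using power_mult[of q 2 k] power_add[of q "2 * k" 1] power_add[of q "2 * k" 2]
      by (simp_all only: power_one_right mult.commute)
    then show "part_factor z q (2 * k + 1) = 1 - (- z * q) * (q ^ 2) ^ k" "part_factor z q (2 * k + 2) = 1 / (1 - (z * q ^ 2) * (q ^ 2) ^ k)"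
      by (simp_all only: part_factor_def) (simp_all add: mult.assoc)
  qed
  ultimately show ?case unfolding Suc by (simp add: qp_fin_Suc)
qed simp

section \<open>All admissible partitions, sorted by half of the largest part\<close>

definition no_rep :: "nat multiset set" where
  "no_rep = {p. 0 \<notin># p \<and> (\<forall>k. odd k \<longrightarrow> count p k \<le> 1)}"

lemma no_rep_upto_subset: "no_rep_upto m \<subseteq> no_rep_upto (Suc m)" "no_rep_upto m \<subseteq> no_rep"
  by (auto simp: no_rep_upto_def no_rep_def)

text \<open>With \<open>c\<close> half the largest part \<open>M\<close> rounded up,
  \<open>M\<close> is \<open>2 * c - 1\<close> or \<open>2 * c\<close>. Positivity of
  \<open>c\<close> is recorded since \<open>c - 1\<close> is a natural number subtraction.\<close>

lemma no_rep_in_upto: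
  assumes "p \<in> no_rep" "p \<noteq> {#}"
  shows "p \<in> no_rep_upto (2 * nat \<lceil>real (Max (set_mset p)) / 2\<rceil>) - no_rep_upto (2 * (nat \<lceil>real (Max (set_mset p)) / 2\<rceil> - 1))"
    "nat \<lceil>real (Max (set_mset p)) / 2\<rceil> > 0"
proof -
  define M where "M = Max (set_mset p)"
  define c where "c = nat \<lceil>real M / 2\<rceil>"
  have M: "M \<in># p" "\<And>k. k \<in># p \<Longrightarrow> k \<le> M"
    using assms(2) by (auto simp: M_def)
  have M0: "M > 0" using M(1) assms(1) by (auto simp: no_rep_def intro: Nat.gr0I)
  have c: "M \<le> 2 * c" "2 * (c - 1) < M" "c > 0"
    unfolding c_def using M0 by linarith+
  show "nat \<lceil>real (Max (set_mset p)) / 2\<rceil> > 0" using c(3) by (simp add: c_def M_def)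
  have "p \<in> no_rep_upto (2 * c)"
  proof -
    have "k \<in> {1..2 * c}" if "k \<in># p" for k
    proof -
      have "k \<noteq> 0" using assms(1) that by (auto simp: no_rep_def intro: ccontr)
      then show ?thesis using M(2)[OF that] c(1) by auto
    qed
    then show ?thesis using assms(1) by (auto simp: no_rep_upto_def no_rep_def)
  qed
  moreover have "p \<notin> no_rep_upto (2 * (c - 1))" using M(1) c(2) by (auto simp: no_rep_upto_def)
  ultimately show "p \<in> no_rep_upto (2 * nat \<lceil>real (Max (set_mset p)) / 2\<rceil>) - no_rep_upto (2 * (nat \<lceil>real (Max (set_mset p)) / 2\<rceil> - 1))"
    by (simp add: c_def M_def)
qed

lemma no_rep_upto_diff_rank:
  assumes "p \<in> no_rep_upto (2 * Suc k) - no_rep_upto (2 * k)"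
  shows "p \<in> no_rep" "p \<noteq> {#}" "M2_rank p = int (Suc k) - int (size p)"
proof -
  show n: "p \<in> no_rep" using assms no_rep_upto_subset(2) by blast
  show ne: "p \<noteq> {#}" using assms by (auto simp: no_rep_upto_def)
  have M: "Max (set_mset p) \<in># p" "\<And>j. j \<in># p \<Longrightarrow> j \<le> Max (set_mset p)" using ne by auto
  have ps: "set_mset p \<subseteq> {1..2 * Suc k}" "\<forall>j. odd j \<longrightarrow> count p j \<le> 1"
    using assms unfolding no_rep_upto_def by blast+
  have "Max (set_mset p) \<le> 2 * Suc k" using subsetD[OF ps(1) M(1)] by simp
  moreover have "2 * k < Max (set_mset p)"
  proof (rule ccontr)
    assume nle: "\<not> 2 * k < Max (set_mset p)"
    have "set_mset p \<subseteq> {1..2 * k}"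
    proof
      fix j assume j: "j \<in># p"
      have "j \<le> 2 * k" using M(2)[OF j] nle by linarith
      then show "j \<in> {1..2 * k}" using subsetD[OF ps(1) j] by simp
    qed
    then have "p \<in> no_rep_upto (2 * k)" using ps(2) unfolding no_rep_upto_def by blast
    then show False using assms by blast
  qed
  ultimately have "\<lceil>real (Max (set_mset p)) / 2\<rceil> = int (Suc k)"
    by (intro ceiling_unique) auto
  then show "M2_rank p = int (Suc k) - int (size p)" by (simp add: M2_rank_def)
qed

text \<open>A finite set of partitions has bounded parts, so its sum is at most the product of the
  \<open>part_factor\<close> values at \<open>z = 1\<close> and base \<open>norm q\<close>. These
  products converge as the bound grows and are therefore bounded.\<close>

lemma weight_summable:
  assumes q: "norm q < 1"
  shows "(\<lambda>p. norm q ^ sum_mset p) summable_on no_rep"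
proof (rule nonneg_bdd_above_summable_on)
  have n1: "norm (complex_of_real (norm q)) < 1" using q by simp
  let ?r = "complex_of_real (norm q)"
  have r2: "norm (?r ^ 2) < 1" using n1 by (rule power_less_one_norm) simp
  obtain B where B: "\<And>k. norm (qp_fin (- 1 * ?r) (?r ^ 2) k / qp_fin (1 * ?r ^ 2) (?r ^ 2) k) \<le> B"
  proof -
    have nz: "qp (?r ^ 2) (?r ^ 2) \<noteq> 0" using r2 by (intro qp_nonzero) auto
    have "(\<lambda>k. qp_fin (- 1 * ?r) (?r ^ 2) k / qp_fin (1 * ?r ^ 2) (?r ^ 2) k) \<longlonglongrightarrow> qp (- 1 * ?r) (?r ^ 2) / qp (1 * ?r ^ 2) (?r ^ 2)"
      unfolding qp_fin_def using nz r2 by (intro tendsto_intros qp_LIMSEQ) auto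
    then have "Bseq (\<lambda>k. qp_fin (- 1 * ?r) (?r ^ 2) k / qp_fin (1 * ?r ^ 2) (?r ^ 2) k)"
      by (intro convergent_imp_Bseq) (auto simp: convergent_def)
    then show ?thesis using that by (auto simp: Bseq_def)
  qed
  show "bdd_above (sum (\<lambda>p. norm q ^ sum_mset p) ` {F. F \<subseteq> no_rep \<and> finite F})"
  proof (rule bdd_aboveI2)
    fix F :: "nat multiset set" assume "F \<in> {F. F \<subseteq> no_rep \<and> finite F}"
    then have F: "F \<subseteq> no_rep" "finite F" by auto
    have "finite (\<Union>p\<in>F. set_mset p)" using F by auto
    then obtain k where k: "\<And>j. j \<in> (\<Union>p\<in>F. set_mset p) \<Longrightarrow> j \<le> k"
      by (meson finite_nat_set_iff_bounded_le)
    have FA: "F \<subseteq> no_rep_upto (2 * k)"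
    proof
      fix p assume p: "p \<in> F"
      have "j \<in> {1..2 * k}" if "j \<in># p" for j
      proof -
        have "j \<noteq> 0" using F p that by (auto simp: no_rep_def intro: ccontr)
        moreover have "j \<le> k" using k p that by blast
        ultimately show ?thesis by auto
      qed
      then show "p \<in> no_rep_upto (2 * k)" using F p by (auto simp: no_rep_upto_def no_rep_def)
    qed
    have s: "(weight 1 ?r has_sum (\<Prod>i\<in>{1..2 * k}. part_factor 1 ?r i)) (no_rep_upto (2 * k))"
      "(\<lambda>p. norm (weight 1 ?r p)) summable_on no_rep_upto (2 * k)"
      using has_sum_no_rep_upto[of 1 ?r "2 * k"] n1 by auto
    have e: "norm (weight 1 ?r p) = norm q ^ sum_mset p" "weight 1 ?r p = of_real (norm q ^ sum_mset p)" for p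
      by (simp_all add: weight_def norm_power)
    have s2: "(\<lambda>p. norm q ^ sum_mset p) summable_on no_rep_upto (2 * k)" using s(2) unfolding e(1) .
    then have h: "((\<lambda>p. norm q ^ sum_mset p) has_sum (\<Sum>\<^sub>\<infinity>p\<in>no_rep_upto (2 * k). norm q ^ sum_mset p)) (no_rep_upto (2 * k))"
      by (rule has_sum_infsum)
    then have "(weight 1 ?r has_sum of_real (\<Sum>\<^sub>\<infinity>p\<in>no_rep_upto (2 * k). norm q ^ sum_mset p)) (no_rep_upto (2 * k))"
      unfolding e(2)[abs_def] by (rule has_sum_of_real)
    then have "complex_of_real (\<Sum>\<^sub>\<infinity>p\<in>no_rep_upto (2 * k). norm q ^ sum_mset p) = (\<Prod>i\<in>{1..2 * k}. part_factor 1 ?r i)"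
      using s(1) has_sum_unique by blast
    then have "norm (complex_of_real (\<Sum>\<^sub>\<infinity>p\<in>no_rep_upto (2 * k). norm q ^ sum_mset p)) \<le> B"
      unfolding prod_part_factor using B by simp
    then have "(\<Sum>\<^sub>\<infinity>p\<in>no_rep_upto (2 * k). norm q ^ sum_mset p) \<le> B" by simp
    moreover have "sum (\<lambda>p. norm q ^ sum_mset p) F \<le> (\<Sum>\<^sub>\<infinity>p\<in>no_rep_upto (2 * k). norm q ^ sum_mset p)"
      by (rule finite_sum_le_infsum[OF s2 F(2) FA]) auto
    ultimately show "sum (\<lambda>p. norm q ^ sum_mset p) F \<le> B" by linarith
  qed
qed auto

lemma finite_partitions: "finite (partitions_no_rep_odd n)"
proof -
  have "partitions_no_rep_odd n \<subseteq> mset ` {xs. set xs \<subseteq> {..n} \<and> length xs \<le> n}"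
  proof
    fix p assume p: "p \<in> partitions_no_rep_odd n"
    obtain xs where xs: "mset xs = p" using ex_mset by blast
    have p0: "0 \<notin># p" "sum_mset p = n" using p by (auto simp: partitions_no_rep_odd_def)
    have "k \<le> n" if "k \<in># p" for k
      using sum_mset.remove[OF that] p0(2) by simp
    moreover have "size p \<le> sum_mset p" using p0(1)
      by (induction p) (auto simp: Suc_le_eq intro: add_mono)
    ultimately have "set xs \<subseteq> {..n} \<and> length xs \<le> n" using xs p0 by auto
    then show "p \<in> mset ` {xs. set xs \<subseteq> {..n} \<and> length xs \<le> n}" using xs by blast
  qed
  moreover have "finite {xs. set xs \<subseteq> {..n} \<and> length xs \<le> n}"
    by (rule finite_lists_length_le) simp
  ultimately show ?thesis using finite_subset by blast
qed

text \<open>On \<open>D k\<close> the rank is \<open>k + 1\<close> minus the number of parts, so the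
  summand is \<open>x ^ Suc k\<close> times the weight with \<open>z = 1 / x\<close>. The sum over
  \<open>D k\<close> is a difference of consecutive products. As \<open>norm x = 1\<close>, absolute
  summability does not depend on \<open>x\<close>.\<close>

theorem rank_gf:
  assumes q: "q \<noteq> 0" "norm q < 1" and x: "norm x = 1"
  shows "((\<lambda>p. x powi M2_rank p * q ^ sum_mset p) has_sum (rank_series q x - 1)) (no_rep - {{#}})"
proof -
  define z where "z = 1 / x"
  have x0: "x \<noteq> 0" using x by auto
  have z: "norm z = 1" "norm z \<le> 1" using x by (auto simp: z_def norm_divide)
  define D where "D = (\<lambda>k. no_rep_upto (2 * Suc k) - no_rep_upto (2 * k))"
  let ?f = "\<lambda>p. x powi M2_rank p * q ^ sum_mset p"
  have D: "no_rep - {{#}} = (\<Union>k. D k)"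
  proof (intro equalityI subsetI)
    fix p assume p: "p \<in> no_rep - {{#}}"
    define c where "c = nat \<lceil>real (Max (set_mset p)) / 2\<rceil>"
    have "p \<in> no_rep_upto (2 * c) - no_rep_upto (2 * (c - 1))" "c > 0" using no_rep_in_upto[of p] p by (auto simp: c_def)
    moreover from \<open>c > 0\<close> have "Suc (c - 1) = c" by simp
    ultimately have "p \<in> D (c - 1)" by (simp only: D_def)
    then show "p \<in> (\<Union>k. D k)" by blast
  next
    fix p assume "p \<in> (\<Union>k. D k)"
    then obtain k where "p \<in> no_rep_upto (2 * Suc k) - no_rep_upto (2 * k)" by (auto simp: D_def)
    from no_rep_upto_diff_rank[OF this] show "p \<in> no_rep - {{#}}" by auto
  qed
  have Dr: "M2_rank p = int (Suc k) - int (size p)" if "p \<in> D k" for p k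
    using no_rep_upto_diff_rank that by (auto simp: D_def)
  have inj: "k = l" if "p \<in> D k" "p \<in> D l" for p k l
    using Dr[OF that(1)] Dr[OF that(2)] by simp
  have bij: "bij_betw snd (Sigma UNIV D) (no_rep - {{#}})"
    unfolding D by (auto simp: bij_betw_def inj_on_def image_iff intro: inj)
  have fD: "?f p = x ^ Suc k * weight z q p" if "p \<in> D k" for p k
  proof -
    have "x powi M2_rank p = x ^ Suc k * z ^ size p"
      unfolding Dr[OF that] z_def using x0 by (simp add: power_int_diff power_one_over divide_inverse power_inverse del: of_nat_Suc power_Suc)
    then show ?thesis by (simp add: weight_def)
  qed
  have abs: "(\<lambda>p. norm (?f p)) summable_on (no_rep - {{#}})"
  proof -
    have "norm (?f p) = norm q ^ sum_mset p" for p
      using x by (simp add: norm_mult norm_power norm_power_int)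
    then show ?thesis using summable_on_subset_banach[OF weight_summable[OF q(2)], of "no_rep - {{#}}"] by simp
  qed
  have summ: "?f summable_on (no_rep - {{#}})" using abs by (rule abs_summable_summable)
  define P where "P = (\<lambda>k. qp_fin (- z * q) (q ^ 2) k / qp_fin (z * q ^ 2) (q ^ 2) k)"
  have DP: "(?f has_sum x ^ Suc k * (P (Suc k) - P k)) (D k)" for k
  proof -
    have a: "(weight z q has_sum P k) (no_rep_upto (2 * k))" for k
      using has_sum_no_rep_upto[OF z(2) q(2), of "2 * k"] unfolding prod_part_factor P_def by blast
    have "(weight z q has_sum (P (Suc k) - P k)) (D k)"
      unfolding D_def by (intro has_sum_Diff a) (use no_rep_upto_subset(1) in \<open>auto intro: subsetD\<close>)
    then have "((\<lambda>p. x ^ Suc k * weight z q p) has_sum x ^ Suc k * (P (Suc k) - P k)) (D k)"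
      by (rule has_sum_cmult_right)
    then show ?thesis using has_sum_cong[of "D k" ?f "\<lambda>p. x ^ Suc k * weight z q p"] fD by blast
  qed
  have total: "((\<lambda>(k, p). ?f p) has_sum infsum ?f (no_rep - {{#}})) (Sigma UNIV D)"
    using has_sum_reindex_bij_betw[OF bij, of ?f] has_sum_infsum[OF summ] by (simp add: case_prod_unfold)
  have "((\<lambda>k. x ^ Suc k * (P (Suc k) - P k)) has_sum infsum ?f (no_rep - {{#}})) UNIV"
    using has_sum_SigmaD[OF total, of "\<lambda>k. x ^ Suc k * (P (Suc k) - P k)"] DP by simp
  then have s: "(\<lambda>k. x ^ Suc k * (P (Suc k) - P k)) sums infsum ?f (no_rep - {{#}})"
    by (rule has_sum_imp_sums)
  have nz: "qp (q ^ 2 / x) (q ^ 2) \<noteq> 0"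
    using x norm_square_less_1[OF q] by (intro qp_nonzero) (auto simp: norm_divide)
  \<comment> \<open>Passing from \<open>P k\<close> to \<open>P (Suc k)\<close> multiplies by one
    factor of each product; the difference of these two factors is
    \<open>(1 + q) * q * (q ^ 2) ^ k / x\<close>.\<close>
  have G: "x ^ Suc k * (P (Suc k) - P k) = (1 + q) * q * ((q ^ 2 * x) ^ k * rank_term q x k)" for k
  proof -
    have pn: "qp_fin (q ^ 2 / x) (q ^ 2) (Suc k) \<noteq> 0" using qp_fin_nonzero[OF q refl] nz by simp
    then have n: "1 - q ^ 2 / x * (q ^ 2) ^ k \<noteq> 0" "qp_fin (q ^ 2 / x) (q ^ 2) k \<noteq> 0" by (auto simp: qp_fin_Suc)
    have aux: "A * v / (Q * u) - A / Q = A * (v - u) / (Q * u)" if "u \<noteq> 0" "Q \<noteq> 0" for A Q u v :: complex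
      using that by (simp add: field_simps)
    have "P (Suc k) - P k = qp_fin (- q / x) (q ^ 2) k * ((1 - (- q / x) * (q ^ 2) ^ k) - (1 - q ^ 2 / x * (q ^ 2) ^ k)) / qp_fin (q ^ 2 / x) (q ^ 2) (Suc k)"
      using aux[OF n] unfolding P_def z_def by (simp add: qp_fin_Suc)
    also have "(1 - (- q / x) * (q ^ 2) ^ k) - (1 - q ^ 2 / x * (q ^ 2) ^ k) = (1 + q) * q * (q ^ 2) ^ k / x"
      by (simp add: algebra_simps power2_eq_square add_divide_distrib)
    finally show ?thesis using x0 by (simp add: rank_term_def power_mult_distrib)
  qed
  have "summable (\<lambda>k. (q ^ 2 * x) ^ k * rank_term q x k)"
    by (rule rank_term_summable[OF q refl]) (use nz x0 x norm_square_less_1[OF q] in \<open>auto simp: norm_mult\<close>)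
  then have "(\<lambda>k. (1 + q) * q * ((q ^ 2 * x) ^ k * rank_term q x k)) sums ((1 + q) * q * (\<Sum>k. (q ^ 2 * x) ^ k * rank_term q x k))"
    by (intro sums_mult summable_sums)
  then have "infsum ?f (no_rep - {{#}}) = rank_series q x - 1"
    using sums_unique2 s unfolding G by (fastforce simp: rank_series_def)
  then show ?thesis using has_sum_infsum[OF summ] by simp
qed

section \<open>Separating residue classes modulo 3\<close>

text \<open>Builds in the convention that nothing is counted for \<open>n = 0\<close>; this is why
  the generating function below is \<open>rank_series q x - 1\<close>.\<close>

definition nonempty_parts :: "nat \<Rightarrow> nat multiset set" where
  "nonempty_parts n = (if n = 0 then {} else partitions_no_rep_odd n)"

lemma finite_nonempty_parts: "finite (nonempty_parts n)"
  by (simp add: nonempty_parts_def finite_partitions)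

lemma N2_eq: "N2 m n = card {p \<in> nonempty_parts n. M2_rank p = m}"
  by (simp add: N2_def nonempty_parts_def)

text \<open>All but finitely many ranks contribute 0, so the sum over a residue class reduces to the
  ranks that occur, and grouping by rank gives one cardinality.\<close>

lemma N2_mod_eq: "N2_mod s l n = card {p \<in> nonempty_parts n. [M2_rank p = s] (mod int l)}"
proof -
  let ?B = "nonempty_parts n"
  let ?B' = "{p \<in> ?B. [M2_rank p = s] (mod int l)}"
  have "N2_mod s l n = (\<Sum>\<^sub>\<infinity>m\<in>M2_rank ` ?B'. N2 m n)"
    unfolding N2_mod_def
  proof (rule infsum_cong_neutral)
    fix m assume m: "m \<in> {m. [m = s] (mod int l)} - M2_rank ` ?B'"
    then have E: "{p \<in> ?B. M2_rank p = m} = {}" by auto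
    show "N2 m n = 0" unfolding N2_eq E by simp
  qed auto
  also have "\<dots> = (\<Sum>m\<in>M2_rank ` ?B'. N2 m n)"
    using finite_nonempty_parts[of n] by (intro infsum_finite) auto
  also have "\<dots> = (\<Sum>m\<in>M2_rank ` ?B'. \<Sum>p\<in>{p \<in> ?B'. M2_rank p = m}. 1)"
  proof (rule sum.cong[OF refl])
    fix m assume "m \<in> M2_rank ` ?B'"
    then have "{p \<in> ?B. M2_rank p = m} = {p \<in> ?B'. M2_rank p = m}" by auto
    then show "N2 m n = (\<Sum>p\<in>{p \<in> ?B'. M2_rank p = m}. 1)" unfolding N2_eq by simp
  qed
  also have "\<dots> = (\<Sum>p\<in>?B'. 1)"
    using finite_nonempty_parts[of n] by (intro sum.group) auto
  finally show ?thesis by simp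
qed

lemma sum_cube_root_rank:
  assumes w: "1 + w + w ^ 2 = (0::complex)"
  shows "(\<Sum>p\<in>nonempty_parts n. w powi M2_rank p) = of_nat (N2_mod 0 3 n) + w * of_nat (N2_mod 1 3 n) + w ^ 2 * of_nat (N2_mod 2 3 n)"
proof -
  note wp = cube_root_props[OF w]
  let ?B = "nonempty_parts n"
  have c: "of_nat (N2_mod s 3 n) = (\<Sum>p\<in>?B. if M2_rank p mod 3 = s mod 3 then 1 else 0 :: complex)" for s
    unfolding N2_mod_eq using finite_nonempty_parts[of n] by (simp add: cong_def flip: sum.inter_filter)
  have "w powi r = (if r mod 3 = 0 mod 3 then 1 else 0) + w * (if r mod 3 = 1 mod 3 then 1 else 0) + w ^ 2 * (if r mod 3 = 2 mod 3 then 1 else 0)" for r :: int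
  proof -
    have "r = 3 * (r div 3) + r mod 3" by simp
    then have "w powi r = w powi (3 * (r div 3)) * w powi (r mod 3)" using power_int_add[of w "3 * (r div 3)" "r mod 3"] wp(2) by simp
    also have "w powi (3 * (r div 3)) = 1" using power_int_mult[of w 3 "r div 3"] wp(1) by simp
    finally have e: "w powi r = w powi (r mod 3)" by simp
    have "r mod 3 = 0 \<or> r mod 3 = 1 \<or> r mod 3 = 2" by presburger
    then show ?thesis unfolding e by (auto simp: wp(2))
  qed
  then show ?thesis unfolding c by (simp only: sum.distrib sum_distrib_left)
qed

lemma rank_gf_by_size:
  assumes q: "q \<noteq> 0" "norm q < 1" and x: "norm x = 1"
  shows "((\<lambda>n. (\<Sum>p\<in>nonempty_parts n. x powi M2_rank p) * q ^ n) has_sum (rank_series q x - 1)) UNIV"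
proof -
  let ?f = "\<lambda>p. x powi M2_rank p * q ^ sum_mset p"
  have bij: "bij_betw snd (Sigma UNIV nonempty_parts) (no_rep - {{#}})"
  proof (rule bij_betwI[where g = "\<lambda>p. (sum_mset p, p)"])
    have "sum_mset p \<noteq> 0" if "p \<in> no_rep" "p \<noteq> {#}" for p
    proof -
      obtain k where "k \<in># p" using \<open>p \<noteq> {#}\<close> by blast
      moreover from this have "k \<noteq> 0" using \<open>p \<in> no_rep\<close> by (auto simp: no_rep_def intro: ccontr)
      ultimately show ?thesis using sum_mset.remove[of k p] by simp
    qed
    then show "(\<lambda>p. (sum_mset p, p)) \<in> no_rep - {{#}} \<rightarrow> Sigma UNIV nonempty_parts"
      by (auto simp: nonempty_parts_def partitions_no_rep_odd_def no_rep_def)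
  qed (auto simp: nonempty_parts_def partitions_no_rep_odd_def no_rep_def split: if_splits)
  have "((\<lambda>(n, p). ?f p) has_sum (rank_series q x - 1)) (Sigma UNIV nonempty_parts)"
    using has_sum_reindex_bij_betw[OF bij, of ?f] rank_gf[OF q x] by (simp add: case_prod_unfold)
  then show ?thesis
  proof (rule has_sum_SigmaD)
    fix n :: nat
    have "(\<Sum>p\<in>nonempty_parts n. ?f p) = (\<Sum>p\<in>nonempty_parts n. x powi M2_rank p) * q ^ n"
      unfolding sum_distrib_right
      by (intro sum.cong refl) (auto simp: nonempty_parts_def partitions_no_rep_odd_def split: if_splits)
    then show "((\<lambda>p. case (n, p) of (n, p) \<Rightarrow> ?f p) has_sum (\<Sum>p\<in>nonempty_parts n. x powi M2_rank p) * q ^ n) (nonempty_parts n)"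
      using finite_nonempty_parts by (simp add: has_sum_finiteI)
  qed
qed

text \<open>The second equation is inversion of the Appell sum: \<open>w ^ 2 = 1 / w\<close>
  introduces the factor \<open>- w\<close>, and \<open>(1 - w ^ 2) * - w = 1 - w\<close>.\<close>

lemma rank_series_cube_root:
  assumes t: "t \<noteq> 0" "norm t < 1" and w: "1 + w + w ^ 2 = 0"
  shows "rank_series t w = (1 - w) * appell t w / psi t" "rank_series t (w ^ 2) = rank_series t w"
proof -
  have *: "rank_series t v = (1 - v) * appell t v / psi t" if v: "1 + v + v ^ 2 = 0" for v
  proof (rule rank_series_eq_appell[OF t refl])
    note vp = cube_root_props[OF v]
    show "v \<noteq> 0" by (rule vp)
    have "norm (t ^ 2) < 1" "0 < norm (t ^ 2)" using norm_square_less_1[OF t] by auto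
    then show "norm v < 1 / norm (t ^ 2)" using vp(6) by (simp only: less_divide_eq_1_pos)
    show "v \<notin> poles (t ^ 2)" using cube_root_nonpoles(4)[OF t v vp(1,3)] by (auto simp: poles_def[OF t refl])
  qed
  show 1: "rank_series t w = (1 - w) * appell t w / psi t" by (rule *[OF w])
  note wp = cube_root_props[OF w]
  have "w ^ 2 * w ^ 2 = w" using wp(1) by (simp add: power2_eq_square power3_eq_cube mult.assoc)
  then have "1 + w ^ 2 + (w ^ 2) ^ 2 = 1 + w + w ^ 2" by (simp add: power2_eq_square[of "w ^ 2"])
  then have w2: "1 + w ^ 2 + (w ^ 2) ^ 2 = 0" using w by simp
  have "appell t (w ^ 2) = - w * appell t w"
    using appell_on_inverse[OF t wp(2), of UNIV] wp(4) by simp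
  moreover have "(1 - w ^ 2) * - w = 1 - w" using wp(1) by (simp add: algebra_simps power2_eq_square power3_eq_cube)
  ultimately have "(1 - w ^ 2) * appell t (w ^ 2) = (1 - w) * appell t w" by (metis mult.assoc)
  then show "rank_series t (w ^ 2) = rank_series t w" unfolding 1 *[OF w2] by simp
qed

text \<open>A concrete primitive cube root of unity, for statements in which no root
  appears.\<close>

definition cbrt1 :: complex where "cbrt1 = Complex (- 1 / 2) (sqrt 3 / 2)"

lemma cbrt1: "1 + cbrt1 + cbrt1 ^ 2 = 0"
  by (simp add: cbrt1_def complex_eq_iff power2_eq_square)

text \<open>The generating functions at \<open>w\<close> and \<open>w ^ 2\<close> coincide, so their
  difference has zero coefficients. These are \<open>w - w ^ 2\<close> times the difference of the
  two counts.\<close>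

lemma N2_mod_symmetric: "N2_mod 1 3 n = N2_mod 2 3 n"
proof -
  let ?w = cbrt1
  note w = cbrt1
  note wp = cube_root_props[OF w]
  have "?w ^ 2 * ?w ^ 2 = ?w" using wp(1) by (simp add: power2_eq_square power3_eq_cube mult.assoc)
  then have w4: "(?w ^ 2) ^ 2 = ?w" by (simp add: power2_eq_square[of "?w ^ 2"])
  then have "1 + ?w ^ 2 + (?w ^ 2) ^ 2 = 1 + ?w + ?w ^ 2" by simp
  then have w2: "1 + ?w ^ 2 + (?w ^ 2) ^ 2 = 0" using w by simp
  define a where "a = (\<lambda>n. (?w - ?w ^ 2) * (of_nat (N2_mod 1 3 n) - of_nat (N2_mod 2 3 n)))"
  have a: "a n = (\<Sum>p\<in>nonempty_parts n. ?w powi M2_rank p) - (\<Sum>p\<in>nonempty_parts n. (?w ^ 2) powi M2_rank p)" for n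
    unfolding sum_cube_root_rank[OF w] sum_cube_root_rank[OF w2] w4 a_def by (simp add: algebra_simps)
  have a0: "a 0 = 0" unfolding a by (simp add: nonempty_parts_def)
  have s: "(\<lambda>n. a n * (q - 0) ^ n) sums 0" if "norm (q - 0) < 1" for q
  proof (cases "q = 0")
    case True
    then show ?thesis using a0 by simp
  next
    case False
    have q: "q \<noteq> 0" "norm q < 1" using False that by auto
    have n2: "norm (?w ^ 2) = 1" using wp(6) by (simp add: norm_power)
    have "(\<lambda>n. (\<Sum>p\<in>nonempty_parts n. ?w powi M2_rank p) * q ^ n - (\<Sum>p\<in>nonempty_parts n. (?w ^ 2) powi M2_rank p) * q ^ n) sums
        ((rank_series q ?w - 1) - (rank_series q (?w ^ 2) - 1))"
      by (intro sums_diff has_sum_imp_sums rank_gf_by_size q wp n2)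
    then show ?thesis using rank_series_cube_root(2)[OF q w] by (simp add: a left_diff_distrib)
  qed
  have "a n = 0"
  proof (rule ccontr)
    assume an: "a n \<noteq> 0"
    then have n: "n > 0" using a0 by (cases n) auto
    show False
    \<comment> \<open>A nonzero coefficient would make the zero function nonzero on a punctured
      disc; the point \<open>e\<close> refutes this.\<close>
    proof (rule powser_0_nonzero[where a = a and m = n and f = "\<lambda>_. 0" and r = 1 and \<xi> = 0])
      fix e :: real assume e: "0 < e" and nz: "\<And>z::complex. z \<in> cball 0 e - {0} \<Longrightarrow> (0::complex) \<noteq> 0"
      have "complex_of_real e \<in> cball 0 e - {0}" using e by auto
      from nz[OF this] show False by simp
    qed (use s an n in auto)
  qed
  moreover have "?w \<noteq> ?w ^ 2" using wp(2,3) by (simp add: power2_eq_square)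
  ultimately show ?thesis by (simp add: a_def)
qed

section \<open>The generating function of the rank difference and its trisection\<close>

definition dcoeff :: "nat \<Rightarrow> complex" where
  "dcoeff n = of_int (int (N2_mod 0 3 n) - int (N2_mod 1 3 n))"

lemma dcoeff_gf:
  assumes t: "t \<noteq> 0" "norm t < 1" and w: "1 + w + w ^ 2 = 0"
  shows "((\<lambda>n. dcoeff n * t ^ n) has_sum ((1 - w) * appell t w / psi t - 1)) UNIV"
proof -
  have "(\<Sum>p\<in>nonempty_parts n. w powi M2_rank p) = dcoeff n" for n
  proof -
    have "a + w * b + w ^ 2 * b = a - b + (1 + w + w ^ 2) * b" for a b by (simp add: algebra_simps)
    then show ?thesis unfolding sum_cube_root_rank[OF w] dcoeff_def N2_mod_symmetric[symmetric] by (simp add: w)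
  qed
  then show ?thesis using rank_gf_by_size[OF t cube_root_props(6)[OF w]] rank_series_cube_root(1)[OF t w] by simp
qed

lemma rank_diff_eq: "rank_diff 3 0 1 d q = (\<Sum>n. dcoeff (3 * n + d) * q ^ n)"
  by (simp add: rank_diff_def dcoeff_def)

lemma dcoeff_trisect:
  assumes t: "t \<noteq> 0" "norm t < 1" and w: "1 + w + w ^ 2 = 0"
  shows "(1 - w) * appell t w / psi t - 1 = rank_diff 3 0 1 0 (t ^ 3) + t * rank_diff 3 0 1 1 (t ^ 3) + t ^ 2 * rank_diff 3 0 1 2 (t ^ 3)"
proof -
  note h = dcoeff_gf[OF t w]
  have s: "(\<lambda>n. dcoeff (3 * n + d) * (t ^ 3) ^ n) sums rank_diff 3 0 1 d (t ^ 3)" for d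
  proof -
    have "(\<lambda>n. dcoeff n * t ^ n) summable_on range (\<lambda>n. 3 * n + d)"
      using has_sum_imp_summable[OF h] by (rule summable_on_subset_banach) auto
    then have "(\<lambda>n. dcoeff (3 * n + d) * t ^ (3 * n + d)) summable_on UNIV"
      by (subst (asm) summable_on_reindex) (auto simp: inj_on_def o_def)
    then have "summable (\<lambda>n. dcoeff (3 * n + d) * t ^ (3 * n + d))"
      by (rule summable_on_imp_summable)
    then have "summable (\<lambda>n. dcoeff (3 * n + d) * t ^ (3 * n + d) * (1 / t ^ d))" by (rule summable_mult2)
    moreover have "dcoeff (3 * n + d) * t ^ (3 * n + d) * (1 / t ^ d) = dcoeff (3 * n + d) * (t ^ 3) ^ n" for n
      using t by (simp add: power_add power_mult)
    ultimately have "summable (\<lambda>n. dcoeff (3 * n + d) * (t ^ 3) ^ n)" by (simp only:)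
    then show ?thesis unfolding rank_diff_eq by (rule summable_sums)
  qed
  have "(\<lambda>n. dcoeff (3 * n + 0) * (t ^ 3) ^ n + t * (dcoeff (3 * n + 1) * (t ^ 3) ^ n) + t ^ 2 * (dcoeff (3 * n + 2) * (t ^ 3) ^ n)) sums
     (rank_diff 3 0 1 0 (t ^ 3) + t * rank_diff 3 0 1 1 (t ^ 3) + t ^ 2 * rank_diff 3 0 1 2 (t ^ 3))"
    by (intro sums_add sums_mult s)
  moreover have "(\<lambda>n. sum (\<lambda>n. dcoeff n * t ^ n) {n * 3 ..< n * 3 + 3}) sums ((1 - w) * appell t w / psi t - 1)"
    by (rule sums_group[OF has_sum_imp_sums[OF h]]) simp
  moreover have "sum (\<lambda>n. dcoeff n * t ^ n) {n * 3 ..< n * 3 + 3} =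
      dcoeff (3 * n + 0) * (t ^ 3) ^ n + t * (dcoeff (3 * n + 1) * (t ^ 3) ^ n) + t ^ 2 * (dcoeff (3 * n + 2) * (t ^ 3) ^ n)" for n
  proof -
    have "{n * 3 ..< n * 3 + 3} = {3 * n, 3 * n + 1, 3 * n + 2}" by auto
    then have "sum f {n * 3 ..< n * 3 + 3} = f (3 * n + 0) + f (3 * n + 1) + f (3 * n + 2)" for f :: "nat \<Rightarrow> complex"
      by (simp add: add.assoc)
    moreover have "t ^ (3 * n + k) = (t ^ 3) ^ n * t ^ k" for k by (simp add: power_add power_mult)
    ultimately show ?thesis by (simp only: power_0 power_one_right mult_1_right mult_1_left mult_ac)
  qed
  ultimately show ?thesis using sums_unique2 by (simp only:) blast
qed

text \<open>Each of the first three products is split by exponents modulo 3. The multiples of 3 give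
  three copies of \<open>qp (u ^ 3) (u ^ 3)\<close>; the classes 1 and 2 collapse over the cube
  roots and, together with \<open>qp (u ^ 9) (u ^ 9)\<close>, form the fourth copy.\<close>

lemma prod_cube_roots_eta:
  assumes u: "norm u < 1" and w: "1 + w + w ^ 2 = 0"
  shows "qp u u * qp (w * u) (w * u) * qp (w ^ 2 * u) (w ^ 2 * u) * qp (u ^ 9) (u ^ 9) = qp (u ^ 3) (u ^ 3) ^ 4"
proof -
  note wp = cube_root_props[OF w]
  have w4: "w ^ 2 * w ^ 2 = w" "w ^ 4 = w" "(w ^ 2) ^ 2 = w" "(w ^ 2) ^ 3 = 1" "w ^ 6 = 1"
    using wp(1) power_add[of w 3 1] power_mult[of w 3 2] power_mult[of w 2 3] power_mult[of w 2 2] power_add[of w 2 2] by auto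
  have n: "norm (u ^ 3) < 1" using power_less_one_norm[OF u] by simp
  have e: "(u ^ 3) ^ 3 = u ^ 9" "(u ^ 2) ^ 3 = u ^ 6" "u ^ 3 * u ^ 3 = u ^ 6" "u ^ 3 * (u ^ 3) ^ 2 = u ^ 9"
    by (simp_all flip: power_mult power_add)
  have sp: "qp v v = qp v (u ^ 3) * qp (v ^ 2) (u ^ 3) * qp (u ^ 3) (u ^ 3)" if "norm v < 1" "v ^ 3 = u ^ 3" for v
    using qp_split3[OF that(1), of v] that(2) by (simp add: power2_eq_square power3_eq_cube mult.assoc)
  have nw: "norm (w * u) < 1" "norm (w ^ 2 * u) < 1" using u wp(6) by (simp_all add: norm_mult norm_power)
  have a: "qp u u = qp u (u ^ 3) * qp (u ^ 2) (u ^ 3) * qp (u ^ 3) (u ^ 3)" using sp u by blast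
  have b: "qp (w * u) (w * u) = qp (w * u) (u ^ 3) * qp (w ^ 2 * u ^ 2) (u ^ 3) * qp (u ^ 3) (u ^ 3)"
    using sp[OF nw(1)] wp(1) by (simp add: power_mult_distrib)
  have c: "qp (w ^ 2 * u) (w ^ 2 * u) = qp (w ^ 2 * u) (u ^ 3) * qp (w * u ^ 2) (u ^ 3) * qp (u ^ 3) (u ^ 3)"
    using sp[OF nw(2)] w4 by (simp add: power_mult_distrib)
  have d: "qp u (u ^ 3) * qp (w * u) (u ^ 3) * qp (w ^ 2 * u) (u ^ 3) = qp (u ^ 3) (u ^ 9)"
    using qp_mult_cube_roots[OF n w, of u] by (simp only: e)
  have f: "qp (u ^ 2) (u ^ 3) * qp (w * u ^ 2) (u ^ 3) * qp (w ^ 2 * u ^ 2) (u ^ 3) = qp (u ^ 6) (u ^ 9)"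
    using qp_mult_cube_roots[OF n w, of "u ^ 2"] by (simp only: e)
  have g: "qp (u ^ 3) (u ^ 3) = qp (u ^ 3) (u ^ 9) * qp (u ^ 6) (u ^ 9) * qp (u ^ 9) (u ^ 9)"
    using qp_split3[OF n, of "u ^ 3"] by (simp only: e)
  have "qp u u * qp (w * u) (w * u) * qp (w ^ 2 * u) (w ^ 2 * u) * qp (u ^ 9) (u ^ 9)
    = (qp u (u ^ 3) * qp (w * u) (u ^ 3) * qp (w ^ 2 * u) (u ^ 3)) * (qp (u ^ 2) (u ^ 3) * qp (w * u ^ 2) (u ^ 3) * qp (w ^ 2 * u ^ 2) (u ^ 3))
      * qp (u ^ 9) (u ^ 9) * qp (u ^ 3) (u ^ 3) ^ 3"
    unfolding a b c by (simp only: power3_eq_cube mult_ac)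
  also have "\<dots> = qp (u ^ 3) (u ^ 3) * qp (u ^ 3) (u ^ 3) ^ 3" unfolding d f by (simp only: g[symmetric])
  also have "\<dots> = qp (u ^ 3) (u ^ 3) ^ 4" by (simp add: power_add[symmetric] flip: power_Suc)
  finally show ?thesis .
qed

text \<open>By \<open>ps\<close>, \<open>psi v\<close> is a quotient of products
  \<open>qp (v ^ k) (v ^ k)\<close> for \<open>k\<close> in 1, 2, 4, so
  \<open>prod_cube_roots_eta\<close> is applied at \<open>t\<close>, \<open>t ^ 2\<close> and
  \<open>t ^ 4\<close>. Squaring exchanges \<open>w\<close> and \<open>w ^ 2\<close>, fourth powers
  fix them.\<close>

lemma prod_cube_roots_psi:
  assumes t: "t \<noteq> 0" "norm t < 1" and w: "1 + w + w ^ 2 = 0"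
  shows "psi t * psi (w * t) * psi (w ^ 2 * t) * psi (t ^ 9) = psi (t ^ 3) ^ 4"
proof -
  note wp = cube_root_props[OF w]
  have "w ^ 4 = w ^ 3 * w" "(w ^ 2) ^ 2 = w ^ 3 * w" "(w ^ 2) ^ 4 = (w ^ 3) ^ 2 * w ^ 2"
    by (simp_all flip: power_mult power_add power_Suc2)
  then have w4: "(w ^ 2) ^ 2 = w" "(w ^ 2) ^ 4 = w ^ 2" "w ^ 4 = w"
    by (simp_all only: wp(1) power_one mult_1_left)
  have wt: "w * t \<noteq> 0" "norm (w * t) < 1" "w ^ 2 * t \<noteq> 0" "norm (w ^ 2 * t) < 1"
    using t wp by (simp_all add: norm_mult norm_power)
  note tn = power_less_one_norm[OF t(2)]
  have n: "norm (t ^ 2) < 1" "norm (t ^ 4) < 1" "norm (t ^ 3) < 1" "norm (t ^ 9) < 1" "norm (t ^ 6) < 1" "norm (t ^ 12) < 1" "norm (t ^ 18) < 1" "norm (t ^ 36) < 1" using tn by auto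
  have ps: "psi v * qp (v ^ 2) (v ^ 2) = qp (v ^ 4) (v ^ 4) * qp v v" if "v \<noteq> 0" "norm v < 1" for v
    using psi_eq(2)[OF that] qp_split2[OF that(2), of v] by (simp add: power2_eq_square mult_ac)
  have e1: "(w * t) ^ 2 = w ^ 2 * t ^ 2" "(w * t) ^ 4 = w * t ^ 4" "(w ^ 2 * t) ^ 2 = w * t ^ 2" "(w ^ 2 * t) ^ 4 = w ^ 2 * t ^ 4"
    by (simp_all only: power_mult_distrib w4)
  have e2: "(t ^ 2) ^ 9 = t ^ 18" "(t ^ 2) ^ 3 = t ^ 6" "(t ^ 4) ^ 9 = t ^ 36" "(t ^ 4) ^ 3 = t ^ 12" "(t ^ 3) ^ 2 = t ^ 6" "(t ^ 3) ^ 4 = t ^ 12"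
    "(t ^ 9) ^ 2 = t ^ 18" "(t ^ 9) ^ 4 = t ^ 36"
    by (simp_all flip: power_mult)
  note P1 = prod_cube_roots_eta[OF t(2) w] and P2 = prod_cube_roots_eta[OF n(1) w, unfolded e2] and P4 = prod_cube_roots_eta[OF n(2) w, unfolded e2]
  have n2: "norm (w * t ^ 2) < 1" "norm (w ^ 2 * t ^ 2) < 1" using n(1) wp(6) by (simp_all add: norm_mult norm_power)
  define X where "X = qp (t ^ 2) (t ^ 2) * qp (w * t ^ 2) (w * t ^ 2) * qp (w ^ 2 * t ^ 2) (w ^ 2 * t ^ 2) * qp (t ^ 18) (t ^ 18)"
  have X: "X \<noteq> 0" unfolding X_def using n n2 by (simp add: qp_nonzero)
  have "psi t * psi (w * t) * psi (w ^ 2 * t) * psi (t ^ 9) * X =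
     (psi t * qp (t ^ 2) (t ^ 2)) * (psi (w * t) * qp (w ^ 2 * t ^ 2) (w ^ 2 * t ^ 2)) * (psi (w ^ 2 * t) * qp (w * t ^ 2) (w * t ^ 2)) * (psi (t ^ 9) * qp (t ^ 18) (t ^ 18))"
    unfolding X_def by (simp only: mult_ac)
  also have "\<dots> = (qp (t ^ 4) (t ^ 4) * qp t t) * (qp (w * t ^ 4) (w * t ^ 4) * qp (w * t) (w * t)) *
       (qp (w ^ 2 * t ^ 4) (w ^ 2 * t ^ 4) * qp (w ^ 2 * t) (w ^ 2 * t)) * (qp (t ^ 36) (t ^ 36) * qp (t ^ 9) (t ^ 9))"
    using ps[OF t] ps[OF wt(1,2)] ps[OF wt(3,4)] ps[of "t ^ 9"] t n by (simp only: e1 e2) simp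
  also have "\<dots> = (qp (t ^ 4) (t ^ 4) * qp (w * t ^ 4) (w * t ^ 4) * qp (w ^ 2 * t ^ 4) (w ^ 2 * t ^ 4) * qp (t ^ 36) (t ^ 36))
      * (qp t t * qp (w * t) (w * t) * qp (w ^ 2 * t) (w ^ 2 * t) * qp (t ^ 9) (t ^ 9))"
    by (simp only: mult_ac)
  also have "\<dots> = (qp (t ^ 12) (t ^ 12) * qp (t ^ 3) (t ^ 3)) ^ 4" unfolding P1 P4 by (simp only: power_mult_distrib)
  also have "\<dots> = (psi (t ^ 3) * qp (t ^ 6) (t ^ 6)) ^ 4" using ps[of "t ^ 3"] t n by (simp add: e2)
  also have "\<dots> = psi (t ^ 3) ^ 4 * X" unfolding X_def P2 by (simp only: power_mult_distrib)
  finally show ?thesis using X by simp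
qed

text \<open>Combines the two evaluations of \<open>jac t w\<close>: as \<open>psi t\<close> times a
  product in \<open>t ^ 3\<close>, and as the class 0 part minus \<open>theta1 t 1\<close>.\<close>

lemma psi_linear:
  assumes t: "t \<noteq> 0" "norm t < 1"
  shows "psi t = jac (t ^ 9) 1 / qp (- (t ^ 3)) (t ^ 6) - t * psi (t ^ 9)"
proof -
  note v = jac_values[OF t cbrt1]
  have "psi t * qp (- (t ^ 3)) (t ^ 6) = jac (t ^ 9) 1 - t * psi (t ^ 9) * qp (- (t ^ 3)) (t ^ 6)"
    using v(1,2,4) by simp
  then show ?thesis using v(5) by (simp add: field_simps)
qed

section \<open>The notation of the statement, and comparison of the three cube roots\<close>

lemma qpoch_eq:
  assumes q: "norm q < 1"
  shows "qpoch as q = (\<Prod>a\<leftarrow>as. qp a q)"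
proof -
  have "convergent_prod (\<lambda>k. \<Prod>a\<leftarrow>as. 1 - a * q ^ k) \<and> (\<Prod>k. \<Prod>a\<leftarrow>as. 1 - a * q ^ k) = (\<Prod>a\<leftarrow>as. qp a q)"
  proof (induction as)
    case (Cons a as)
    then show ?case
      using convergent_prod_mult[OF convergent_qp[OF q, of a], of "\<lambda>k. \<Prod>a\<leftarrow>as. 1 - a * q ^ k"]
        prodinf_mult[OF convergent_qp[OF q, of a], of "\<lambda>k. \<Prod>a\<leftarrow>as. 1 - a * q ^ k"]
      by (simp add: qp_def)
  qed simp
  then show ?thesis by (simp add: qpoch_def)
qed

text \<open>The factor \<open>q powi (6 * n)\<close>, up to \<open>q ^ 4\<close>, is the numerator
  in \<open>D / (1 - D) = 1 / (1 - D) - 1\<close> for \<open>D = q powi (6 * n + 4)\<close>, which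
  produces \<open>appell (q ^ 3) (q ^ 4)\<close> and \<open>psi (q ^ 3)\<close>. The shift from
  \<open>1 / q ^ 2\<close> to \<open>q ^ 4\<close>, followed by inversion, returns the argument to
  \<open>q ^ 2\<close>.\<close>

lemma appell_sum_eq:
  assumes q: "q \<noteq> 0" "norm q < 1"
  shows "q ^ 3 * (\<Sum>\<^sub>\<infinity>n\<in>(UNIV :: int set). (- 1) powi n * q powi (6 * n ^ 2 + 9 * n) / (1 - q powi (6 * n + 4)))
     = appell (q ^ 3) (q ^ 2) - psi (q ^ 3)"
proof -
  have t: "q ^ 3 \<noteq> 0" "norm (q ^ 3) < 1" using q power_less_one_norm[OF q(2)] by auto
  have e: "(q ^ 3) ^ 2 = q ^ 6" by (simp flip: power_mult)
  have n6: "norm (q ^ 6) < 1" using power_less_one_norm[OF q(2)] by auto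
  define a where "a = (\<lambda>n::int. (q ^ 6) powi (n ^ 2) * (- (q ^ 3)) powi n)"
  have P: "q powi m \<noteq> 1" if "m \<noteq> 0" for m :: int
  proof
    assume "q powi m = 1"
    moreover have "(q ^ 2) powi m = (q powi m) ^ 2"
      using power_int_mult[of q 2 m] power_int_mult[of q m 2] by (simp add: mult.commute)
    ultimately show False using q2_powi_ne_1[OF q that] by simp
  qed
  have pw: "q ^ 4 * (q ^ 6) powi n = q powi (6 * n + 4)" "(1 / q ^ 2) * (q ^ 6) powi n = q powi (6 * n - 2)" for n
    using power_int_mult[of q 6 n] q by (simp_all add: power_int_add power_int_diff)
  have np4: "q ^ 4 * ((q ^ 3) ^ 2) powi n \<noteq> 1" for n
    unfolding e pw by (rule P) presburger
  have np2: "(1 / q ^ 2) * ((q ^ 3) ^ 2) powi n \<noteq> 1" for n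
    unfolding e pw by (rule P) presburger
  have A: "((\<lambda>n. a n / (1 - q ^ 4 * (q ^ 6) powi n)) has_sum appell (q ^ 3) (q ^ 4)) UNIV"
    using appell_on_summable[OF t _ np4, of UNIV] q by (simp add: appell_on_def a_def e)
  have B: "(a has_sum psi (q ^ 3)) UNIV"
    using summable_theta(2)[OF n6, of "- (q ^ 3)"] q by (simp add: psi_def jac_def a_def[abs_def] e)
  have "((\<lambda>n. (1 / q ^ 4) * (a n / (1 - q ^ 4 * (q ^ 6) powi n) - a n)) has_sum (1 / q ^ 4) * (appell (q ^ 3) (q ^ 4) - psi (q ^ 3))) UNIV"
    using has_sum_cmult_right[OF has_sum_add[OF A has_sum_cmult_right[OF B, of "- 1"]], of "1 / q ^ 4"] by simp
  moreover have "(1 / q ^ 4) * (a n / (1 - q ^ 4 * (q ^ 6) powi n) - a n) = (- 1) powi n * q powi (6 * n ^ 2 + 9 * n) / (1 - q powi (6 * n + 4))" for n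
  proof -
    define D where "D = 1 - q powi (6 * n + 4)"
    have D: "D \<noteq> 0" unfolding D_def using P[of "6 * n + 4"] by (auto; presburger)
    have "(- (q ^ 3)) powi n = (- 1) powi n * q powi (3 * n)"
      using power_int_mult[of q 3 n] power_int_mult_distrib[of "- 1" "q ^ 3" n] by simp
    moreover have "(q ^ 6) powi (n ^ 2) = q powi (6 * n ^ 2)" using power_int_mult[of q 6 "n ^ 2"] by simp
    ultimately have an: "a n = (- 1) powi n * q powi (6 * n ^ 2 + 3 * n)"
      using q by (simp add: a_def power_int_add)
    have "(1 / q ^ 4) * (a n / D - a n) = (1 / q ^ 4) * (a n * (1 - D) / D)" using D by (simp add: field_simps)
    also have "1 - D = q powi (6 * n + 4)" by (simp add: D_def)
    also have "(1 / q ^ 4) * (a n * q powi (6 * n + 4) / D) = (- 1) powi n * q powi (6 * n ^ 2 + 9 * n) / D"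
    proof -
      have "q powi (6 * n + 4) = q powi (6 * n) * q ^ 4" using q by (simp add: power_int_add)
      moreover have "q powi (6 * n ^ 2 + 9 * n) = q powi (6 * n ^ 2 + 3 * n) * q powi (6 * n)"
        using q by (simp flip: power_int_add add: add.assoc)
      ultimately show ?thesis using q by (simp add: an)
    qed
    finally show ?thesis unfolding pw D_def .
  qed
  ultimately have S: "(\<Sum>\<^sub>\<infinity>n\<in>(UNIV :: int set). (- 1) powi n * q powi (6 * n ^ 2 + 9 * n) / (1 - q powi (6 * n + 4))) = (1 / q ^ 4) * (appell (q ^ 3) (q ^ 4) - psi (q ^ 3))"
    by (simp only: infsumI)
  have "(q ^ 3) ^ 2 * (1 / q ^ 2) = q ^ 4" unfolding e using q by (simp add: field_simps flip: power_add)
  then have "appell (q ^ 3) (q ^ 4) = - (q ^ 3) * (1 / q ^ 2) ^ 2 * appell (q ^ 3) (1 / q ^ 2) + psi (q ^ 3) * (1 - q ^ 3 * (1 / q ^ 2))"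
    using appell_shift[OF t _ np2] q by simp
  moreover have "appell (q ^ 3) (1 / q ^ 2) = - (q ^ 2) * appell (q ^ 3) (q ^ 2)"
    using appell_on_inverse[OF t, of "q ^ 2" UNIV] q by simp
  moreover have "- (q ^ 3) * (1 / q ^ 2) ^ 2 * (- (q ^ 2)) = q" "q ^ 3 * (1 / q ^ 2) = q"
    using q by (simp_all add: power2_eq_square power3_eq_cube field_simps)
  ultimately have "appell (q ^ 3) (q ^ 4) = q * appell (q ^ 3) (q ^ 2) + psi (q ^ 3) * (1 - q)"
    by (metis mult.assoc)
  then have "appell (q ^ 3) (q ^ 4) - psi (q ^ 3) = q * (appell (q ^ 3) (q ^ 2) - psi (q ^ 3))" by (simp add: algebra_simps)
  then show ?thesis unfolding S using q by (simp add: power_add[of q 3 1, simplified])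
qed

text \<open>The part of \<open>psi t\<close> that is free of \<open>t\<close> when
  \<open>q = t ^ 3\<close>: by \<open>psi_linear\<close>,
  \<open>psi t = ptail q - t * psi (q ^ 3)\<close>.\<close>

definition ptail :: "complex \<Rightarrow> complex" where
  "ptail q = jac (q ^ 3) 1 / qp (- q) (q ^ 2)"

text \<open>\<open>prod_cube_roots_psi\<close> turns \<open>1 / psi t\<close> into a multiple of
  \<open>psi (w * t) * psi (w ^ 2 * t)\<close>, a product of two linear polynomials in
  \<open>t\<close>.\<close>

lemma trisected_identity:
  assumes t: "t \<noteq> 0" "norm t < 1" and q: "q = t ^ 3" and w: "1 + w + w ^ 2 = (0::complex)"
  shows "rank_diff 3 0 1 0 q + t * rank_diff 3 0 1 1 q + t ^ 2 * rank_diff 3 0 1 2 q + 1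
    = - 3 * (appell (q ^ 3) (q ^ 2) / psi (q ^ 3) - 1)
      + (ptail q ^ 2 + t * (ptail q * psi (q ^ 3)) + t ^ 2 * psi (q ^ 3) ^ 2) / psi q"
proof -
  note wp = cube_root_props[OF w]
  note tn = power_less_one_norm[OF t(2)]
  have e: "t ^ 9 = q ^ 3" "t ^ 6 = q ^ 2" by (simp_all add: q flip: power_mult)
  have qn: "q \<noteq> 0" "norm q < 1" "q ^ 3 \<noteq> 0" "norm (q ^ 3) < 1" using t tn[of 3] tn[of 9] by (auto simp: q simp flip: power_mult)
  have main: "(1 - w) * appell t w / psi t = - 3 * (appell (q ^ 3) (q ^ 2) / psi (q ^ 3) - 1) + psi q ^ 3 / (psi t * psi (q ^ 3))"
    using appell_at_cube_root[OF t w] by (simp add: appell9_def[OF t w] e flip: q)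
  have lin: "psi v = ptail q - v * psi (q ^ 3)" if "v \<noteq> 0" "norm v < 1" "v ^ 3 = q" for v
  proof -
    have "v ^ 9 = q ^ 3" "v ^ 6 = q ^ 2" by (simp_all add: that(3)[symmetric] flip: power_mult)
    then show ?thesis using psi_linear[OF that(1,2)] by (simp add: ptail_def that(3))
  qed
  have w6: "(w ^ 2) ^ 3 = 1" using wp(1) power_mult[of w 3 2] power_mult[of w 2 3] by simp
  have wt: "w * t \<noteq> 0" "norm (w * t) < 1" "(w * t) ^ 3 = q" "w ^ 2 * t \<noteq> 0" "norm (w ^ 2 * t) < 1" "(w ^ 2 * t) ^ 3 = q"
    using t wp w6 by (simp_all add: norm_mult norm_power power_mult_distrib q)
  have nz: "psi t \<noteq> 0" "psi q \<noteq> 0" "psi (q ^ 3) \<noteq> 0" using psi_nonzero[OF t] psi_nonzero[OF qn(1,2)] psi_nonzero[OF qn(3,4)] by simp_all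
  have "psi t * psi (w * t) * psi (w ^ 2 * t) * psi (q ^ 3) = psi q ^ 4"
    using prod_cube_roots_psi[OF t w] by (simp add: e flip: q)
  then have "psi q ^ 3 * psi q = psi t * psi (q ^ 3) * (psi (w * t) * psi (w ^ 2 * t))"
    by (simp add: mult_ac flip: power_Suc power_Suc2)
  then have "psi q ^ 3 / (psi t * psi (q ^ 3)) = psi (w * t) * psi (w ^ 2 * t) / psi q"
    using nz by (simp add: field_simps)
  also have "psi (w * t) * psi (w ^ 2 * t) = ptail q ^ 2 + t * (ptail q * psi (q ^ 3)) + t ^ 2 * psi (q ^ 3) ^ 2"
  proof -
    have "(P - w * t * y) * (P - w ^ 2 * t * y) = P ^ 2 + t * (P * y) + t ^ 2 * y ^ 2 - (1 + w + w ^ 2) * (t * P * y) + (w ^ 3 - 1) * (t ^ 2 * y ^ 2)" for P y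
      by (simp add: algebra_simps power2_eq_square power3_eq_cube)
    then show ?thesis unfolding lin[OF wt(1-3)] lin[OF wt(4-6)] by (simp add: w wp(1))
  qed
  finally show ?thesis using dcoeff_trisect[OF t w] main by (simp add: q algebra_simps)
qed

lemma exists_cube_root: "\<exists>t::complex. t ^ 3 = q"
proof (cases "q = 0")
  case False
  then have "exp (Ln q / 3) ^ 3 = q" by (simp flip: exp_of_nat_mult)
  then show ?thesis by blast
qed auto

text \<open>Adding the three equations isolates \<open>a\<close>; eliminating between the first and
  the third then isolates \<open>b\<close>.\<close>

lemma vandermonde_cube:
  fixes a b c t w :: complex
  assumes w: "1 + w + w ^ 2 = 0" and t: "t \<noteq> 0"
    and "a + t * b + t ^ 2 * c = 0" "a + (w * t) * b + (w * t) ^ 2 * c = 0" "a + (w ^ 2 * t) * b + (w ^ 2 * t) ^ 2 * c = 0"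
  shows "a = 0" "b = 0" "c = 0"
proof -
  note wp = cube_root_props[OF w]
  have w4: "w ^ 2 * w ^ 2 = w" using wp(1) by (simp add: power2_eq_square power3_eq_cube mult.assoc)
  have 1: "a + t * b + t ^ 2 * c = 0" "a + w * (t * b) + w ^ 2 * (t ^ 2 * c) = 0" "a + w ^ 2 * (t * b) + w * (t ^ 2 * c) = 0"
    using assms(3-5) w4 by (simp_all add: power_mult_distrib power2_eq_square[of "w ^ 2"] mult_ac)
  have "3 * a + (1 + w + w ^ 2) * (t * b) + (1 + w + w ^ 2) * (t ^ 2 * c)
     = (a + t * b + t ^ 2 * c) + (a + w * (t * b) + w ^ 2 * (t ^ 2 * c)) + (a + w ^ 2 * (t * b) + w * (t ^ 2 * c))"
    by (simp add: algebra_simps)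
  then show a: "a = 0" unfolding 1 w by simp
  have "t * b + t ^ 2 * c = 0" "w ^ 2 * (t * b) + w * (t ^ 2 * c) = 0" using 1(1,3) by (simp_all add: a)
  moreover have "(w ^ 2 - w) * (t * b) = (w ^ 2 * (t * b) + w * (t ^ 2 * c)) - w * (t * b + t ^ 2 * c)"
    by (simp add: algebra_simps)
  ultimately have "(w ^ 2 - w) * (t * b) = 0" by simp
  moreover have "w ^ 2 - w \<noteq> 0" using wp(2,3) by (simp add: power2_eq_square)
  ultimately show b: "b = 0" using t by simp
  show "c = 0" using 1(1) a b t by simp
qed

text \<open>The identity holds at all three cube roots of \<open>q\<close> with the same
  coefficients \<open>a\<close>, \<open>b\<close>, \<open>c\<close>, which therefore vanish.\<close>

lemma rank_diff_values:
  assumes q: "q \<noteq> 0" "norm q < 1"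
  shows "rank_diff 3 0 1 0 q = - 1 - 3 * (appell (q ^ 3) (q ^ 2) / psi (q ^ 3) - 1) + ptail q ^ 2 / psi q"
    and "rank_diff 3 0 1 1 q = ptail q * psi (q ^ 3) / psi q"
    and "rank_diff 3 0 1 2 q = psi (q ^ 3) ^ 2 / psi q"
proof -
  let ?w = cbrt1
  note w = cbrt1
  note wp = cube_root_props[OF w]
  obtain t where t: "t ^ 3 = q" using exists_cube_root by blast
  have t0: "t \<noteq> 0" using t q by auto
  have "norm t < 1"
  proof (rule ccontr)
    assume "\<not> ?thesis"
    then have "1 \<le> norm t ^ 3" by (intro one_le_power) auto
    then show False using q t by (simp flip: norm_power)
  qed
  note tt = t0 this t[symmetric]
  have w6: "(?w ^ 2) ^ 3 = 1" using wp(1) power_mult[of ?w 3 2] power_mult[of ?w 2 3] by simp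
  have wt: "?w * t \<noteq> 0" "norm (?w * t) < 1" "q = (?w * t) ^ 3" "?w ^ 2 * t \<noteq> 0" "norm (?w ^ 2 * t) < 1" "q = (?w ^ 2 * t) ^ 3"
    using tt wp w6 by (simp_all add: norm_mult norm_power power_mult_distrib)
  define a where "a = rank_diff 3 0 1 0 q + 1 + 3 * (appell (q ^ 3) (q ^ 2) / psi (q ^ 3) - 1) - ptail q ^ 2 / psi q"
  define b where "b = rank_diff 3 0 1 1 q - ptail q * psi (q ^ 3) / psi q"
  define c where "c = rank_diff 3 0 1 2 q - psi (q ^ 3) ^ 2 / psi q"
  have *: "a + v * b + v ^ 2 * c = 0" if "v \<noteq> 0" "norm v < 1" "q = v ^ 3" for v
  proof -
    have "R0 + 1 + 3 * F - P / y + v * (R1 - Q / y) + v ^ 2 * (R2 - S / y) = 0"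
      if "R0 + v * R1 + v ^ 2 * R2 + 1 = - 3 * F + (P + v * Q + v ^ 2 * S) / y" for R0 R1 R2 F P Q S y
      using that by (simp add: algebra_simps add_divide_distrib)
    then show ?thesis unfolding a_def b_def c_def using trisected_identity[OF that w] by blast
  qed
  note z = vandermonde_cube[OF w t0 *[OF tt] *[OF wt(1-3)] *[OF wt(4-6)]]
  show "rank_diff 3 0 1 0 q = - 1 - 3 * (appell (q ^ 3) (q ^ 2) / psi (q ^ 3) - 1) + ptail q ^ 2 / psi q"
    using z(1) by (simp add: a_def algebra_simps)
  show "rank_diff 3 0 1 1 q = ptail q * psi (q ^ 3) / psi q" using z(2) by (simp add: b_def)
  show "rank_diff 3 0 1 2 q = psi (q ^ 3) ^ 2 / psi q" using z(3) by (simp add: c_def)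
qed

section \<open>Products over residue classes as quotients of products
  \<open>qp (b ^ k) (b ^ k)\<close>\<close>

lemma qp_odd:
  assumes "norm b < 1" "b \<noteq> 0"
  shows "qp b (b ^ 2) = qp b b / qp (b ^ 2) (b ^ 2)"
  using qp_split2[OF assms(1), of b] qp_nonzero[of "b ^ 2" "b ^ 2"] power_less_one_norm[OF assms(1), of 2]
  by (simp add: power2_eq_square)

lemma qp_minus:
  assumes "norm b < 1"
  shows "qp (- b) b = qp (b ^ 2) (b ^ 2) / qp b b"
  using qp_mult_minus[OF assms, of b] qp_nonzero[OF assms assms] by (simp add: field_simps)

lemma qp_minus_odd:
  assumes "norm b < 1" "b \<noteq> 0"
  shows "qp (- b) (b ^ 2) = qp (b ^ 2) (b ^ 2) ^ 2 / (qp b b * qp (b ^ 4) (b ^ 4))"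
proof -
  note n = power_less_one_norm[OF assms(1)]
  have "qp b (b ^ 2) * qp (- b) (b ^ 2) = qp (b ^ 2) ((b ^ 2) ^ 2)"
    using qp_mult_minus[of "b ^ 2" b] n[of 2] by simp
  also have "\<dots> = qp (b ^ 2) (b ^ 2) / qp ((b ^ 2) ^ 2) ((b ^ 2) ^ 2)"
    using qp_odd[of "b ^ 2"] n[of 2] assms by simp
  finally show ?thesis
    using qp_odd[OF assms] qp_nonzero[OF assms(1) assms(1)] n[of 2] n[of 4] qp_nonzero[of "b ^ 2" "b ^ 2"] qp_nonzero[of "b ^ 4" "b ^ 4"]
    by (simp add: field_simps power2_eq_square[of "qp _ _"] flip: power_mult)
qed

lemma qp_nonmultiples_3:
  assumes "norm b < 1"
  shows "qp b (b ^ 3) * qp (b ^ 2) (b ^ 3) = qp b b / qp (b ^ 3) (b ^ 3)"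
proof -
  have "b * b = b ^ 2" "b * b ^ 2 = b ^ 3" by (simp_all add: power2_eq_square power3_eq_cube)
  then have "qp b b = qp b (b ^ 3) * qp (b ^ 2) (b ^ 3) * qp (b ^ 3) (b ^ 3)"
    using qp_split3[OF assms, of b] by (simp only:)
  then show ?thesis using qp_nonzero[of "b ^ 3" "b ^ 3"] power_less_one_norm[OF assms, of 3] by simp
qed

text \<open>The odd exponents with the odd multiples of 3 removed.\<close>

lemma qp_coprime_6:
  assumes "norm b < 1" "b \<noteq> 0"
  shows "qp b (b ^ 6) * qp (b ^ 5) (b ^ 6) = qp b b * qp (b ^ 6) (b ^ 6) / (qp (b ^ 2) (b ^ 2) * qp (b ^ 3) (b ^ 3))"
proof -
  note n = power_less_one_norm[OF assms(1)]
  have nz: "qp (b ^ 2) (b ^ 2) \<noteq> 0" "qp (b ^ 3) (b ^ 3) \<noteq> 0" "qp (b ^ 6) (b ^ 6) \<noteq> 0" "qp (b ^ 3) (b ^ 6) \<noteq> 0"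
    using n by (simp_all add: qp_nonzero)
  have e: "b * b ^ 2 = b ^ 3" "b * (b ^ 2) ^ 2 = b ^ 5" "b * b ^ 4 = b ^ 5" "(b ^ 2) ^ 3 = b ^ 6" "(b ^ 3) ^ 2 = b ^ 6"
    by (simp_all flip: power_mult power_add power_Suc)
  have "qp b (b ^ 6) * qp (b ^ 3) (b ^ 6) * qp (b ^ 5) (b ^ 6) = qp b b / qp (b ^ 2) (b ^ 2)"
    using qp_split3[OF n[of 2], of b] qp_odd[OF assms] by (simp add: e)
  moreover have "qp (b ^ 3) (b ^ 6) = qp (b ^ 3) (b ^ 3) / qp (b ^ 6) (b ^ 6)"
    using qp_odd[of "b ^ 3"] n[of 3] assms by (simp add: e)
  ultimately show ?thesis using nz by (simp add: field_simps)
qed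

text \<open>After \<open>rank_diff_values\<close>, every product is expressed by the functions
  \<open>f_k = qp (q ^ k) (q ^ k)\<close> with \<open>k\<close> dividing 12. The theta parts then
  become equalities between monomials in these.\<close>

theorem theorem1p1:
  fixes q :: complex
  assumes "0 < norm q" and "norm q < 1"
  shows "rank_diff 3 0 1 0 q =
           - 1
           - 3 * q ^ 3 * (qpoch [- (q ^ 3)] (q ^ 6) / qpoch [q ^ 6] (q ^ 6))
               * (\<Sum>\<^sub>\<infinity>n\<in>(UNIV :: int set).
                    (- 1) powi n * q powi (6 * n ^ 2 + 9 * n) / (1 - q powi (6 * n + 4)))
           + qpoch [q ^ 6] (q ^ 6) ^ 4 * qpoch [- (q ^ 3)] (q ^ 3) ^ 4 * qpoch [q] (q ^ 2)
               / (qpoch [q ^ 4] (q ^ 4) * qpoch [q ^ 2, q ^ 10, q ^ 12] (q ^ 12) ^ 2)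
       \<and> rank_diff 3 0 1 1 q =
           qpoch [- (q ^ 3), q ^ 6] (q ^ 6) / qpoch [q ^ 2, q ^ 4] (q ^ 6)
       \<and> rank_diff 3 0 1 2 q =
           qpoch [q ^ 3] (q ^ 3) * qpoch [- (q ^ 6)] (q ^ 6)
             / (qpoch [q, q ^ 5] (q ^ 6) * qpoch [q ^ 4, q ^ 8] (q ^ 12))"
proof -
  have q: "q \<noteq> 0" "norm q < 1" using assms by auto
  note n = power_less_one_norm[OF q(2)]
  have qn: "norm (q ^ 2) < 1" "norm (q ^ 3) < 1" "norm (q ^ 4) < 1" "norm (q ^ 6) < 1" "norm (q ^ 12) < 1"
    using n by auto
  note qpochs = qpoch_eq[OF qn(1)] qpoch_eq[OF qn(2)] qpoch_eq[OF qn(3)] qpoch_eq[OF qn(4)] qpoch_eq[OF qn(5)]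
  define f1 where "f1 = qp q q"
  define f2 where "f2 = qp (q ^ 2) (q ^ 2)"
  define f3 where "f3 = qp (q ^ 3) (q ^ 3)"
  define f4 where "f4 = qp (q ^ 4) (q ^ 4)"
  define f6 where "f6 = qp (q ^ 6) (q ^ 6)"
  define f12 where "f12 = qp (q ^ 12) (q ^ 12)"
  note fs = f1_def[symmetric] f2_def[symmetric] f3_def[symmetric] f4_def[symmetric] f6_def[symmetric] f12_def[symmetric]
  have nz: "f1 \<noteq> 0" "f2 \<noteq> 0" "f3 \<noteq> 0" "f4 \<noteq> 0" "f6 \<noteq> 0" "f12 \<noteq> 0"
    unfolding f1_def f2_def f3_def f4_def f6_def f12_def using q qn by (simp_all add: qp_nonzero)
  have e: "(q ^ 3) ^ 2 = q ^ 6" "(q ^ 3) ^ 4 = q ^ 12" "(q ^ 6) ^ 2 = q ^ 12" "(q ^ 2) ^ 6 = q ^ 12" "(q ^ 2) ^ 5 = q ^ 10"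
    "(q ^ 2) ^ 2 = q ^ 4" "(q ^ 2) ^ 3 = q ^ 6" "(q ^ 4) ^ 3 = q ^ 12" "(q ^ 4) ^ 2 = q ^ 8"
    by (simp_all flip: power_mult)
  have o1: "qp q (q ^ 2) = f1 / f2" using qp_odd[OF q(2,1)] by (simp only: fs)
  have o2: "qp (- q) (q ^ 2) = f2 ^ 2 / (f1 * f4)" using qp_minus_odd[OF q(2,1)] by (simp only: fs)
  have o3: "qp (- (q ^ 3)) (q ^ 6) = f6 ^ 2 / (f3 * f12)"
    using qp_minus_odd[OF qn(2)] q by (simp add: e fs)
  have o4: "qp (- (q ^ 3)) (q ^ 3) = f6 / f3" using qp_minus[OF qn(2)] by (simp only: e fs)
  have o5: "qp (- (q ^ 6)) (q ^ 6) = f12 / f6" using qp_minus[OF qn(4)] by (simp only: e fs)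
  have o6: "qp q (q ^ 6) * qp (q ^ 5) (q ^ 6) = f1 * f6 / (f2 * f3)" using qp_coprime_6[OF q(2,1)] by (simp only: fs)
  \<comment> \<open>The coprime-to-6 pattern in base \<open>q ^ 2\<close>: exponents 2 and 10 modulo
    12.\<close>
  have o7: "qp (q ^ 2) (q ^ 12) * qp (q ^ 10) (q ^ 12) = f2 * f12 / (f4 * f6)"
    using qp_coprime_6[OF qn(1)] q by (simp add: e fs)
  have o8: "qp (q ^ 2) (q ^ 6) * qp (q ^ 4) (q ^ 6) = f2 / f6" using qp_nonmultiples_3[OF qn(1)] by (simp only: e fs)
  have o9: "qp (q ^ 4) (q ^ 12) * qp (q ^ 8) (q ^ 12) = f4 / f12" using qp_nonmultiples_3[OF qn(3)] by (simp only: e fs)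
  have p1: "psi q = f1 * f4 / f2" using psi_eq(2)[OF q] by (simp add: o1 fs)
  have p3: "psi (q ^ 3) = f3 * f12 / f6" using psi_eq(1)[of "q ^ 3"] q qn o3 nz by (simp add: e fs power2_eq_square)
  have "jac (q ^ 3) 1 = f6 * (f6 ^ 2 / (f3 * f12)) ^ 2"
    using jacobi_triple_product[of "q ^ 3" 1] q qn by (simp add: e o3 fs power2_eq_square mult.assoc)
  then have pt: "ptail q = f1 * f4 * f6 ^ 5 / (f2 ^ 2 * f3 ^ 2 * f12 ^ 2)"
    using nz by (simp add: ptail_def o2 field_simps) (simp add: power2_eq_square eval_nat_numeral)
  define S where "S = (\<Sum>\<^sub>\<infinity>n\<in>(UNIV :: int set). (- 1) powi n * q powi (6 * n ^ 2 + 9 * n) / (1 - q powi (6 * n + 4)))"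
  have psi3: "psi (q ^ 3) \<noteq> 0" using p3 nz by simp
  have "q ^ 3 * S = appell (q ^ 3) (q ^ 2) - psi (q ^ 3)" unfolding S_def by (rule appell_sum_eq[OF q])
  then have "appell (q ^ 3) (q ^ 2) / psi (q ^ 3) - 1 = q ^ 3 * S / psi (q ^ 3)" using psi3 by (simp add: diff_divide_distrib)
  also have "\<dots> = q ^ 3 * (qp (- (q ^ 3)) (q ^ 6) / qp (q ^ 6) (q ^ 6)) * S"
    unfolding p3 o3 fs using nz by (simp add: field_simps power2_eq_square)
  finally have S: "3 * (appell (q ^ 3) (q ^ 2) / psi (q ^ 3) - 1) = 3 * q ^ 3 * (qp (- (q ^ 3)) (q ^ 6) / qp (q ^ 6) (q ^ 6)) * S"
    by (simp only: mult.assoc)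
  have 0: "ptail q ^ 2 / psi q = f6 ^ 4 * (f6 / f3) ^ 4 * (f1 / f2) / (f4 * (f2 * f12 / (f4 * f6) * f12) ^ 2)"
    unfolding pt p1 using nz by (simp add: field_simps power_mult_distrib power_divide) (simp add: eval_nat_numeral)
  have 1: "ptail q * psi (q ^ 3) / psi q = f6 ^ 2 / (f3 * f12) * f6 / (f2 / f6)"
    unfolding pt p1 p3 using nz by (simp add: field_simps) (simp add: eval_nat_numeral)
  have 2: "psi (q ^ 3) ^ 2 / psi q = f3 * (f12 / f6) / (f1 * f6 / (f2 * f3) * (f4 / f12))"
    unfolding p1 p3 using nz by (simp add: field_simps power2_eq_square)
  have "qpoch [q ^ 2, q ^ 10, q ^ 12] (q ^ 12) = f2 * f12 / (f4 * f6) * f12"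
    unfolding qpochs by (simp only: list.map prod_list.Cons prod_list.Nil mult_1_right mult.assoc[symmetric] o7 fs)
  moreover have "qpoch [q ^ 2, q ^ 4] (q ^ 6) = f2 / f6" "qpoch [q, q ^ 5] (q ^ 6) = f1 * f6 / (f2 * f3)"
     "qpoch [q ^ 4, q ^ 8] (q ^ 12) = f4 / f12" "qpoch [- (q ^ 3), q ^ 6] (q ^ 6) = f6 ^ 2 / (f3 * f12) * f6"
    unfolding qpochs by (simp_all only: list.map prod_list.Cons prod_list.Nil mult_1_right o6 o8 o9 o3 fs)
  moreover have "qpoch [q ^ 6] (q ^ 6) = f6" "qpoch [- (q ^ 3)] (q ^ 3) = f6 / f3" "qpoch [q] (q ^ 2) = f1 / f2" "qpoch [q ^ 4] (q ^ 4) = f4"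
    "qpoch [q ^ 3] (q ^ 3) = f3" "qpoch [- (q ^ 6)] (q ^ 6) = f12 / f6" "qpoch [- (q ^ 3)] (q ^ 6) = qp (- (q ^ 3)) (q ^ 6)"
    unfolding qpochs by (simp_all only: list.map prod_list.Cons prod_list.Nil mult_1_right o1 o4 o5 fs)
  moreover have "qp (q ^ 6) (q ^ 6) = f6" by (simp only: fs)
  ultimately show ?thesis
    unfolding rank_diff_values[OF q] S S_def[symmetric] 0 1 2 by (simp only: simp_thms)
qed

end
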